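(* Let $H$ be a trace normed Hamiltonian on $[0,\infty)$ and let $m$ be the corresponding $m$-function. Then the following conditions are equivalent: (i) For some $a_0\ge 0$, $b_0\in\mathbb{R}$ and $c_0>0$ with $a_0c_0-b_0^2\ge 0$ one has $$\frac1x\int_0^x H(t)\,dt\to\begin{pmatrix} a_0 & b_0\\ b_0 & c_0\end{pmatrix},\qquad x\to 0.$$ (ii) For some $\zeta_0\in\mathbb{C}$ with $\operatorname{Im}\zeta_0\ge 0$ one has $m(z)\to\zeta_0$ as $z\to\infty$ in any closed sector in $\mathbb{C}_+$. In this case, with $h_0=\sqrt{a_0c_0-b_0^2}$, the quantities are related by $$\zeta_0=\frac{\mathrm{i}h_0-b_0}{c_0},\qquad a_0=\frac{|\zeta_0|^2}{|\zeta_0|^2+1},\quad b_0=\frac{-\operatorname{Re}\zeta_0}{|\zeta_0|^2+1},\quad c_0=\frac{1}{|\zeta_0|^2+1}.$$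
   Context: Let $J=\begin{pmatrix} 0 & -1 \\ 1 & 0 \end{pmatrix}$ and $L\in(0,\infty]$. A Hamiltonian on $[0,L)$ is a function $H=\begin{pmatrix} a & b \\ b & c \end{pmatrix}$ with real-valued, locally integrable entries on $[0,L)$ such that $H(x)\ge 0$ and $H(x)\ne 0$ for almost all $x$, $\int_0^L\operatorname{tr}H(x)\,dx=\infty$, and it is not the case that $b=c=0$ almost everywhere. It is trace normed if $a(x)+c(x)=1$ for almost all $x$. Consider the canonical system $JY'=zHY$ on $[0,L)$, $z\in\mathbb{C}$, and let $U(z,x)$ be its $2\times2$ fundamental matrix solution with $U(z,0)=I_2$. The $m$-function $m:\mathbb{C}\setminus\mathbb{R}\to\mathbb{C}$ is the unique function such that $U(z,\cdot)\begin{pmatrix} 1 \\ m(z) \end{pmatrix}\in L^2([0,L);H)$ for every $z\in\mathbb{C}\setminus\mathbb{R}$, where $f\in L^2([0,L);H)$ means $\int_0^L f^*Hf\,dx<\infty$. It is a Herglotz--Nevanlinna function (holomorphic on $\mathbb{C}\setminus\mathbb{R}$, maps the open upper half-plane $\mathbb{C}_+$ into its closure, $m(\bar z)=\overline{m(z)}$). A closed sector in $\mathbb{C}_+$ is a set $\{z\neq0:\delta_1\le\arg z\le\delta_2\}$ with $0<\delta_1\le\delta_2<\pi$. *)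

theory Defs
  imports "HOL-Analysis.Analysis"
begin

text \<open>
  All functions of the space variable \<open>x\<close> live on \<open>[0,\<infinity>)\<close>; they are total functions on \<open>real\<close> whose
  values at negative arguments are irrelevant.
\<close>

definition pos_semidef :: "real^'n^'n \<Rightarrow> bool" where
  "pos_semidef A \<longleftrightarrow> transpose A = A \<and> (\<forall>v. 0 \<le> v \<bullet> (A *v v))"

definition hamiltonian :: "(real \<Rightarrow> real^2^2) \<Rightarrow> bool" where
  "hamiltonian H \<longleftrightarrow>
     (\<forall>x\<ge>0. transpose (H x) = H x) \<and>
     (\<forall>R\<ge>0. \<forall>i j. (\<lambda>x. H x $ i $ j) absolutely_integrable_on {0..R}) \<and>
     (AE x\<in>{0..} in lebesgue. pos_semidef (H x) \<and> H x \<noteq> 0) \<and>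
     (\<integral>\<^sup>+x\<in>{0..}. ennreal (trace (H x)) \<partial>lebesgue) = \<infinity> \<and>
     \<not> (AE x\<in>{0..} in lebesgue. H x $ 1 $ 2 = 0 \<and> H x $ 2 $ 2 = 0)"

definition trace_normed :: "(real \<Rightarrow> real^2^2) \<Rightarrow> bool" where
  "trace_normed H \<longleftrightarrow> (AE x\<in>{0..} in lebesgue. H x $ 1 $ 1 + H x $ 2 $ 2 = 1)"

definition J :: "complex^2^2" where
  "J = vector [vector [0, -1], vector [1, 0]]"

abbreviation cmatrix :: "real^2^2 \<Rightarrow> complex^2^2" where
  "cmatrix \<equiv> map_matrix complex_of_real"

text \<open>
  Absolute continuity on a closed interval \<open>S\<close>, in the usual \<open>\<epsilon>\<close>-\<open>\<delta>\<close> form: a division is a finite set of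
  nonempty compact intervals \<open>K = [Inf K, Sup K]\<close> with pairwise disjoint interiors, and its union
  \<open>T\<close> may be any subset of \<open>S\<close>.
\<close>

definition abs_continuous_on :: "real set \<Rightarrow> (real \<Rightarrow> 'a::real_normed_vector) \<Rightarrow> bool" where
  "abs_continuous_on S f \<longleftrightarrow>
     (\<forall>\<epsilon>>0. \<exists>\<delta>>0. \<forall>D T. D division_of T \<and> T \<subseteq> S \<and> (\<Sum>K\<in>D. Sup K - Inf K) < \<delta> \<longrightarrow>
        (\<Sum>K\<in>D. norm (f (Sup K) - f (Inf K))) < \<epsilon>)"

text \<open>Solutions of \<open>J Y' = z H Y\<close> are understood in the usual Caratheodory sense.\<close>

definition canonical_solution ::
  "(real \<Rightarrow> real^2^2) \<Rightarrow> complex \<Rightarrow> (real \<Rightarrow> complex^2) \<Rightarrow> bool" where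
  "canonical_solution H z Y \<longleftrightarrow>
     (\<forall>R\<ge>0. abs_continuous_on {0..R} Y) \<and>
     (AE x\<in>{0..} in lebesgue. \<exists>Y'. (Y has_vector_derivative Y') (at x within {0..}) \<and>
        J *v Y' = z *s (cmatrix (H x) *v Y x))"

definition fundamental_solution ::
  "(real \<Rightarrow> real^2^2) \<Rightarrow> (complex \<Rightarrow> real \<Rightarrow> complex^2^2) \<Rightarrow> bool" where
  "fundamental_solution H U \<longleftrightarrow>
     (\<forall>z. U z 0 = mat 1 \<and> (\<forall>j. canonical_solution H z (\<lambda>x. column j (U z x))))"

text \<open>
  The quadratic form \<open>f\<^sup>*Hf\<close> is real and nonnegative almost everywhere, so taking its real part
  below loses nothing.
\<close>

definition in_L2 :: "(real \<Rightarrow> real^2^2) \<Rightarrow> (real \<Rightarrow> complex^2) \<Rightarrow> bool" where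
  "in_L2 H f \<longleftrightarrow>
     set_borel_measurable lebesgue {0..} f \<and>
     (\<integral>\<^sup>+x\<in>{0..}. ennreal (Re (\<Sum>i\<in>UNIV. cnj (f x $ i) * (cmatrix (H x) *v f x) $ i)) \<partial>lebesgue) < \<infinity>"

text \<open>The values of \<open>m\<close> on the real line are irrelevant.\<close>

definition m_function ::
  "(real \<Rightarrow> real^2^2) \<Rightarrow> (complex \<Rightarrow> real \<Rightarrow> complex^2^2) \<Rightarrow> (complex \<Rightarrow> complex) \<Rightarrow> bool" where
  "m_function H U m \<longleftrightarrow> (\<forall>z. z \<notin> \<real> \<longrightarrow> in_L2 H (\<lambda>x. U z x *v vector [1, m z]))"

definition closed_sector :: "real \<Rightarrow> real \<Rightarrow> complex set" where
  "closed_sector \<delta>\<^sub>1 \<delta>\<^sub>2 = {z. z \<noteq> 0 \<and> \<delta>\<^sub>1 \<le> Arg z \<and> Arg z \<le> \<delta>\<^sub>2}"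

definition tendsto_in_sectors :: "(complex \<Rightarrow> complex) \<Rightarrow> complex \<Rightarrow> bool" where
  "tendsto_in_sectors m \<zeta> \<longleftrightarrow>
     (\<forall>\<delta>\<^sub>1 \<delta>\<^sub>2. 0 < \<delta>\<^sub>1 \<and> \<delta>\<^sub>1 \<le> \<delta>\<^sub>2 \<and> \<delta>\<^sub>2 < pi \<longrightarrow>
        (m \<longlongrightarrow> \<zeta>) (inf at_infinity (principal (closed_sector \<delta>\<^sub>1 \<delta>\<^sub>2))))"

definition mean_tendsto :: "(real \<Rightarrow> real^2^2) \<Rightarrow> real^2^2 \<Rightarrow> bool" where
  "mean_tendsto H A \<longleftrightarrow>
     ((\<lambda>x. (1 / x) *\<^sub>R (LINT t:{0..x}|lebesgue. H t)) \<longlongrightarrow> A) (at_right 0)"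

end

theory Submission
  imports Defs "HOL-Complex_Analysis.Great_Picard"
begin

text \<open>
  Rescaling \<open>x\<close> by \<open>|z|\<close> turns the behaviour of \<open>m\<close> at infinity into a question about the Hamiltonians
  \<open>H(x / r)\<close> as \<open>r \<rightarrow> \<infinity>\<close>. Throughout, a solution \<open>y\<close> is controlled by its flux \<open>Im (cnj y1 * y2)\<close>, whose derivative
  is \<open>- Im z * y\<^sup>*Hy\<close>; for the Weyl solution and \<open>Im z > 0\<close> the flux stays nonnegative, so the energy
  \<open>Im z * \<integral> y\<^sup>*Hy\<close> is at most \<open>Im m(z)\<close>.

  If the means of \<open>H\<close> converge, this energy bound, compared with the constant limit Hamiltonian after an
  integration by parts, forces \<open>m(z)\<close> to be close to \<open>\<zeta>\<close>. Conversely, if \<open>m \<rightarrow> \<zeta>\<close>, then along a subsequence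
  the rescaled solutions starting at \<open>(1, \<zeta>)\<close> converge to entire functions of \<open>z\<close> by Montel's theorem. The limit
  has nonnegative flux in both half planes; therefore its Cayley transform is bounded and entire, and hence constant
  by Liouville's theorem, and the first-order term in \<open>z\<close> determines the limit of the means of \<open>H\<close>.
\<close>

section \<open>Absolutely continuous functions\<close>

text \<open>The rescaled Hamiltonians converge only in the mean: H - H0 itself need not become
  small, only its primitive does. Hence the integration by parts, and hence error bounds that see
  \<open>z\<close> and \<open>x\<close> through |z|x, the quantity which rescaling preserves. The
  number \<zeta> is the root of a0 + 2 b0 \<zeta> + c0 \<zeta>^2 = 0 in the closed upper half plane,
  the value of the m-function of the constant Hamiltonian there. In the converse direction no limit
  Hamiltonian is constructed: the limit is taken for the solutions, and only this quadratic equation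
  is read off. Convergence of m gives information for Im z > 0; below the real axis the sign of Im
  \<zeta> and the monotonicity of the flux take over, and Liouville needs both half planes. For
  nonreal \<zeta> the equation and the trace determine the limit of the means; for real \<zeta> the
  imaginary part of the equation is empty, and positivity of the form supplies the missing
  relation.\<close>

lemma abs_continuous_onE:
  assumes "abs_continuous_on S f" "\<epsilon> > 0"
  obtains \<delta> where "\<delta> > 0"
    "\<And>D T. \<lbrakk>D division_of T; T \<subseteq> S; (\<Sum>K\<in>D. Sup K - Inf K) < \<delta>\<rbrakk>
       \<Longrightarrow> (\<Sum>K\<in>D. norm (f (Sup K) - f (Inf K))) < \<epsilon>"
  using assms unfolding abs_continuous_on_def by metis

text \<open>The definition sums over a set of intervals, a gauge argument over tagged intervals. Two
  tags can share an interval only if its interior is empty; such an interval is a point and both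
  summands vanish on it, so the two kinds of sums agree.\<close>

lemma abs_continuous_on_tagged:
  fixes f :: "real \<Rightarrow> 'a::real_normed_vector"
  assumes D: "\<And>D T. \<lbrakk>D division_of T; T \<subseteq> S; (\<Sum>K\<in>D. Sup K - Inf K) < \<delta>\<rbrakk>
       \<Longrightarrow> (\<Sum>K\<in>D. norm (f (Sup K) - f (Inf K))) < \<epsilon>"
    and p: "p tagged_partial_division_of S"
    and small: "(\<Sum>(x,K)\<in>p. Sup K - Inf K) < \<delta>"
  shows "(\<Sum>(x,K)\<in>p. norm (f (Sup K) - f (Inf K))) < \<epsilon>"
proof -
  have *: "(\<Sum>(x,K)\<in>p. h K) = (\<Sum>K\<in>snd ` p. h K)"
    if h: "\<And>u. h {u} = 0" for h :: "real set \<Rightarrow> real"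
  proof -
    \<comment> \<open>\<open>Inf\<close> and \<open>Sup\<close> of the empty set are unspecified,
      while the lemma on sums over tagged divisions also asks for the value 0 there.\<close>
    define h' where "h' K = (if K = {} then 0 else h K)" for K
    have ne: "K \<noteq> {}" if "(x,K) \<in> p" for x K
      using tagged_partial_division_ofD(2)[OF p that] by auto
    have "(\<Sum>(x,K)\<in>p. h K) = (\<Sum>(x,K)\<in>p. h' K)"
      using ne by (intro sum.cong) (auto simp: h'_def)
    also have "\<dots> = (\<Sum>K\<in>snd ` p. h' K)"
    proof (rule sum.over_tagged_division_lemma[OF tagged_partial_division_of_Union_self[OF p]])
      fix u v :: real assume "box u v = {}"
      then have "cbox u v = {} \<or> cbox u v = {u}" by (auto simp: box_real)
      then show "h' (cbox u v) = 0" using h by (auto simp: h'_def)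
    qed
    also have "\<dots> = (\<Sum>K\<in>snd ` p. h K)"
      using ne by (intro sum.cong) (auto simp: h'_def)
    finally show ?thesis .
  qed
  have div: "(snd ` p) division_of (\<Union>(snd ` p))"
    using division_of_tagged_division[OF tagged_partial_division_of_Union_self[OF p]] .
  have sub: "\<Union>(snd ` p) \<subseteq> S"
    using tagged_partial_division_ofD(3)[OF p] by fastforce
  show ?thesis
    using D[OF div sub] small *[of "\<lambda>K. Sup K - Inf K"] *[of "\<lambda>K. norm (f (Sup K) - f (Inf K))"]
    by simp
qed

text \<open>
  As for the usual gauge proof, except that the tags in the exceptional null set are confined to
  an open set of small measure, where absolute continuity bounds their contribution.
\<close>

theorem fundamental_theorem_of_calculus_abs_continuous:
  fixes f :: "real \<Rightarrow> 'a::banach"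
  assumes "a \<le> b" and ac: "abs_continuous_on {a..b} f"
    and ae: "AE x\<in>{a..b} in lebesgue. (f has_vector_derivative f' x) (at x within {a..b})"
  shows "(f' has_integral (f b - f a)) {a..b}"
proof -
  obtain N where N: "negligible N"
    "\<And>x. x \<in> {a..b} - N \<Longrightarrow> (f has_vector_derivative f' x) (at x within {a..b})"
  proof -
    obtain N where N1: "{x \<in> space lebesgue. \<not> (x \<in> {a..b} \<longrightarrow> (f has_vector_derivative f' x) (at x within {a..b}))} \<subseteq> N"
      "N \<in> null_sets lebesgue"
      using ae unfolding eventually_ae_filter by blast
    then have "negligible N" by (simp add: negligible_iff_null_sets)
    then show ?thesis using that N1(1) by auto
  qed
  \<comment> \<open>With value 0 at tags in \<open>N\<close>, the error there is just the increment
    of \<open>f\<close>, which absolute continuity controls.\<close>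
  define f'' where "f'' x = (if x \<in> N then 0 else f' x)" for x
  have "(f'' has_integral (f b - f a)) {a..b}"
    unfolding has_integral_real
  proof (intro allI impI)
    fix e :: real assume e: "e > 0"
    obtain \<delta> where \<delta>: "\<delta> > 0"
      "\<And>D T. \<lbrakk>D division_of T; T \<subseteq> {a..b}; (\<Sum>K\<in>D. Sup K - Inf K) < \<delta>\<rbrakk>
       \<Longrightarrow> (\<Sum>K\<in>D. norm (f (Sup K) - f (Inf K))) < e/2"
      using abs_continuous_onE[OF ac, of "e/2"] e by auto
    have Nl: "N \<in> sets lebesgue" using N(1) negligible_imp_sets by blast
    obtain G where G: "open G" "N \<subseteq> G" "G - N \<in> lmeasurable" "emeasure lebesgue (G - N) < ennreal \<delta>"
      using sets_lebesgue_outer_open[OF Nl \<delta>(1)] by blast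
    have G_eq: "G = (G - N) \<union> N" using G(2) by auto
    have Gm: "G \<in> lmeasurable"
      using G(3) negligible_imp_measurable[OF N(1)] by (subst G_eq) (rule fmeasurable.Un)
    have Gms: "measure lebesgue G < \<delta>"
    proof -
      have "emeasure lebesgue G = emeasure lebesgue (G - N)"
        using N(1) G(3) by (subst G_eq) (intro emeasure_Un_null_set, auto simp: negligible_iff_null_sets)
      then show ?thesis using G(4) Gm \<delta>(1)
        by (metis emeasure_eq_measure2 ennreal_less_iff measure_nonneg)
    qed
    \<comment> \<open>Half of \<open>e\<close> spread over the interval; the summand 1 keeps the
      denominator positive when a = b.\<close>
    define e' where "e' = e / (2 * (b - a + 1))"
    have e': "e' > 0" using e \<open>a \<le> b\<close> by (simp add: e'_def)
    have "\<forall>x. \<exists>d>0. x \<in> {a..b} - N \<longrightarrow>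
         (\<forall>y\<in>{a..b}. norm (y-x) < d \<longrightarrow> norm (f y - f x - (y-x) *\<^sub>R f' x) \<le> e' * norm (y-x))"
      using N(2)[unfolded has_vector_derivative_def has_derivative_within_alt] e'
      by (metis zero_less_one)
    then obtain d where d: "\<And>x. 0 < d x"
                 "\<And>x y. \<lbrakk>x \<in> {a..b}; x \<notin> N; y \<in> {a..b}; norm (y-x) < d x\<rbrakk>
                        \<Longrightarrow> norm (f y - f x - (y-x) *\<^sub>R f' x) \<le> e' * norm (y-x)"
      by (metis DiffI)
    have "\<forall>x. \<exists>r>0. x \<in> N \<longrightarrow> ball x r \<subseteq> G"
      using G(1,2) by (metis open_contains_ball subsetD zero_less_one)
    then obtain r where r: "\<And>x. 0 < r x" "\<And>x. x \<in> N \<Longrightarrow> ball x (r x) \<subseteq> G" by metis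
    define \<gamma> where "\<gamma> x = ball x (if x \<in> N then r x else d x)" for x
    have gauge: "gauge \<gamma>" unfolding \<gamma>_def
      using d(1) r(1) by (intro gauge_ball_dependent) auto
    show "\<exists>\<gamma>. gauge \<gamma> \<and> (\<forall>\<D>. \<D> tagged_division_of {a..b} \<and> \<gamma> fine \<D> \<longrightarrow>
             norm ((\<Sum>(x, K)\<in>\<D>. measure lborel K *\<^sub>R f'' x) - (f b - f a)) < e)"
    proof (intro exI[of _ \<gamma>] conjI allI impI gauge)
      fix p assume "p tagged_division_of {a..b} \<and> \<gamma> fine p"
      then have p: "p tagged_division_of {a..b}" and fine: "\<gamma> fine p" by auto
      have finp: "finite p" using p by auto
      define p1 where "p1 = {(x,K) \<in> p. x \<in> N}"
      define p2 where "p2 = {(x,K) \<in> p. x \<notin> N}"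
      have pp: "p = p1 \<union> p2" "p1 \<inter> p2 = {}" by (auto simp: p1_def p2_def)
      have fin: "finite p1" "finite p2" using finp pp by auto
      have cell: "\<exists>u v. K = {u..v} \<and> u \<le> v \<and> x \<in> {u..v} \<and> u \<in> {a..b} \<and> v \<in> {a..b} \<and> measure lborel K = v - u
          \<and> Sup K = v \<and> Inf K = u" if xK: "(x,K) \<in> p" for x K
      proof -
        obtain u v :: real where K: "K = cbox u v" using tagged_division_ofD(4)[OF p xK] by blast
        have "x \<in> K" "K \<subseteq> {a..b}" using tagged_division_ofD(2,3)[OF p xK] by auto
        then have "u \<le> v" "K = {u..v}" using K by auto
        then show ?thesis using \<open>x \<in> K\<close> \<open>K \<subseteq> {a..b}\<close> by (intro exI[of _ u] exI[of _ v]) auto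
      qed
      have fb: "f b - f a = (\<Sum>(x,K)\<in>p. f (Sup K) - f (Inf K))"
        using additive_tagged_division_1[OF \<open>a \<le> b\<close> p, of f] by simp
      have ba: "b - a = (\<Sum>(x,K)\<in>p. Sup K - Inf K)"
        using additive_tagged_division_1[OF \<open>a \<le> b\<close> p, of "\<lambda>x. x"] by simp
      have p1part: "p1 tagged_partial_division_of {a..b}"
        using tagged_partial_division_subset[of p "{a..b}" p1] p pp
        by (auto simp: tagged_division_of_def)
      have small: "(\<Sum>(x,K)\<in>p1. Sup K - Inf K) < \<delta>"
      proof -
        have t: "p1 tagged_division_of (\<Union>(snd ` p1))"
          by (rule tagged_partial_division_of_Union_self[OF p1part])
        have "(\<Sum>(x,K)\<in>p1. Sup K - Inf K) = (\<Sum>(x,K)\<in>p1. measure lborel K)"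
          using cell pp by (intro sum.cong) fastforce+
        also have "\<dots> = (\<Sum>K\<in>snd ` p1. measure lborel K)"
          by (rule sum.over_tagged_division_lemma[OF t]) (simp add: content_eq_0_interior interior_cbox)
        also have "\<dots> = measure lebesgue (\<Union>(snd ` p1))"
          using content_division[OF division_of_tagged_division[OF t]] division_ofD(4)[OF division_of_tagged_division[OF t]]
          by (metis (no_types, lifting) sum.cong measure_completion lborelD borel_closed closed_cbox sets_lborel)
        also have "\<dots> \<le> measure lebesgue G"
        proof (rule measure_mono_fmeasurable[OF _ _ Gm])
          show "\<Union>(snd ` p1) \<in> sets lebesgue"
            using lmeasurable_division[OF division_of_tagged_division[OF t]] by auto
          show "\<Union>(snd ` p1) \<subseteq> G"
          proof safe
            fix x K y assume "(x,K) \<in> p1" "y \<in> snd (x,K)"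
            then have "x \<in> N" "K \<subseteq> \<gamma> x" "y \<in> K" using fine by (auto simp: p1_def fine_def)
            then show "y \<in> G" using r(2)[of x] by (auto simp: \<gamma>_def)
          qed
        qed
        finally show ?thesis using Gms by simp
      qed
      have s1: "(\<Sum>(x,K)\<in>p1. norm (f (Sup K) - f (Inf K))) < e/2"
        by (rule abs_continuous_on_tagged[OF \<delta>(2) p1part small])
      have s2: "norm (measure lborel K *\<^sub>R f'' x - (f (Sup K) - f (Inf K))) \<le> e' * (Sup K - Inf K)"
        if xK: "(x,K) \<in> p2" for x K
      proof -
        have xN: "x \<notin> N" and xp: "(x,K) \<in> p" using xK by (auto simp: p2_def)
        obtain u v where uv: "K = {u..v}" "u \<le> v" "x \<in> {u..v}" "u \<in> {a..b}" "v \<in> {a..b}"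
          "measure lborel K = v - u" "Sup K = v" "Inf K = u" using cell[OF xp] by blast
        have xab: "x \<in> {a..b}" using uv by auto
        have "K \<subseteq> ball x (d x)" using bspec[OF fine[unfolded fine_def] xp] xN by (simp add: \<gamma>_def)
        then have nu: "norm (u - x) < d x" "norm (v - x) < d x"
          using uv(1,2) by (auto simp: dist_real_def subset_iff)
        \<comment> \<open>Straddle estimate: the tag x lies between u and v, so |u - x| + |v - x| =
          v - u.\<close>
        have "norm ((v - u) *\<^sub>R f' x - (f v - f u)) = norm (f u - f x - (u - x) *\<^sub>R f' x - (f v - f x - (v - x) *\<^sub>R f' x))"
          by (auto simp: algebra_simps)
        also have "\<dots> \<le> norm (f u - f x - (u - x) *\<^sub>R f' x) + norm (f v - f x - (v - x) *\<^sub>R f' x)"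
          by (rule norm_triangle_ineq4)
        also have "\<dots> \<le> e' * norm (u - x) + e' * norm (v - x)"
          using d(2)[OF xab xN uv(4) nu(1)] d(2)[OF xab xN uv(5) nu(2)] by simp
        also have "\<dots> = e' * (v - u)" using uv(3) by (simp add: algebra_simps)
        finally show ?thesis using uv xN by (simp add: f''_def)
      qed
      have s3: "norm (measure lborel K *\<^sub>R f'' x - (f (Sup K) - f (Inf K))) \<le> norm (f (Sup K) - f (Inf K))"
        if "(x,K) \<in> p1" for x K
        using that by (simp add: p1_def f''_def norm_minus_commute)
      have "(\<Sum>(x, K)\<in>p. measure lborel K *\<^sub>R f'' x) - (f b - f a)
          = (\<Sum>(x,K)\<in>p. measure lborel K *\<^sub>R f'' x - (f (Sup K) - f (Inf K)))"
        unfolding fb by (simp add: sum_subtractf case_prod_unfold)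
      also have "\<dots> = (\<Sum>(x,K)\<in>p1. measure lborel K *\<^sub>R f'' x - (f (Sup K) - f (Inf K)))
            + (\<Sum>(x,K)\<in>p2. measure lborel K *\<^sub>R f'' x - (f (Sup K) - f (Inf K)))"
        using fin pp(2) unfolding pp(1) by (rule sum.union_disjoint)
      finally have "norm ((\<Sum>(x, K)\<in>p. measure lborel K *\<^sub>R f'' x) - (f b - f a))
          \<le> norm (\<Sum>(x,K)\<in>p1. measure lborel K *\<^sub>R f'' x - (f (Sup K) - f (Inf K)))
            + norm (\<Sum>(x,K)\<in>p2. measure lborel K *\<^sub>R f'' x - (f (Sup K) - f (Inf K)))"
        by (simp add: norm_triangle_ineq)
      also have "\<dots> \<le> (\<Sum>(x,K)\<in>p1. norm (f (Sup K) - f (Inf K))) + (\<Sum>(x,K)\<in>p2. e' * (Sup K - Inf K))"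
        using s2 s3 by (intro add_mono sum_norm_le) auto
      also have "(\<Sum>(x,K)\<in>p2. e' * (Sup K - Inf K)) \<le> (\<Sum>(x,K)\<in>p. e' * (Sup K - Inf K))"
        using finp pp cell e' by (intro sum_mono2) fastforce+
      also have "\<dots> = e' * (b - a)" by (simp add: ba sum_distrib_left case_prod_unfold)
      also have "\<dots> \<le> e / 2" using e \<open>a \<le> b\<close> by (simp add: e'_def field_simps)
      finally show "norm ((\<Sum>(x, K)\<in>p. measure lborel K *\<^sub>R f'' x) - (f b - f a)) < e"
        using s1 by simp
    qed
  qed
  then show ?thesis
    by (rule has_integral_spike[OF N(1), rotated]) (auto simp: f''_def)
qed

section \<open>Closure properties of absolute continuity\<close>

lemma division_member_real:
  fixes S :: "real set"
  assumes "D division_of T" "T \<subseteq> S" "K \<in> D"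
  shows "Sup K \<in> S" "Inf K \<in> S" "Inf K \<le> Sup K"
proof -
  obtain u v :: real where "K = cbox u v" "K \<noteq> {}" "K \<subseteq> T"
    using division_ofD(2)[OF assms(1,3)] division_ofD(3)[OF assms(1,3)] division_ofD(4)[OF assms(1,3)]
    by auto
  then show "Sup K \<in> S" "Inf K \<in> S" "Inf K \<le> Sup K" using assms(2) by auto
qed

text \<open>One comparison principle from which sums, products and Lipschitz images all
  follow.\<close>

lemma abs_continuous_on_dominated:
  fixes f :: "real \<Rightarrow> 'a::real_normed_vector" and g :: "real \<Rightarrow> 'b::real_normed_vector"
    and h :: "real \<Rightarrow> 'c::real_normed_vector"
  assumes f: "abs_continuous_on S f" and g: "abs_continuous_on S g"
    and h: "\<And>u v. \<lbrakk>u \<in> S; v \<in> S\<rbrakk> \<Longrightarrow> norm (h u - h v) \<le> M * (norm (f u - f v) + norm (g u - g v))"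
  shows "abs_continuous_on S h"
  unfolding abs_continuous_on_def
proof (intro allI impI)
  fix \<epsilon> :: real assume \<epsilon>: "\<epsilon> > 0"
  define M' where "M' = \<bar>M\<bar> + 1"
  have M': "M' > 0" by (simp add: M'_def)
  define e where "e = \<epsilon> / (2 * M')"
  have e: "e > 0" using \<epsilon> M' by (simp add: e_def)
  obtain \<delta>1 where \<delta>1: "\<delta>1 > 0" "\<And>D T. \<lbrakk>D division_of T; T \<subseteq> S; (\<Sum>K\<in>D. Sup K - Inf K) < \<delta>1\<rbrakk>
       \<Longrightarrow> (\<Sum>K\<in>D. norm (f (Sup K) - f (Inf K))) < e"
    using abs_continuous_onE[OF f e] by blast
  obtain \<delta>2 where \<delta>2: "\<delta>2 > 0" "\<And>D T. \<lbrakk>D division_of T; T \<subseteq> S; (\<Sum>K\<in>D. Sup K - Inf K) < \<delta>2\<rbrakk>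
       \<Longrightarrow> (\<Sum>K\<in>D. norm (g (Sup K) - g (Inf K))) < e"
    using abs_continuous_onE[OF g e] by blast
  show "\<exists>\<delta>>0. \<forall>D T. D division_of T \<and> T \<subseteq> S \<and> (\<Sum>K\<in>D. Sup K - Inf K) < \<delta> \<longrightarrow>
        (\<Sum>K\<in>D. norm (h (Sup K) - h (Inf K))) < \<epsilon>"
  proof (intro exI[of _ "min \<delta>1 \<delta>2"] conjI allI impI)
    fix D T assume *: "D division_of T \<and> T \<subseteq> S \<and> (\<Sum>K\<in>D. Sup K - Inf K) < min \<delta>1 \<delta>2"
    have "(\<Sum>K\<in>D. norm (h (Sup K) - h (Inf K)))
        \<le> (\<Sum>K\<in>D. M' * (norm (f (Sup K) - f (Inf K)) + norm (g (Sup K) - g (Inf K))))"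
    proof (rule sum_mono)
      fix K assume "K \<in> D"
      then have "Sup K \<in> S" "Inf K \<in> S"
        using division_member_real(1,2)[OF conjunct1[OF *] conjunct1[OF conjunct2[OF *]]] by auto
      then have "norm (h (Sup K) - h (Inf K)) \<le> M * (norm (f (Sup K) - f (Inf K)) + norm (g (Sup K) - g (Inf K)))"
        by (rule h)
      also have "\<dots> \<le> M' * (norm (f (Sup K) - f (Inf K)) + norm (g (Sup K) - g (Inf K)))"
        by (intro mult_right_mono) (auto simp: M'_def)
      finally show "norm (h (Sup K) - h (Inf K)) \<le> \<dots>" .
    qed
    also have "\<dots> = M' * ((\<Sum>K\<in>D. norm (f (Sup K) - f (Inf K))) + (\<Sum>K\<in>D. norm (g (Sup K) - g (Inf K))))"
      by (simp only: sum_distrib_left[symmetric] sum.distrib)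
    also have "\<dots> < M' * (e + e)"
      using \<delta>1(2)[of D T] \<delta>2(2)[of D T] * M' by (intro mult_strict_left_mono add_strict_mono) auto
    also have "\<dots> = \<epsilon>" using M' by (simp add: e_def)
    finally show "(\<Sum>K\<in>D. norm (h (Sup K) - h (Inf K))) < \<epsilon>" .
  qed (use \<delta>1 \<delta>2 in auto)
qed

lemma abs_continuous_on_subset:
  "abs_continuous_on S f \<Longrightarrow> T \<subseteq> S \<Longrightarrow> abs_continuous_on T f"
  unfolding abs_continuous_on_def by (meson order_trans)

lemma abs_continuous_on_id: "abs_continuous_on S (\<lambda>x. x)"
  unfolding abs_continuous_on_def
proof (intro allI impI)
  fix \<epsilon> :: real assume \<epsilon>: "\<epsilon> > 0"
  have "(\<Sum>K\<in>D. norm (Sup K - Inf K)) = (\<Sum>K\<in>D. Sup K - Inf K)" if "D division_of T" for D and T :: "real set"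
    using division_member_real(3)[OF that subset_refl] by (intro sum.cong) auto
  with \<epsilon> show "\<exists>\<delta>>0. \<forall>D T. D division_of T \<and> T \<subseteq> S \<and> (\<Sum>K\<in>D. Sup K - Inf K) < \<delta> \<longrightarrow>
            (\<Sum>K\<in>D. norm (Sup K - Inf K)) < \<epsilon>" by auto
qed

lemma abs_continuous_on_Lipschitz_compose:
  assumes "abs_continuous_on S f"
    and "\<And>u v. \<lbrakk>u \<in> S; v \<in> S\<rbrakk> \<Longrightarrow> norm (h u - h v) \<le> M * norm (f u - f v)"
  shows "abs_continuous_on S h"
proof (rule abs_continuous_on_dominated[OF assms(1) assms(1)])
  fix u v assume "u \<in> S" "v \<in> S"
  then show "norm (h u - h v) \<le> (M/2) * (norm (f u - f v) + norm (f u - f v))" using assms(2) by simp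
qed

lemma abs_continuous_on_const: "abs_continuous_on S (\<lambda>x. c)"
  by (rule abs_continuous_on_Lipschitz_compose[OF abs_continuous_on_id, of _ _ 0]) auto

lemma abs_continuous_on_bounded_linear:
  assumes "bounded_linear F" "abs_continuous_on S f"
  shows "abs_continuous_on S (\<lambda>x. F (f x))"
proof -
  obtain M where M: "\<And>x. norm (F x) \<le> norm x * M" using bounded_linear.bounded[OF assms(1)] by blast
  show ?thesis
  proof (rule abs_continuous_on_Lipschitz_compose[OF assms(2)])
    fix u v show "norm (F (f u) - F (f v)) \<le> M * norm (f u - f v)"
      using M[of "f u - f v"] by (simp add: linear_diff[OF bounded_linear.linear[OF assms(1)]] mult.commute)
  qed
qed

lemma abs_continuous_on_add:
  assumes "abs_continuous_on S f" "abs_continuous_on S g"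
  shows "abs_continuous_on S (\<lambda>x. f x + g x)"
proof (rule abs_continuous_on_dominated[OF assms])
  fix u v show "norm (f u + g u - (f v + g v)) \<le> 1 * (norm (f u - f v) + norm (g u - g v))"
    by (simp add: norm_diff_triangle_ineq)
qed

lemma abs_continuous_on_minus:
  "abs_continuous_on S f \<Longrightarrow> abs_continuous_on S (\<lambda>x. - f x)"
  by (rule abs_continuous_on_bounded_linear[OF bounded_linear_minus[OF bounded_linear_ident]])

lemma abs_continuous_on_diff:
  assumes "abs_continuous_on S f" "abs_continuous_on S g"
  shows "abs_continuous_on S (\<lambda>x. f x - g x)"
  using abs_continuous_on_add[OF assms(1) abs_continuous_on_minus[OF assms(2)]] by simp

lemma abs_continuous_on_imp_continuous_on:
  fixes f :: "real \<Rightarrow> 'a::real_normed_vector"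
  assumes "abs_continuous_on {a..b} f"
  shows "continuous_on {a..b} f"
  unfolding continuous_on_iff
proof (intro ballI allI impI)
  fix x e :: real assume x: "x \<in> {a..b}" and e: "e > 0"
  obtain \<delta> where \<delta>: "\<delta> > 0" "\<And>D T. \<lbrakk>D division_of T; T \<subseteq> {a..b}; (\<Sum>K\<in>D. Sup K - Inf K) < \<delta>\<rbrakk>
       \<Longrightarrow> (\<Sum>K\<in>D. norm (f (Sup K) - f (Inf K))) < e"
    using abs_continuous_onE[OF assms e] by blast
  have *: "dist (f v) (f u) < e" if "u \<le> v" "u \<in> {a..b}" "v \<in> {a..b}" "v - u < \<delta>" for u v
  proof -
    have "{cbox u v} division_of cbox u v" using that by (intro division_of_self) auto
    from \<delta>(2)[OF this] that show ?thesis by (auto simp: dist_norm)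
  qed
  show "\<exists>d>0. \<forall>x'\<in>{a..b}. dist x' x < d \<longrightarrow> dist (f x') (f x) < e"
  proof (intro exI[of _ \<delta>] conjI ballI impI \<delta>(1))
    fix x' assume x': "x' \<in> {a..b}" "dist x' x < \<delta>"
    then show "dist (f x') (f x) < e"
      using *[of x x'] *[of x' x] x by (cases "x \<le> x'") (auto simp: dist_real_def dist_commute)
  qed
qed

lemma abs_continuous_on_imp_bounded:
  fixes f :: "real \<Rightarrow> 'a::real_normed_vector"
  assumes "abs_continuous_on {a..b} f"
  obtains B where "B > 0" "\<And>x. x \<in> {a..b} \<Longrightarrow> norm (f x) \<le> B"
proof -
  have "bounded (f ` {a..b})"
    using abs_continuous_on_imp_continuous_on[OF assms] by (simp add: compact_continuous_image compact_imp_bounded)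
  then show ?thesis using that unfolding bounded_pos by blast
qed

text \<open>On a compact interval both factors are bounded, and multiplication is Lipschitz on
  bounded sets.\<close>

lemma abs_continuous_on_mult:
  fixes f g :: "real \<Rightarrow> 'a::real_normed_algebra"
  assumes f: "abs_continuous_on {a..b} f" and g: "abs_continuous_on {a..b} g"
  shows "abs_continuous_on {a..b} (\<lambda>x. f x * g x)"
proof -
  obtain A where A: "A > 0" "\<And>x. x \<in> {a..b} \<Longrightarrow> norm (f x) \<le> A" using abs_continuous_on_imp_bounded[OF f] by blast
  obtain B where B: "B > 0" "\<And>x. x \<in> {a..b} \<Longrightarrow> norm (g x) \<le> B" using abs_continuous_on_imp_bounded[OF g] by blast
  show ?thesis
  proof (rule abs_continuous_on_dominated[OF f g])
    fix u v assume uv: "u \<in> {a..b}" "v \<in> {a..b}"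
    have "norm (f u * g u - f v * g v) = norm ((f u - f v) * g u + f v * (g u - g v))"
      by (simp add: algebra_simps)
    also have "\<dots> \<le> norm (f u - f v) * norm (g u) + norm (f v) * norm (g u - g v)"
      by (rule order_trans[OF norm_triangle_ineq add_mono[OF norm_mult_ineq norm_mult_ineq]])
    also have "\<dots> \<le> norm (f u - f v) * B + A * norm (g u - g v)"
      by (intro add_mono mult_left_mono mult_right_mono A(2)[OF uv(2)] B(2)[OF uv(1)] norm_ge_zero)
    also have "\<dots> \<le> norm (f u - f v) * (A + B) + (A + B) * norm (g u - g v)"
      using A(1) B(1) by (intro add_mono mult_left_mono mult_right_mono) auto
    finally show "norm (f u * g u - f v * g v) \<le> (A + B) * (norm (f u - f v) + norm (g u - g v))"
      by (simp add: algebra_simps)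
  qed
qed

lemma abs_continuous_on_exp:
  fixes f :: "real \<Rightarrow> 'a::{real_normed_field,banach}"
  assumes f: "abs_continuous_on {a..b} f"
  shows "abs_continuous_on {a..b} (\<lambda>x. exp (f x))"
proof -
  obtain B where B: "B > 0" "\<And>x. x \<in> {a..b} \<Longrightarrow> norm (f x) \<le> B" using abs_continuous_on_imp_bounded[OF f] by blast
  show ?thesis
  proof (rule abs_continuous_on_Lipschitz_compose[OF f, where M="exp B"])
    fix u v assume "u \<in> {a..b}" "v \<in> {a..b}"
    then have uv: "f u \<in> cball 0 B" "f v \<in> cball 0 B" using B(2) by auto
    show "norm (exp (f u) - exp (f v)) \<le> exp B * norm (f u - f v)"
    proof (rule field_differentiable_bound[OF convex_cball _ _ uv])
      fix w :: 'a assume "w \<in> cball 0 B"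
      then show "norm (exp w) \<le> exp B" using norm_exp[of w] by (simp add: order_trans)
    qed (rule has_field_derivative_at_within[OF DERIV_exp])
  qed
qed

lemmas abs_continuous_on_Re = abs_continuous_on_bounded_linear[OF bounded_linear_Re]
lemmas abs_continuous_on_Im = abs_continuous_on_bounded_linear[OF bounded_linear_Im]
lemmas abs_continuous_on_cnj = abs_continuous_on_bounded_linear[OF bounded_linear_cnj]
lemmas abs_continuous_on_of_real = abs_continuous_on_bounded_linear[OF bounded_linear_of_real]

lemmas ac_intros = abs_continuous_on_add abs_continuous_on_diff abs_continuous_on_minus
  abs_continuous_on_mult abs_continuous_on_Re abs_continuous_on_Im abs_continuous_on_cnj
  abs_continuous_on_of_real abs_continuous_on_const abs_continuous_on_id

lemmas vd_intros = has_vector_derivative_add has_vector_derivative_diff has_vector_derivative_minus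
  has_vector_derivative_mult bounded_linear.has_vector_derivative[OF bounded_linear_Re]
  bounded_linear.has_vector_derivative[OF bounded_linear_Im]
  bounded_linear.has_vector_derivative[OF bounded_linear_cnj]
  bounded_linear.has_vector_derivative[OF bounded_linear_of_real] has_vector_derivative_const has_vector_derivative_id

section \<open>Mean value inequalities with derivative bounds almost everywhere\<close>

text \<open>The derivative is asked for existentially at almost every point, so that it can be
  supplied inside an \<open>AE\<close> proof, point by point, instead of as one global
  function.\<close>

lemma norm_increment_le_abs_continuous:
  fixes f :: "real \<Rightarrow> 'a::banach"
  assumes "a \<le> b" "0 \<le> B" "abs_continuous_on {a..b} f"
    and ae: "AE x\<in>{a..b} in lebesgue. \<exists>d. (f has_vector_derivative d) (at x within {a..b}) \<and> norm d \<le> B"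
  shows "norm (f b - f a) \<le> B * (b - a)"
proof -
  define P where "P x d \<longleftrightarrow> (f has_vector_derivative d) (at x within {a..b}) \<and> norm d \<le> B" for x d
  \<comment> \<open>The default 0 respects the bound by \<open>B\<close>, which therefore holds
    everywhere.\<close>
  define f' where "f' x = (if \<exists>d. P x d then SOME d. P x d else 0)" for x
  have P: "P x (f' x)" if "\<exists>d. P x d" for x
    using that someI_ex[of "P x"] by (simp add: f'_def)
  have bd: "norm (f' x) \<le> B" for x
  proof (cases "\<exists>d. P x d")
    case True
    then show ?thesis using P[of x] unfolding P_def by blast
  next
    case False
    then have "f' x = 0" unfolding f'_def by (rule if_not_P)
    then show ?thesis using \<open>0 \<le> B\<close> by simp
  qed
  have "(f' has_integral (f b - f a)) {a..b}"
  proof (rule fundamental_theorem_of_calculus_abs_continuous[OF assms(1,3)])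
    show "AE x\<in>{a..b} in lebesgue. (f has_vector_derivative f' x) (at x within {a..b})"
      using ae
    proof eventually_elim
      case (elim x)
      then show ?case using P[of x] unfolding P_def by blast
    qed
  qed
  from has_integral_bound_real[OF \<open>0 \<le> B\<close> finite.emptyI this] bd \<open>a \<le> b\<close> show ?thesis
    by (simp add: content_real)
qed

lemma increment_le_abs_continuous:
  fixes f :: "real \<Rightarrow> real"
  assumes "a \<le> b" "abs_continuous_on {a..b} f"
    and ae: "AE x\<in>{a..b} in lebesgue. \<exists>d. (f has_vector_derivative d) (at x within {a..b}) \<and> d \<le> B"
  shows "f b - f a \<le> B * (b - a)"
proof -
  define P where "P x d \<longleftrightarrow> (f has_vector_derivative d) (at x within {a..b}) \<and> d \<le> B" for x d
  \<comment> \<open>Here the default has to be \<open>B\<close> itself: the bound is one-sided and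
    \<open>B\<close> may be negative.\<close>
  define f' where "f' x = (if \<exists>d. P x d then SOME d. P x d else B)" for x
  have P: "P x (f' x)" if "\<exists>d. P x d" for x
    using that someI_ex[of "P x"] by (simp add: f'_def)
  have bd: "f' x \<le> B" for x
  proof (cases "\<exists>d. P x d")
    case True
    then show ?thesis using P[of x] unfolding P_def by blast
  next
    case False
    then have "f' x = B" unfolding f'_def by (rule if_not_P)
    then show ?thesis by simp
  qed
  have i: "(f' has_integral (f b - f a)) {a..b}"
  proof (rule fundamental_theorem_of_calculus_abs_continuous[OF assms(1,2)])
    show "AE x\<in>{a..b} in lebesgue. (f has_vector_derivative f' x) (at x within {a..b})"
      using ae
    proof eventually_elim
      case (elim x)
      then show ?case using P[of x] unfolding P_def by blast
    qed
  qed
  have c: "((\<lambda>x. B) has_integral (B * (b - a))) {a..b}"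
    using has_integral_const_real[of B a b] \<open>a \<le> b\<close> by (simp add: mult.commute)
  show ?thesis using has_integral_le[OF i c] bd by blast
qed

section \<open>The canonical system in components\<close>

text \<open>The expression is the trace of the product of two positive semidefinite matrices. The
  mixed term is controlled by (2bB)^2 <= 4(aA)(cC) <= (aA + cC)^2.\<close>

lemma psd_form_nonneg:
  fixes a b c A B C :: real
  assumes "0 \<le> a" "0 \<le> c" "b\<^sup>2 \<le> a * c" "0 \<le> A" "0 \<le> C" "B\<^sup>2 \<le> A * C"
  shows "0 \<le> a * A + 2 * b * B + c * C"
proof -
  have "(2 * b * B)\<^sup>2 = 4 * (b\<^sup>2 * B\<^sup>2)" by (simp add: power2_eq_square)
  also have "\<dots> \<le> 4 * ((a * c) * (A * C))"
    using assms by (intro mult_left_mono mult_mono) auto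
  also have "\<dots> = 4 * ((a * A) * (c * C))" by simp
  also have "\<dots> \<le> (a * A + c * C)\<^sup>2"
    using zero_le_power2[of "a * A - c * C"] unfolding power2_sum power2_diff by linarith
  finally have "\<bar>2 * b * B\<bar> \<le> \<bar>a * A + c * C\<bar>" by (simp only: abs_le_square_iff)
  moreover have "0 \<le> a * A + c * C" using assms by simp
  ultimately show ?thesis by linarith
qed

lemma cnj_mult_norm_sq: "(Re (cnj u * v))\<^sup>2 + (Im (cnj u * v))\<^sup>2 = (cmod u)\<^sup>2 * (cmod v)\<^sup>2"
  unfolding cmod_power2 by (simp add: power2_eq_square algebra_simps)

text \<open>This is y*Hy for y = (u, v) and H with rows (a, b) and (b, c), in real terms.\<close>

definition energy_density :: "real \<Rightarrow> real \<Rightarrow> real \<Rightarrow> complex \<Rightarrow> complex \<Rightarrow> real" where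
  "energy_density a b c u v = a * (cmod u)\<^sup>2 + 2 * b * Re (cnj u * v) + c * (cmod v)\<^sup>2"

text \<open>Let G be the real part of the rank one matrix y y*, with entries A, B, C as named in the
  proof. The density is tr(HG), and det G is the square of the flux. For tr H = 1 the matrix H and
  its adjugate add up to the identity, so positivity against the adjugate gives the upper bound. The
  lower bound is Cayley-Hamilton for G: tr G tr(HG) = tr(HG^2) + det G. The last bound is
  Cauchy-Schwarz with |Hy|^2 <= y*Hy, which is Cayley-Hamilton for H; its left side is what occurs
  in the derivative of |y|^2.\<close>

lemma energy_density_bounds:
  assumes H: "0 \<le> a" "0 \<le> c" "b\<^sup>2 \<le> a * c" "a + c = 1"
  shows energy_density_nonneg: "0 \<le> energy_density a b c u v"
    and energy_density_le: "energy_density a b c u v \<le> (cmod u)\<^sup>2 + (cmod v)\<^sup>2"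
    and energy_density_ge: "(Im (cnj u * v))\<^sup>2 \<le> ((cmod u)\<^sup>2 + (cmod v)\<^sup>2) * energy_density a b c u v"
    and energy_density_cross: "(cmod (cnj u * (of_real b * u + of_real c * v) - cnj v * (of_real a * u + of_real b * v)))\<^sup>2
      \<le> ((cmod u)\<^sup>2 + (cmod v)\<^sup>2) * energy_density a b c u v"
proof -
  define A where "A = (cmod u)\<^sup>2"
  define B where "B = Re (cnj u * v)"
  define C where "C = (cmod v)\<^sup>2"
  define G where "G = Im (cnj u * v)"
  have AC: "0 \<le> A" "0 \<le> C" by (auto simp: A_def C_def)
  have BG: "B\<^sup>2 + G\<^sup>2 = A * C" unfolding A_def B_def C_def G_def by (rule cnj_mult_norm_sq)
  have BAC: "B\<^sup>2 \<le> A * C" using BG zero_le_power2[of G] by linarith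
  have q: "energy_density a b c u v = a * A + 2 * b * B + c * C"
    by (simp add: energy_density_def A_def B_def C_def)
  show "0 \<le> energy_density a b c u v" unfolding q
    using psd_form_nonneg[OF H(1-3) AC BAC] .
  have "0 \<le> c * A + 2 * (-b) * B + a * C"
    using psd_form_nonneg[OF H(2,1) _ AC BAC, of "-b"] H(3) by (simp add: mult.commute)
  then have "a * A + 2 * b * B + c * C \<le> (a + c) * A + (a + c) * C" by (simp add: algebra_simps)
  then have "a * A + 2 * b * B + c * C \<le> A + C" using H(4) by simp
  then show "energy_density a b c u v \<le> (cmod u)\<^sup>2 + (cmod v)\<^sup>2"
    unfolding q by (simp add: A_def C_def)
  \<comment> \<open>The forms of H at the columns (A, B) and (B, C) of G; they add up to
    tr(HG^2).\<close>
  have 1: "0 \<le> a * A\<^sup>2 + 2 * b * (A * B) + c * B\<^sup>2"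
    by (rule psd_form_nonneg[OF H(1-3)]) (auto simp: power_mult_distrib)
  have 2: "0 \<le> a * B\<^sup>2 + 2 * b * (B * C) + c * C\<^sup>2"
    by (rule psd_form_nonneg[OF H(1-3)]) (auto simp: power_mult_distrib)
  have "(A + C) * (a * A + 2 * b * B + c * C) - (a + c) * (A * C - B\<^sup>2)
      = (a * A\<^sup>2 + 2 * b * (A * B) + c * B\<^sup>2) + (a * B\<^sup>2 + 2 * b * (B * C) + c * C\<^sup>2)"
    by (simp add: algebra_simps power2_eq_square)
  moreover have "A * C - B\<^sup>2 = G\<^sup>2" using BG by simp
  ultimately have "G\<^sup>2 \<le> (A + C) * (a * A + 2 * b * B + c * C)" using 1 2 H(4) by simp
  then show "(Im (cnj u * v))\<^sup>2 \<le> ((cmod u)\<^sup>2 + (cmod v)\<^sup>2) * energy_density a b c u v"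
    unfolding q by (simp add: A_def C_def G_def)
  define s where "s = of_real b * u + of_real c * v"
  define t where "t = of_real a * u + of_real b * v"
  have "(cmod s)\<^sup>2 + (cmod t)\<^sup>2 = (a\<^sup>2 + b\<^sup>2) * A + 2 * b * (a + c) * B + (b\<^sup>2 + c\<^sup>2) * C"
    unfolding s_def t_def A_def B_def C_def cmod_power2 by (simp add: algebra_simps power2_eq_square)
  also have "\<dots> = a * (a + c) * A + 2 * b * (a + c) * B + c * (a + c) * C - (a * c - b\<^sup>2) * (A + C)"
    by (simp add: algebra_simps power2_eq_square)
  also have "\<dots> = (a * A + 2 * b * B + c * C) - (a * c - b\<^sup>2) * (A + C)"
    unfolding H(4) by simp
  also have "\<dots> \<le> energy_density a b c u v"
    using mult_nonneg_nonneg[of "a * c - b\<^sup>2" "A + C"] H(3) AC unfolding q by simp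
  finally have st: "(cmod s)\<^sup>2 + (cmod t)\<^sup>2 \<le> energy_density a b c u v" .
  have "cmod (cnj u * s - cnj v * t) \<le> cmod u * cmod s + cmod v * cmod t"
    by (rule order_trans[OF norm_triangle_ineq4]) (simp add: norm_mult)
  then have "(cmod (cnj u * s - cnj v * t))\<^sup>2 \<le> (cmod u * cmod s + cmod v * cmod t)\<^sup>2"
    by (intro power_mono) auto
  also have "\<dots> \<le> ((cmod u)\<^sup>2 + (cmod v)\<^sup>2) * ((cmod s)\<^sup>2 + (cmod t)\<^sup>2)"
    using zero_le_power2[of "cmod u * cmod t - cmod v * cmod s"]
    by (simp add: algebra_simps power2_eq_square)
  also have "\<dots> \<le> ((cmod u)\<^sup>2 + (cmod v)\<^sup>2) * energy_density a b c u v"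
    using st by (intro mult_left_mono) auto
  finally show "(cmod (cnj u * (of_real b * u + of_real c * v) - cnj v * (of_real a * u + of_real b * v)))\<^sup>2
      \<le> ((cmod u)\<^sup>2 + (cmod v)\<^sup>2) * energy_density a b c u v"
    unfolding s_def t_def .
qed

lemma has_vector_derivative_exp_real:
  fixes f :: "real \<Rightarrow> real"
  assumes "(f has_vector_derivative d) (at x within S)"
  shows "((\<lambda>x. exp (f x)) has_vector_derivative exp (f x) * d) (at x within S)"
  using assms unfolding has_real_derivative_iff_has_vector_derivative[symmetric]
  by (auto intro!: derivative_eq_intros)

lemma has_vector_derivative_norm_sq:
  fixes f :: "real \<Rightarrow> complex"
  assumes "(f has_vector_derivative d) (at x within S)"
  shows "((\<lambda>x. (cmod (f x))\<^sup>2) has_vector_derivative 2 * Re (cnj (f x) * d)) (at x within S)"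
proof -
  have "((\<lambda>x. Re (cnj (f x) * f x)) has_vector_derivative Re (cnj (f x) * d + cnj d * f x)) (at x within S)"
    by (rule vd_intros assms)+
  then show ?thesis unfolding cmod_power2 by (simp add: power2_eq_square algebra_simps)
qed

lemma abs_continuous_on_norm_sq:
  fixes f :: "real \<Rightarrow> complex"
  assumes "abs_continuous_on {u..v} f"
  shows "abs_continuous_on {u..v} (\<lambda>x. (cmod (f x))\<^sup>2)"
proof -
  have "abs_continuous_on {u..v} (\<lambda>x. Re (cnj (f x) * f x))" by (intro ac_intros assms)
  then show ?thesis unfolding cmod_power2 by (simp add: power2_eq_square)
qed

section \<open>Trace normed systems: growth of solutions and monotonicity of the flux\<close>

locale trace_normed_system =
  fixes a b c :: "real \<Rightarrow> real"
  assumes entries_integrable: "\<And>R. 0 \<le> R \<Longrightarrow> a absolutely_integrable_on {0..R}"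
      "\<And>R. 0 \<le> R \<Longrightarrow> b absolutely_integrable_on {0..R}"
      "\<And>R. 0 \<le> R \<Longrightarrow> c absolutely_integrable_on {0..R}"
    and entries_AE: "AE x\<in>{0..} in lebesgue. 0 \<le> a x \<and> 0 \<le> c x \<and> (b x)\<^sup>2 \<le> a x * c x \<and> a x + c x = 1"
begin

text \<open>The two rows of Y' = -zJHY, the system solved for the derivative.\<close>

abbreviation solves_at :: "complex \<Rightarrow> (real \<Rightarrow> complex) \<Rightarrow> (real \<Rightarrow> complex) \<Rightarrow> real \<Rightarrow> real set \<Rightarrow> bool" where
  "solves_at z y1 y2 x S \<equiv>
     (y1 has_vector_derivative z * (of_real (b x) * y1 x + of_real (c x) * y2 x)) (at x within S) \<and>
     (y2 has_vector_derivative - z * (of_real (a x) * y1 x + of_real (b x) * y2 x)) (at x within S)"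

definition solution :: "complex \<Rightarrow> (real \<Rightarrow> complex) \<Rightarrow> (real \<Rightarrow> complex) \<Rightarrow> bool" where
  "solution z y1 y2 \<longleftrightarrow>
     (\<forall>R\<ge>0. abs_continuous_on {0..R} y1 \<and> abs_continuous_on {0..R} y2) \<and>
     (AE x\<in>{0..} in lebesgue.
        solves_at z y1 y2 x {0..})"

lemma solution_ac:
  assumes "solution z y1 y2" "0 \<le> u"
  shows "abs_continuous_on {u..v} y1" "abs_continuous_on {u..v} y2"
proof -
  have "abs_continuous_on {0..max 0 v} y1" "abs_continuous_on {0..max 0 v} y2"
    using assms unfolding solution_def by auto
  then show "abs_continuous_on {u..v} y1" "abs_continuous_on {u..v} y2"
    using \<open>0 \<le> u\<close> by (auto elim!: abs_continuous_on_subset)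
qed

lemma solution_AE:
  assumes "solution z y1 y2" "0 \<le> u"
  shows "AE x\<in>{u..v} in lebesgue.
        solves_at z y1 y2 x {u..v} \<and>
        0 \<le> a x \<and> 0 \<le> c x \<and> (b x)\<^sup>2 \<le> a x * c x \<and> a x + c x = 1"
proof -
  have "AE x\<in>{0..} in lebesgue.
        solves_at z y1 y2 x {0..}"
    using assms(1) unfolding solution_def by blast
  with entries_AE show ?thesis
  proof eventually_elim
    case (elim x)
    have "{u..v} \<subseteq> {0..}" using \<open>0 \<le> u\<close> by auto
    with elim show ?case by (meson has_vector_derivative_within_subset subsetD)
  qed
qed

lemma solution_linear:
  assumes "solution z y1 y2" "solution z w1 w2"
  shows "solution z (\<lambda>x. y1 x + k * w1 x) (\<lambda>x. y2 x + k * w2 x)"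
  unfolding solution_def
proof (intro conjI allI impI)
  fix R :: real assume "0 \<le> R"
  show "abs_continuous_on {0..R} (\<lambda>x. y1 x + k * w1 x)" "abs_continuous_on {0..R} (\<lambda>x. y2 x + k * w2 x)"
    by (intro ac_intros solution_ac[OF assms(1)] solution_ac[OF assms(2)] order_refl)+
next
  have "AE x\<in>{0..} in lebesgue.
        solves_at z y1 y2 x {0..}"
       "AE x\<in>{0..} in lebesgue.
        solves_at z w1 w2 x {0..}"
    using assms unfolding solution_def by blast+
  then show "AE x\<in>{0..} in lebesgue.
        ((\<lambda>x. y1 x + k * w1 x) has_vector_derivative z * (of_real (b x) * (y1 x + k * w1 x) + of_real (c x) * (y2 x + k * w2 x))) (at x within {0..}) \<and>
        ((\<lambda>x. y2 x + k * w2 x) has_vector_derivative - z * (of_real (a x) * (y1 x + k * w1 x) + of_real (b x) * (y2 x + k * w2 x))) (at x within {0..})"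
  proof eventually_elim
    case (elim x)
    show ?case
    proof (intro impI conjI)
      assume x: "x \<in> {0..}"
      have D: "(y1 has_vector_derivative z * (of_real (b x) * y1 x + of_real (c x) * y2 x)) (at x within {0..})"
        "(y2 has_vector_derivative - z * (of_real (a x) * y1 x + of_real (b x) * y2 x)) (at x within {0..})"
        "(w1 has_vector_derivative z * (of_real (b x) * w1 x + of_real (c x) * w2 x)) (at x within {0..})"
        "(w2 has_vector_derivative - z * (of_real (a x) * w1 x + of_real (b x) * w2 x)) (at x within {0..})"
        using elim x by auto
      show "((\<lambda>x. y1 x + k * w1 x) has_vector_derivative z * (of_real (b x) * (y1 x + k * w1 x) + of_real (c x) * (y2 x + k * w2 x))) (at x within {0..})"
        by (rule has_vector_derivative_eq_rhs, (rule vd_intros D)+) (simp add: algebra_simps)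
      show "((\<lambda>x. y2 x + k * w2 x) has_vector_derivative - z * (of_real (a x) * (y1 x + k * w1 x) + of_real (b x) * (y2 x + k * w2 x))) (at x within {0..})"
        by (rule has_vector_derivative_eq_rhs, (rule vd_intros D)+) (simp add: algebra_simps)
    qed
  qed
qed

lemma energy_derivative:
  assumes "solves_at z y1 y2 x S"
  shows "((\<lambda>x. (cmod (y1 x))\<^sup>2 + (cmod (y2 x))\<^sup>2) has_vector_derivative
      2 * Re (z * (cnj (y1 x) * (of_real (b x) * y1 x + of_real (c x) * y2 x)
                 - cnj (y2 x) * (of_real (a x) * y1 x + of_real (b x) * y2 x)))) (at x within S)"
  by (rule has_vector_derivative_eq_rhs,
      rule has_vector_derivative_add[OF has_vector_derivative_norm_sq[OF conjunct1[OF assms]] has_vector_derivative_norm_sq[OF conjunct2[OF assms]]])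
     (simp add: algebra_simps)

lemma flux_derivative:
  assumes "solves_at z y1 y2 x S"
  shows "((\<lambda>x. Im (cnj (y1 x) * y2 x)) has_vector_derivative
      - Im z * energy_density (a x) (b x) (c x) (y1 x) (y2 x)) (at x within S)"
  by (rule has_vector_derivative_eq_rhs, (rule vd_intros conjunct1[OF assms] conjunct2[OF assms])+)
     (unfold energy_density_def cmod_power2, simp add: algebra_simps power2_eq_square)

text \<open>Gronwall in both directions: by \<open>energy_density_cross\<close> and
  \<open>energy_density_le\<close> the derivative of |y|^2 is at most 2|z||y|^2 in modulus. The
  second bound later keeps a limit of solutions from vanishing.\<close>

lemma solution_norm_growth:
  assumes sol: "solution z y1 y2" and "0 \<le> x"
  shows "(cmod (y1 x))\<^sup>2 + (cmod (y2 x))\<^sup>2 \<le> exp (2 * cmod z * x) * ((cmod (y1 0))\<^sup>2 + (cmod (y2 0))\<^sup>2)"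
    and "(cmod (y1 0))\<^sup>2 + (cmod (y2 0))\<^sup>2 \<le> exp (2 * cmod z * x) * ((cmod (y1 x))\<^sup>2 + (cmod (y2 x))\<^sup>2)"
proof -
  define N where "N x = (cmod (y1 x))\<^sup>2 + (cmod (y2 x))\<^sup>2" for x
  have ac: "abs_continuous_on {0..x} N"
    unfolding N_def by (intro ac_intros abs_continuous_on_norm_sq solution_ac[OF sol]) auto
  have der: "AE t\<in>{0..x} in lebesgue. \<exists>d. (N has_vector_derivative d) (at t within {0..x}) \<and> \<bar>d\<bar> \<le> 2 * cmod z * N t"
    using solution_AE[OF sol order_refl, of x]
  proof eventually_elim
    case (elim t)
    show ?case
    proof
      assume t: "t \<in> {0..x}"
      define w where "w = cnj (y1 t) * (of_real (b t) * y1 t + of_real (c t) * y2 t)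
                 - cnj (y2 t) * (of_real (a t) * y1 t + of_real (b t) * y2 t)"
      have H: "0 \<le> a t" "0 \<le> c t" "(b t)\<^sup>2 \<le> a t * c t" "a t + c t = 1" using elim t by auto
      have "(cmod w)\<^sup>2 \<le> N t * energy_density (a t) (b t) (c t) (y1 t) (y2 t)"
        using energy_density_cross[OF H] unfolding w_def N_def .
      also have "\<dots> \<le> N t * N t"
        using energy_density_le[OF H, of "y1 t" "y2 t"] unfolding N_def by (intro mult_left_mono) auto
      finally have "cmod w \<le> N t"
        by (metis N_def abs_le_square_iff abs_norm_cancel abs_of_nonneg add_nonneg_nonneg power2_eq_square zero_le_power2)
      then have "\<bar>2 * Re (z * w)\<bar> \<le> 2 * cmod z * N t"
        using abs_Re_le_cmod[of "z * w"] mult_left_mono[of "cmod w" "N t" "cmod z"] by (simp add: norm_mult)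
      moreover have "(N has_vector_derivative 2 * Re (z * w)) (at t within {0..x})"
        using energy_derivative[of y1 z t y2 "{0..x}"] elim t unfolding w_def N_def by blast
      ultimately show "\<exists>d. (N has_vector_derivative d) (at t within {0..x}) \<and> \<bar>d\<bar> \<le> 2 * cmod z * N t" by blast
    qed
  qed
  \<comment> \<open>Both bounds in one computation: s = 1 gives the upper and s = -1 the lower one,
    since s k = -2|z| in either case makes the derivative of s exp(kt) N(t) nonpositive.\<close>
  have key: "s * exp (s * (- 2 * cmod z) * x) * N x \<le> s * N 0" if s: "s = 1 \<or> s = -1" for s :: real
  proof -
    define k where "k = s * (- 2 * cmod z)"
    have "(\<lambda>t. s * exp (k * t) * N t) x - (\<lambda>t. s * exp (k * t) * N t) 0 \<le> 0 * (x - 0)"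
    proof (rule increment_le_abs_continuous[OF \<open>0 \<le> x\<close>])
      show "abs_continuous_on {0..x} (\<lambda>t. s * exp (k * t) * N t)"
        by (intro ac_intros abs_continuous_on_exp ac)
      show "AE t\<in>{0..x} in lebesgue. \<exists>d. ((\<lambda>t. s * exp (k * t) * N t) has_vector_derivative d) (at t within {0..x}) \<and> d \<le> 0"
        using der
      proof eventually_elim
        case (elim t)
        show ?case
        proof
          assume "t \<in> {0..x}"
          then obtain d where d: "(N has_vector_derivative d) (at t within {0..x})" "\<bar>d\<bar> \<le> 2 * cmod z * N t"
            using elim by blast
          have e: "((\<lambda>t. exp (k * t)) has_vector_derivative exp (k * t) * k) (at t within {0..x})"
            by (rule has_vector_derivative_exp_real, rule has_vector_derivative_eq_rhs, (rule vd_intros)+) simp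
          have D: "((\<lambda>t. s * exp (k * t) * N t) has_vector_derivative exp (k * t) * (s * d + s * k * N t)) (at t within {0..x})"
            by (rule has_vector_derivative_eq_rhs, (rule vd_intros e d(1))+) (simp add: algebra_simps)
          have "s * k = - 2 * cmod z" using s by (auto simp: k_def)
          then have "s * d + s * k * N t \<le> 0" using d(2) s by auto
          then have "exp (k * t) * (s * d + s * k * N t) \<le> 0" by (simp add: mult_le_0_iff)
          with D show "\<exists>d. ((\<lambda>t. s * exp (k * t) * N t) has_vector_derivative d) (at t within {0..x}) \<and> d \<le> 0" by blast
        qed
      qed
    qed
    then show ?thesis by (simp add: k_def)
  qed
  have "exp (2 * cmod z * x) * (exp (- 2 * cmod z * x) * N x) \<le> exp (2 * cmod z * x) * N 0"
    using key[of 1] by simp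
  then show "(cmod (y1 x))\<^sup>2 + (cmod (y2 x))\<^sup>2 \<le> exp (2 * cmod z * x) * ((cmod (y1 0))\<^sup>2 + (cmod (y2 0))\<^sup>2)"
    unfolding N_def[symmetric] by (simp add: mult.assoc[symmetric] exp_add[symmetric])
  show "(cmod (y1 0))\<^sup>2 + (cmod (y2 0))\<^sup>2 \<le> exp (2 * cmod z * x) * ((cmod (y1 x))\<^sup>2 + (cmod (y2 x))\<^sup>2)"
    using key[of "-1"] unfolding N_def[symmetric] by simp
qed

text \<open>The sign \<open>s\<close> treats both half planes at once; the derivative is -s Im z
  times a density that is nonnegative almost everywhere.\<close>

lemma flux_signed_antimono:
  assumes sol: "solution z y1 y2" and "0 \<le> u" "u \<le> v" and s: "0 \<le> s * Im z"
  shows "s * Im (cnj (y1 v) * y2 v) \<le> s * Im (cnj (y1 u) * y2 u)"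
proof -
  have "s * Im (cnj (y1 v) * y2 v) - s * Im (cnj (y1 u) * y2 u) \<le> 0 * (v - u)"
  proof (rule increment_le_abs_continuous[OF \<open>u \<le> v\<close>])
    show "abs_continuous_on {u..v} (\<lambda>x. s * Im (cnj (y1 x) * y2 x))"
      by (intro ac_intros solution_ac[OF sol] \<open>0 \<le> u\<close>)
    show "AE x\<in>{u..v} in lebesgue. \<exists>d. ((\<lambda>x. s * Im (cnj (y1 x) * y2 x)) has_vector_derivative d) (at x within {u..v}) \<and> d \<le> 0"
      using solution_AE[OF sol \<open>0 \<le> u\<close>, of v]
    proof eventually_elim
      case (elim x)
      show ?case
      proof (intro impI exI conjI)
        assume x: "x \<in> {u..v}"
        have V: "((\<lambda>x. Im (cnj (y1 x) * y2 x)) has_vector_derivative - Im z * energy_density (a x) (b x) (c x) (y1 x) (y2 x)) (at x within {u..v})"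
          by (rule flux_derivative) (use elim x in blast)
        show "((\<lambda>x. s * Im (cnj (y1 x) * y2 x)) has_vector_derivative - (s * Im z * energy_density (a x) (b x) (c x) (y1 x) (y2 x))) (at x within {u..v})"
          by (rule has_vector_derivative_eq_rhs, (rule vd_intros V)+) simp
        show "- (s * Im z * energy_density (a x) (b x) (c x) (y1 x) (y2 x)) \<le> 0"
          using energy_density_nonneg[of "a x" "c x" "b x" "y1 x" "y2 x"] elim x s by simp
      qed
    qed
  qed
  then show ?thesis by simp
qed

lemma flux_mono:
  assumes "solution z y1 y2" "0 \<le> u" "u \<le> v" "Im z \<le> 0"
  shows "Im (cnj (y1 u) * y2 u) \<le> Im (cnj (y1 v) * y2 v)"
  using flux_signed_antimono[OF assms(1-3), of "-1"] assms(4) by simp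

lemma flux_antimono:
  assumes "solution z y1 y2" "0 \<le> u" "u \<le> v" "0 \<le> Im z"
  shows "Im (cnj (y1 v) * y2 v) \<le> Im (cnj (y1 u) * y2 u)"
  using flux_signed_antimono[OF assms(1-3), of 1] assms(4) by simp

end

section \<open>Nonnegative flux of square integrable solutions\<close>

context trace_normed_system
begin

text \<open>
  If the flux became negative, the energy density would be bounded below by a multiple of \<open>|y|\<^sup>-\<^sup>2\<close>,
  while \<open>log |y|\<^sup>2\<close> could grow at most proportionally to the (finite) total energy.
\<close>

lemma flux_nonneg:
  assumes sol: "solution z y1 y2" and z: "0 < Im z"
    and K: "\<And>x. 0 \<le> x \<Longrightarrow> - K \<le> Im (cnj (y1 x) * y2 x)"
    and x0: "0 \<le> x0"
  shows "0 \<le> Im (cnj (y1 x0) * y2 x0)"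
proof (rule ccontr)
  define g where "g x = Im (cnj (y1 x) * y2 x)" for x
  define N where "N x = (cmod (y1 x))\<^sup>2 + (cmod (y2 x))\<^sup>2" for x
  define q where "q x = energy_density (a x) (b x) (c x) (y1 x) (y2 x)" for x
  define \<epsilon> where "\<epsilon> = - g x0"
  assume "\<not> 0 \<le> Im (cnj (y1 x0) * y2 x0)"
  then have \<epsilon>: "\<epsilon> > 0" by (simp add: \<epsilon>_def g_def)
  have gle: "g x \<le> - \<epsilon>" if "x0 \<le> x" for x
    using flux_antimono[OF sol x0 that] z by (simp add: g_def \<epsilon>_def)
  \<comment> \<open>While the flux is below -\<epsilon> one has \<epsilon>^2 <= Nq, so |w|^2 <= Nq
    improves to |w| <= Nq/\<epsilon>, and therefore N' <= kNq.\<close>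
  define k where "k = 2 * cmod z / \<epsilon>"
  have k: "0 \<le> k" using \<epsilon> by (simp add: k_def)
  have acN: "abs_continuous_on {x0..x} N" and acg: "abs_continuous_on {x0..x} g" for x
    unfolding N_def g_def by (intro ac_intros abs_continuous_on_norm_sq solution_ac[OF sol] x0)+
  have ae: "AE t\<in>{x0..x} in lebesgue. (g has_vector_derivative - Im z * q t) (at t within {x0..x}) \<and>
      (\<exists>d. (N has_vector_derivative d) (at t within {x0..x}) \<and> d \<le> k * (N t * q t)) \<and> \<epsilon>\<^sup>2 \<le> N t * q t" for x
    using solution_AE[OF sol x0, of x]
  proof eventually_elim
    case (elim t)
    show ?case
    proof
      assume t: "t \<in> {x0..x}"
      define w where "w = cnj (y1 t) * (of_real (b t) * y1 t + of_real (c t) * y2 t)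
                 - cnj (y2 t) * (of_real (a t) * y1 t + of_real (b t) * y2 t)"
      have H: "0 \<le> a t" "0 \<le> c t" "(b t)\<^sup>2 \<le> a t * c t" "a t + c t = 1" using elim t by auto
      have "\<epsilon>\<^sup>2 \<le> (g t)\<^sup>2"
        using gle[of t] t \<epsilon> abs_le_square_iff[of \<epsilon> "g t"] by auto
      also have "\<dots> \<le> N t * q t"
        using energy_density_ge[OF H, of "y1 t" "y2 t"] by (simp add: g_def N_def q_def)
      finally have Nq: "\<epsilon>\<^sup>2 \<le> N t * q t" .
      have w: "(cmod w)\<^sup>2 \<le> N t * q t"
        using energy_density_cross[OF H] unfolding w_def N_def q_def .
      also have "\<dots> \<le> (N t * q t) * (N t * q t) / \<epsilon>\<^sup>2"
      proof -
        have "0 \<le> N t * q t" using Nq zero_le_power2[of \<epsilon>] by linarith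
        from mult_left_mono[OF Nq this] show ?thesis using \<epsilon> by (simp add: pos_le_divide_eq)
      qed
      finally have "(cmod w)\<^sup>2 \<le> (N t * q t / \<epsilon>)\<^sup>2"
        by (simp add: power2_eq_square)
      moreover have "0 \<le> N t * q t / \<epsilon>" using Nq \<epsilon> zero_le_power2[of \<epsilon>] by (intro divide_nonneg_pos) linarith+
      ultimately have "cmod w \<le> N t * q t / \<epsilon>" by (rule power2_le_imp_le)
      then have "2 * cmod z * cmod w \<le> 2 * cmod z * (N t * q t / \<epsilon>)" by (intro mult_left_mono) auto
      then have "2 * Re (z * w) \<le> k * (N t * q t)"
        using complex_Re_le_cmod[of "z * w"] by (simp add: norm_mult k_def)
      moreover have "(N has_vector_derivative 2 * Re (z * w)) (at t within {x0..x})"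
        using energy_derivative[of y1 z t y2 "{x0..x}"] elim t unfolding w_def N_def by blast
      moreover have "(g has_vector_derivative - Im z * q t) (at t within {x0..x})"
        using flux_derivative[of y1 z t y2 "{x0..x}"] elim t unfolding g_def q_def by blast
      ultimately show "(g has_vector_derivative - Im z * q t) (at t within {x0..x}) \<and>
        (\<exists>d. (N has_vector_derivative d) (at t within {x0..x}) \<and> d \<le> k * (N t * q t)) \<and> \<epsilon>\<^sup>2 \<le> N t * q t"
        using Nq by blast
    qed
  qed
  \<comment> \<open>Because N' <= kNq and g' = -(Im z) q, the product N exp(k g / Im z) does not
    increase. As g stays above -K, this bounds N; the summand 1 makes \<open>B\<close>
    positive.\<close>
  define B where "B = N x0 * exp (k * K / Im z) + 1"
  have N0: "0 \<le> N x" for x by (simp add: N_def)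
  have NB: "N x \<le> B" if x: "x0 \<le> x" for x
  proof -
    have "N x * exp (k / Im z * g x) - N x0 * exp (k / Im z * g x0) \<le> 0 * (x - x0)"
    proof (rule increment_le_abs_continuous[OF x])
      show "abs_continuous_on {x0..x} (\<lambda>x. N x * exp (k / Im z * g x))"
        by (intro ac_intros abs_continuous_on_exp acN acg)
      show "AE t\<in>{x0..x} in lebesgue. \<exists>d. ((\<lambda>x. N x * exp (k / Im z * g x)) has_vector_derivative d) (at t within {x0..x}) \<and> d \<le> 0"
        using ae[of x]
      proof eventually_elim
        case (elim t)
        show ?case
        proof
          assume t: "t \<in> {x0..x}"
          obtain d where d: "(N has_vector_derivative d) (at t within {x0..x})" "d \<le> k * (N t * q t)"
            using elim t by blast
          have g: "(g has_vector_derivative - Im z * q t) (at t within {x0..x})" using elim t by blast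
          have e: "((\<lambda>x. exp (k / Im z * g x)) has_vector_derivative exp (k / Im z * g t) * (- k * q t)) (at t within {x0..x})"
            by (rule has_vector_derivative_exp_real, rule has_vector_derivative_eq_rhs, (rule vd_intros g)+) (use z in simp)
          have D: "((\<lambda>x. N x * exp (k / Im z * g x)) has_vector_derivative exp (k / Im z * g t) * (d - k * (N t * q t))) (at t within {x0..x})"
            by (rule has_vector_derivative_eq_rhs, (rule vd_intros d(1) e)+) (simp add: algebra_simps)
          have "exp (k / Im z * g t) * (d - k * (N t * q t)) \<le> 0" using d(2) by (simp add: mult_le_0_iff)
          with D show "\<exists>d. ((\<lambda>x. N x * exp (k / Im z * g x)) has_vector_derivative d) (at t within {x0..x}) \<and> d \<le> 0" by blast
        qed
      qed
    qed
    then have 1: "N x * exp (k / Im z * g x) \<le> N x0 * exp (k / Im z * g x0)" by simp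
    have "N x = N x * exp (k / Im z * g x) * exp (- (k / Im z * g x))"
      by (simp add: mult.assoc exp_add[symmetric])
    also have "\<dots> \<le> N x0 * exp (k / Im z * g x0) * exp (- (k / Im z * g x))"
      using 1 by (intro mult_right_mono) auto
    also have "\<dots> = N x0 * exp (k / Im z * (g x0 - g x))"
      by (simp add: mult.assoc exp_add[symmetric] right_diff_distrib)
    also have "\<dots> \<le> N x0 * exp (k / Im z * K)"
    proof -
      have "- K \<le> g x" using K[of x] x x0 by (simp add: g_def)
      then have "g x0 - g x \<le> K" using \<epsilon> by (simp add: \<epsilon>_def)
      then show ?thesis
        using k z by (intro mult_left_mono N0 exp_le_cancel_iff[THEN iffD2]) auto
    qed
    finally show ?thesis by (simp add: B_def)
  qed
  have B: "B > 0" using N0[of x0] by (auto simp: B_def intro: add_nonneg_pos)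
  \<comment> \<open>Once N <= B, the density is at least \<epsilon>^2/B, and the flux falls at least
    linearly.\<close>
  have decay: "g x - g x0 \<le> - (Im z * \<epsilon>\<^sup>2 / B) * (x - x0)" if x: "x0 \<le> x" for x
  proof (rule increment_le_abs_continuous[OF x acg])
    show "AE t\<in>{x0..x} in lebesgue. \<exists>d. (g has_vector_derivative d) (at t within {x0..x}) \<and> d \<le> - (Im z * \<epsilon>\<^sup>2 / B)"
      using ae[of x]
    proof eventually_elim
      case (elim t)
      show ?case
      proof
        assume t: "t \<in> {x0..x}"
        have Nq: "\<epsilon>\<^sup>2 \<le> N t * q t" and g: "(g has_vector_derivative - Im z * q t) (at t within {x0..x})"
          using elim t by auto
        have "0 < N t * q t" using Nq zero_less_power[OF \<epsilon>, of 2] by linarith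
        then have "0 < q t" using N0[of t] by (simp add: zero_less_mult_iff)
        then have "\<epsilon>\<^sup>2 \<le> B * q t"
          using Nq mult_right_mono[OF NB[of t], of "q t"] t by (metis atLeastAtMost_iff less_imp_le order_trans)
        then have "\<epsilon>\<^sup>2 / B \<le> q t" using B by (simp add: field_simps)
        then have "- Im z * q t \<le> - (Im z * \<epsilon>\<^sup>2 / B)"
          using z mult_left_mono[of "\<epsilon>\<^sup>2 / B" "q t" "Im z"] by simp
        with g show "\<exists>d. (g has_vector_derivative d) (at t within {x0..x}) \<and> d \<le> - (Im z * \<epsilon>\<^sup>2 / B)" by blast
      qed
    qed
  qed
  define r where "r = Im z * \<epsilon>\<^sup>2 / B"
  \<comment> \<open>Far enough out for the linear decrease to pass -K.\<close>
  define x where "x = x0 + (\<bar>K\<bar> + 1) / r"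
  have pos: "0 < r" using z \<epsilon> B by (simp add: r_def)
  then have x: "x0 \<le> x" by (simp add: x_def)
  have "r * (x - x0) = \<bar>K\<bar> + 1" using pos unfolding x_def by simp
  then have "g x \<le> g x0 - (\<bar>K\<bar> + 1)" using decay[OF x] unfolding r_def[symmetric] by simp
  moreover have "- K \<le> g x" using K[of x] x x0 by (simp add: g_def)
  ultimately show False using \<epsilon> by (simp add: \<epsilon>_def)
qed

text \<open>The flux drops by Im z times the energy spent so far. Finite total energy thus bounds it
  from below, and \<open>flux_nonneg\<close> turns this bound into nonnegativity.\<close>

lemma weyl_flux_nonneg:
  assumes sol: "solution z y1 y2" and z: "0 < Im z"
    and L2: "(\<integral>\<^sup>+x\<in>{0..}. ennreal (energy_density (a x) (b x) (c x) (y1 x) (y2 x)) \<partial>lebesgue) < \<infinity>"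
    and x0: "0 \<le> x0"
  shows "0 \<le> Im (cnj (y1 x0) * y2 x0)"
proof (rule flux_nonneg[OF sol z _ x0])
  define g where "g x = Im (cnj (y1 x) * y2 x)" for x
  define q where "q x = energy_density (a x) (b x) (c x) (y1 x) (y2 x)" for x
  define T where "T = (\<integral>\<^sup>+x\<in>{0..}. ennreal (q x) \<partial>lebesgue)"
  have T: "T < \<infinity>" using L2 by (simp add: T_def q_def)
  fix x :: real assume x: "0 \<le> x"
  \<comment> \<open>The density is nonnegative only almost everywhere. Cutting it off at 0 makes it
    so everywhere, and \<open>ennreal\<close> does not see the difference.\<close>
  have "((\<lambda>t. - Im z * max 0 (q t)) has_integral g x - g 0) {0..x}"
  proof (rule fundamental_theorem_of_calculus_abs_continuous[OF x])
    show "abs_continuous_on {0..x} g"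
      unfolding g_def by (intro ac_intros solution_ac[OF sol] order_refl)
    show "AE t\<in>{0..x} in lebesgue. (g has_vector_derivative - Im z * max 0 (q t)) (at t within {0..x})"
      using solution_AE[OF sol order_refl, of x]
    proof eventually_elim
      case (elim t)
      show ?case
      proof
        assume t: "t \<in> {0..x}"
        have "0 \<le> q t" using energy_density_nonneg[of "a t" "c t" "b t" "y1 t" "y2 t"] elim t by (simp add: q_def)
        moreover have "(g has_vector_derivative - Im z * q t) (at t within {0..x})"
          using flux_derivative[of y1 z t y2 "{0..x}"] elim t unfolding g_def q_def by blast
        ultimately show "(g has_vector_derivative - Im z * max 0 (q t)) (at t within {0..x})" by simp
      qed
    qed
  qed
  from has_integral_mult_right[OF this, of "- inverse (Im z)"]
  have "((\<lambda>t. - inverse (Im z) * (- Im z * max 0 (q t))) has_integral - inverse (Im z) * (g x - g 0)) {0..x}" .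
  moreover have "- inverse (Im z) * (g x - g 0) = (g 0 - g x) / Im z" by (simp add: divide_inverse algebra_simps)
  moreover have "(\<lambda>t. - inverse (Im z) * (- Im z * max 0 (q t))) = (\<lambda>t. max 0 (q t))" using z by auto
  ultimately have I: "((\<lambda>t. max 0 (q t)) has_integral (g 0 - g x) / Im z) {0..x}" by simp
  have "ennreal ((g 0 - g x) / Im z) = (\<integral>\<^sup>+t. ennreal (max 0 (q t)) * indicator {0..x} t \<partial>lborel)"
    using nn_integral_has_integral_lebesgue'[OF _ I] by simp
  also have "\<dots> = (\<integral>\<^sup>+t. ennreal (max 0 (q t)) * indicator {0..x} t \<partial>lebesgue)"
    by (simp add: nn_integral_completion)
  also have "\<dots> \<le> T"
    unfolding T_def by (intro nn_integral_mono) (auto simp: indicator_def max_def ennreal_neg)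
  finally have gT: "ennreal ((g 0 - g x) / Im z) \<le> T" .
  have "(g 0 - g x) / Im z \<le> enn2real T"
  proof (cases "0 \<le> (g 0 - g x) / Im z")
    case True
    with enn2real_mono[OF gT] T show ?thesis by simp
  next
    case False
    then show ?thesis using enn2real_nonneg[of T] by linarith
  qed
  then show "- (Im z * enn2real T - g 0) \<le> Im (cnj (y1 x) * y2 x)"
    using z by (simp add: field_simps g_def)
qed

end

section \<open>Differentiability and absolute continuity of primitives\<close>

text \<open>Averages over [x, x + h] converge to the value at x outside a null set. The same fact
  for the reflected function controls averages over [x - h, x]. The extension \<open>F\<close> by 0
  makes both available on the whole line.\<close>

lemma integral_has_vector_derivative_AE:
  fixes f :: "real \<Rightarrow> real"
  assumes f: "\<And>R. 0 \<le> R \<Longrightarrow> f integrable_on {0..R}"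
  shows "AE x\<in>{0..} in lebesgue. ((\<lambda>x. integral {0..x} f) has_vector_derivative f x) (at x within {0..})"
proof -
  define F where "F x = (if x \<in> {0..} then f x else 0)" for x
  have F: "F integrable_on {u..v}" for u v
  proof -
    have "f integrable_on {max 0 u..v}"
    proof (cases "max 0 u \<le> v")
      case True
      then show ?thesis using integrable_on_subinterval[OF f[of v], of "max 0 u" v] by auto
    qed (simp add: integrable_on_empty)
    moreover have "{0..} \<inter> {u..v} = {max 0 u..v}" by auto
    ultimately show ?thesis unfolding F_def integrable_restrict_Int by simp
  qed
  have F': "(\<lambda>x. F (- x)) integrable_on {u..v}" for u v
    using F[of "-v" "-u"] Henstock_Kurzweil_Integration.integrable_reflect_real[of F "-u" "-v"] by simp
  obtain N1 where N1: "negligible N1" "\<And>x e. \<lbrakk>x \<notin> N1; 0 < e\<rbrakk> \<Longrightarrow>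
      \<exists>d>0. \<forall>h. 0 < h \<and> h < d \<longrightarrow> \<bar>integral {x..x + h} F / h - F x\<bar> < e"
    using integrable_ccontinuous_explicit[of F] F by (auto simp: divide_inverse_commute)
  obtain N2 where N2: "negligible N2" "\<And>x e. \<lbrakk>x \<notin> N2; 0 < e\<rbrakk> \<Longrightarrow>
      \<exists>d>0. \<forall>h. 0 < h \<and> h < d \<longrightarrow> \<bar>integral {x..x + h} (\<lambda>x. F (- x)) / h - F (- x)\<bar> < e"
    using integrable_ccontinuous_explicit[of "\<lambda>x. F (- x)"] F' by (auto simp: divide_inverse_commute)
  have neg: "negligible (N1 \<union> uminus ` N2)"
    using N1(1) negligible_differentiable_image_negligible[OF order_refl N2(1), of uminus]
    by (auto simp: negligible_Un_eq intro!: derivative_intros linear_imp_differentiable_on)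
  have FfI: "integral {u..v} F = integral {u..v} f" if "0 \<le> u" for u v
    using that by (intro integral_cong) (auto simp: F_def)
  have "((\<lambda>x. integral {0..x} f) has_vector_derivative f x) (at x within {0..})"
    if x: "x \<in> {0..}" "x \<notin> N1 \<union> uminus ` N2" for x
    unfolding has_vector_derivative_def has_derivative_within_alt
  proof (intro conjI bounded_linear_scaleR_left allI impI)
    fix e :: real assume e: "e > 0"
    have xN: "x \<notin> N1" "- x \<notin> N2" using x(2) by (auto intro: rev_image_eqI)
    obtain d1 where d1: "d1 > 0" "\<And>h. 0 < h \<Longrightarrow> h < d1 \<Longrightarrow> \<bar>integral {x..x + h} F / h - F x\<bar> < e"
      using N1(2)[OF xN(1) e] by blast
    obtain d2 where d2: "d2 > 0" "\<And>h. 0 < h \<Longrightarrow> h < d2 \<Longrightarrow> \<bar>integral {-x..-x + h} (\<lambda>x. F (- x)) / h - F x\<bar> < e"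
      using N2(2)[OF xN(2) e] by auto
    show "\<exists>d>0. \<forall>y\<in>{0..}. norm (y - x) < d \<longrightarrow>
        norm (integral {0..y} f - integral {0..x} f - (y - x) *\<^sub>R f x) \<le> e * norm (y - x)"
    proof (intro exI[of _ "min d1 d2"] conjI ballI impI)
      fix y :: real assume y: "y \<in> {0..}" "norm (y - x) < min d1 d2"
      consider "y = x" | "x < y" | "y < x" by linarith
      then show "norm (integral {0..y} f - integral {0..x} f - (y - x) *\<^sub>R f x) \<le> e * norm (y - x)"
      proof cases
        case 2
        define h where "h = y - x"
        have h: "0 < h" "h < d1" "y = x + h" using 2 y by (auto simp: h_def)
        have "integral {0..x} f + integral {x..y} f = integral {0..y} f"
          using 2 x y by (intro Henstock_Kurzweil_Integration.integral_combine f) auto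
        then have "integral {0..y} f - integral {0..x} f = integral {x..x + h} F"
          using h(3) x FfI[of x y] by simp
        then have "integral {0..y} f - integral {0..x} f - (y - x) *\<^sub>R f x = h * (integral {x..x + h} F / h - F x)"
          using h x by (simp add: F_def right_diff_distrib)
        also have "norm \<dots> \<le> h * e" using d1(2)[OF h(1,2)] h(1) by (simp add: abs_mult)
        finally show ?thesis using h by (simp add: mult.commute)
      next
        case 3
        define h where "h = x - y"
        have h: "0 < h" "h < d2" "y = x - h" using 3 y by (auto simp: h_def)
        have "integral {0..y} f + integral {y..x} f = integral {0..x} f"
          using 3 x y by (intro Henstock_Kurzweil_Integration.integral_combine f) auto
        moreover have "integral {-x..-x + h} (\<lambda>x. F (- x)) = integral {y..x} F"
          using Henstock_Kurzweil_Integration.integral_reflect_real[of x y F] h by simp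
        ultimately have eq: "integral {0..y} f - integral {0..x} f = - integral {-x..-x + h} (\<lambda>x. F (- x))"
          using y FfI[of y x] by simp
        have "integral {0..y} f - integral {0..x} f - (y - x) *\<^sub>R f x
            = - (h * (integral {-x..-x + h} (\<lambda>x. F (- x)) / h - F x))"
          unfolding eq right_diff_distrib using h x by (simp add: F_def)
        also have "norm \<dots> \<le> h * e" using d2(2)[OF h(1,2)] h(1) by (simp add: abs_mult)
        finally show ?thesis using h by (simp add: mult.commute)
      qed auto
    qed (use d1 d2 in auto)
  qed
  then show ?thesis
    by (intro AE_I'[OF neg[unfolded negligible_iff_null_sets]]) blast
qed

text \<open>The bound on the density makes the primitive Lipschitz with constant 1.\<close>

lemma integral_abs_continuous:
  fixes f :: "real \<Rightarrow> real"
  assumes f: "\<And>R. 0 \<le> R \<Longrightarrow> f integrable_on {0..R}"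
    and bd: "AE x\<in>{0..} in lebesgue. \<bar>f x\<bar> \<le> 1"
  shows "abs_continuous_on {0..R} (\<lambda>x. integral {0..x} f)"
proof -
  obtain N where N: "negligible N" "\<And>x. x \<in> {0..} - N \<Longrightarrow> \<bar>f x\<bar> \<le> 1"
  proof -
    obtain N where N1: "{x \<in> space lebesgue. \<not> (x \<in> {0..} \<longrightarrow> \<bar>f x\<bar> \<le> 1)} \<subseteq> N"
      "N \<in> null_sets lebesgue"
      using bd unfolding eventually_ae_filter by blast
    then have "negligible N" by (simp add: negligible_iff_null_sets)
    then show ?thesis using that N1(1) by auto
  qed
  define F where "F x = (if x \<in> N then 0 else f x)" for x
  have *: "\<bar>integral {0..v} f - integral {0..u} f\<bar> \<le> v - u" if uv: "0 \<le> u" "u \<le> v" for u v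
  proof -
    have "integral {0..u} f + integral {u..v} f = integral {0..v} f"
      using uv by (intro Henstock_Kurzweil_Integration.integral_combine f) auto
    moreover have "(f has_integral integral {u..v} f) {u..v}"
      using uv by (intro integrable_integral integrable_on_subinterval[OF f[of v]]) auto
    then have "(F has_integral integral {u..v} f) {u..v}"
      by (rule has_integral_spike[OF N(1), rotated]) (simp add: F_def)
    then have "norm (integral {u..v} f) \<le> 1 * measure lborel {u..v}"
    proof (rule has_integral_bound_real[OF zero_le_one finite.emptyI])
      fix x assume "x \<in> {u..v} - {}"
      then show "norm (F x) \<le> 1" using N(2)[of x] uv(1) by (cases "x \<in> N") (simp_all add: F_def)
    qed
    ultimately show ?thesis using uv by (simp add: content_real)
  qed
  show ?thesis
  proof (rule abs_continuous_on_Lipschitz_compose[OF abs_continuous_on_id])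
    fix u v assume "u \<in> {0..R}" "v \<in> {0..R}"
    then show "norm (integral {0..u} f - integral {0..v} f) \<le> 1 * norm (u - v)"
      using *[of u v] *[of v u] by (cases "u \<le> v") (simp_all add: abs_minus_commute)
  qed
qed

section \<open>Convergence of the means implies convergence of the m-function\<close>

lemma psd_entries_le_1:
  fixes a b c :: real
  assumes "0 \<le> a" "0 \<le> c" "b\<^sup>2 \<le> a * c" "a + c = 1"
  shows "\<bar>a\<bar> \<le> 1" "\<bar>b\<bar> \<le> 1" "\<bar>c\<bar> \<le> 1"
proof -
  show ac: "\<bar>a\<bar> \<le> 1" "\<bar>c\<bar> \<le> 1" using assms by auto
  have "b\<^sup>2 \<le> 1\<^sup>2" using assms(3) mult_mono[of a 1 c 1] ac assms(1,2) by simp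
  then show "\<bar>b\<bar> \<le> 1" by (metis abs_le_square_iff abs_one)
qed

text \<open>Completing the square: \<zeta> is the root of a + 2b\<zeta> + c\<zeta>^2 with imaginary
  part h/c. For h >= 0 and nonnegative flux the form therefore dominates c|v - \<zeta>u|^2.\<close>

lemma quadratic_form_root:
  fixes a b c h :: real and \<zeta> u v :: complex
  assumes c: "c > 0" and h: "h\<^sup>2 = a * c - b\<^sup>2" and \<zeta>: "\<zeta> = (\<i> * of_real h - of_real b) / of_real c"
  shows "a * (cmod u)\<^sup>2 + 2 * b * Re (cnj u * v) + c * (cmod v)\<^sup>2
       = c * (cmod (v - \<zeta> * u))\<^sup>2 + 2 * h * Im (cnj u * v)"
proof -
  have R: "Re \<zeta> = - b / c" and I: "Im \<zeta> = h / c" using c by (auto simp: \<zeta>)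
  have a: "a = (h\<^sup>2 + b\<^sup>2) / c" using c h by (simp add: field_simps)
  have "c * (cmod (v - \<zeta> * u))\<^sup>2 = c * (cmod v)\<^sup>2 + 2 * b * Re (cnj u * v) - 2 * h * Im (cnj u * v) + ((h\<^sup>2 + b\<^sup>2) / c) * (cmod u)\<^sup>2"
    using c unfolding cmod_power2 by (simp add: R I field_simps power2_eq_square)
  then show ?thesis unfolding a by simp
qed

context trace_normed_system
begin

lemma primitive_AE:
  assumes "0 \<le> X"
  shows "AE t\<in>{0..X} in lebesgue.
      ((\<lambda>t. integral {0..t} a) has_vector_derivative a t) (at t within {0..X}) \<and>
      ((\<lambda>t. integral {0..t} b) has_vector_derivative b t) (at t within {0..X}) \<and>
      ((\<lambda>t. integral {0..t} c) has_vector_derivative c t) (at t within {0..X})"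
proof -
  have i: "\<And>R. 0 \<le> R \<Longrightarrow> a integrable_on {0..R}" "\<And>R. 0 \<le> R \<Longrightarrow> b integrable_on {0..R}" "\<And>R. 0 \<le> R \<Longrightarrow> c integrable_on {0..R}"
    using entries_integrable by (auto simp: absolutely_integrable_on_def)
  have "AE x\<in>{0..} in lebesgue. ((\<lambda>x. integral {0..x} a) has_vector_derivative a x) (at x within {0..})"
    "AE x\<in>{0..} in lebesgue. ((\<lambda>x. integral {0..x} b) has_vector_derivative b x) (at x within {0..})"
    "AE x\<in>{0..} in lebesgue. ((\<lambda>x. integral {0..x} c) has_vector_derivative c x) (at x within {0..})"
    by (rule integral_has_vector_derivative_AE, erule i)+
  then show ?thesis
  proof eventually_elim
    case (elim t)
    have "{0..X} \<subseteq> {0..}" by auto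
    with elim show ?case by (meson has_vector_derivative_within_subset subsetD)
  qed
qed

lemma primitive_ac:
  "abs_continuous_on {0..X} (\<lambda>t. integral {0..t} a)"
  "abs_continuous_on {0..X} (\<lambda>t. integral {0..t} b)"
  "abs_continuous_on {0..X} (\<lambda>t. integral {0..t} c)"
proof -
  have i: "\<And>R. 0 \<le> R \<Longrightarrow> a integrable_on {0..R}" "\<And>R. 0 \<le> R \<Longrightarrow> b integrable_on {0..R}" "\<And>R. 0 \<le> R \<Longrightarrow> c integrable_on {0..R}"
    using entries_integrable by (auto simp: absolutely_integrable_on_def)
  have bd: "AE x\<in>{0..} in lebesgue. \<bar>a x\<bar> \<le> 1" "AE x\<in>{0..} in lebesgue. \<bar>b x\<bar> \<le> 1" "AE x\<in>{0..} in lebesgue. \<bar>c x\<bar> \<le> 1"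
    using entries_AE by (eventually_elim, use psd_entries_le_1 in blast)+
  show "abs_continuous_on {0..X} (\<lambda>t. integral {0..t} a)"
  "abs_continuous_on {0..X} (\<lambda>t. integral {0..t} b)"
  "abs_continuous_on {0..X} (\<lambda>t. integral {0..t} c)"
    by (rule integral_abs_continuous, erule i, rule bd)+
qed

text \<open>
  For a constant Hamiltonian with entries \<open>a0, b0, c0\<close> the row vector \<open>(-\<zeta>, 1)\<close> is an eigenvector of
  the system, so \<open>y2 - \<zeta> y1\<close> evolves by the factor \<open>exp (- \<i> z h x)\<close> and does not decay. Since the
  energy dominates \<open>c0 |y2 - \<zeta> y1|\<^sup>2\<close>, this bounds \<open>m - \<zeta>\<close>. The deviation of the Hamiltonian from the
  constant one is integrated by parts.
\<close>

lemma weyl_estimate: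
  fixes a0 b0 c0 h \<epsilon> X S :: real and m \<zeta> :: complex
  assumes sol: "solution z y1 y2" and init: "y1 0 = 1" "y2 0 = m" and z: "0 < Im z"
    and nonneg: "\<And>x. 0 \<le> x \<Longrightarrow> 0 \<le> Im (cnj (y1 x) * y2 x)"
    and c0: "c0 > 0" and h: "h \<ge> 0" "h\<^sup>2 = a0 * c0 - b0\<^sup>2"
    and \<zeta>: "\<zeta> = (\<i> * of_real h - of_real b0) / of_real c0"
    and X: "X > 0" and \<epsilon>: "\<epsilon> \<ge> 0" and S: "S = cmod z * X"
    and dev: "\<And>t. 0 \<le> t \<Longrightarrow> t \<le> X \<Longrightarrow> \<bar>integral {0..t} a - a0 * t\<bar> \<le> \<epsilon> * X"
      "\<And>t. 0 \<le> t \<Longrightarrow> t \<le> X \<Longrightarrow> \<bar>integral {0..t} b - b0 * t\<bar> \<le> \<epsilon> * X"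
      "\<And>t. 0 \<le> t \<Longrightarrow> t \<le> X \<Longrightarrow> \<bar>integral {0..t} c - c0 * t\<bar> \<le> \<epsilon> * X"
  shows "c0 / 2 * (cmod (m - \<zeta>))\<^sup>2 \<le> Im m / (Im z * X)
     + \<epsilon> * (exp (2 * S) * (1 + (cmod m)\<^sup>2)) * (16 * S + 4 + c0 * \<epsilon> * ((1 + cmod \<zeta>) * (S\<^sup>2 * (2 * h + 4) + 2 * S))\<^sup>2)"
proof -
  \<comment> \<open>The growth bound for both components on [0, X], where |z|t <= S.\<close>
  define K where "K = sqrt (exp (2 * S) * (1 + (cmod m)\<^sup>2))"
  have K: "0 \<le> K" "K\<^sup>2 = exp (2 * S) * (1 + (cmod m)\<^sup>2)" by (auto simp: K_def)
  define PA where "PA t = integral {0..t} a - a0 * t" for t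
  define PB where "PB t = integral {0..t} b - b0 * t" for t
  define PC where "PC t = integral {0..t} c - c0 * t" for t
  have P: "\<bar>PA t\<bar> \<le> \<epsilon> * X" "\<bar>PB t\<bar> \<le> \<epsilon> * X" "\<bar>PC t\<bar> \<le> \<epsilon> * X" if "t \<in> {0..X}" for t
    using dev that by (auto simp: PA_def PB_def PC_def)
  have P0: "PA 0 = 0" "PB 0 = 0" "PC 0 = 0" by (auto simp: PA_def PB_def PC_def)
  have acP: "abs_continuous_on {0..t} PA" "abs_continuous_on {0..t} PB" "abs_continuous_on {0..t} PC" for t
    unfolding PA_def PB_def PC_def by (intro ac_intros primitive_ac)+
  have yK: "cmod (y1 t) \<le> K" "cmod (y2 t) \<le> K" if t: "t \<in> {0..X}" for t
  proof -
    have "(cmod (y1 t))\<^sup>2 + (cmod (y2 t))\<^sup>2 \<le> exp (2 * cmod z * t) * (1 + (cmod m)\<^sup>2)"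
      using solution_norm_growth(1)[OF sol, of t] t init by simp
    also have "\<dots> \<le> exp (2 * S) * (1 + (cmod m)\<^sup>2)"
      using t X by (intro mult_right_mono) (auto simp: S mult_left_mono)
    also have "\<dots> = K\<^sup>2" by (simp add: K)
    finally have *: "(cmod (y1 t))\<^sup>2 + (cmod (y2 t))\<^sup>2 \<le> K\<^sup>2" .
    have "(cmod (y1 t))\<^sup>2 \<le> K\<^sup>2" "(cmod (y2 t))\<^sup>2 \<le> K\<^sup>2"
      using * zero_le_power2[of "cmod (y1 t)"] zero_le_power2[of "cmod (y2 t)"] by linarith+
    then show "cmod (y1 t) \<le> K" "cmod (y2 t) \<le> K" using K(1) power2_le_imp_le by blast+
  qed
  define d1 where "d1 t = z * (of_real (b t) * y1 t + of_real (c t) * y2 t)" for t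
  define d2 where "d2 t = - z * (of_real (a t) * y1 t + of_real (b t) * y2 t)" for t
  have ae: "AE t\<in>{0..s} in lebesgue.
      (y1 has_vector_derivative d1 t) (at t within {0..s}) \<and> (y2 has_vector_derivative d2 t) (at t within {0..s}) \<and>
      (PA has_vector_derivative a t - a0) (at t within {0..s}) \<and> (PB has_vector_derivative b t - b0) (at t within {0..s}) \<and>
      (PC has_vector_derivative c t - c0) (at t within {0..s}) \<and>
      cmod (d1 t) \<le> 2 * cmod z * K \<and> cmod (d2 t) \<le> 2 * cmod z * K" if s: "0 \<le> s" "s \<le> X" for s
    using solution_AE[OF sol order_refl, of s] primitive_AE[OF s(1)]
  proof eventually_elim
    case (elim t)
    show ?case
    proof (intro impI conjI)
      assume t: "t \<in> {0..s}"
      then have tX: "t \<in> {0..X}" using s by auto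
      show "(y1 has_vector_derivative d1 t) (at t within {0..s})" "(y2 has_vector_derivative d2 t) (at t within {0..s})"
        using elim t unfolding d1_def d2_def by blast+
      have I: "((\<lambda>t. integral {0..t} a) has_vector_derivative a t) (at t within {0..s})"
        "((\<lambda>t. integral {0..t} b) has_vector_derivative b t) (at t within {0..s})"
        "((\<lambda>t. integral {0..t} c) has_vector_derivative c t) (at t within {0..s})"
        using elim t by blast+
      show "(PA has_vector_derivative a t - a0) (at t within {0..s})" unfolding PA_def
        by (rule has_vector_derivative_eq_rhs, (rule vd_intros I)+) simp
      show "(PB has_vector_derivative b t - b0) (at t within {0..s})" unfolding PB_def
        by (rule has_vector_derivative_eq_rhs, (rule vd_intros I)+) simp
      show "(PC has_vector_derivative c t - c0) (at t within {0..s})" unfolding PC_def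
        by (rule has_vector_derivative_eq_rhs, (rule vd_intros I)+) simp
      have H: "\<bar>a t\<bar> \<le> 1" "\<bar>b t\<bar> \<le> 1" "\<bar>c t\<bar> \<le> 1"
        using elim t psd_entries_le_1[of "a t" "c t" "b t"] by auto
      have *: "cmod (of_real r * y1 t + of_real s * y2 t) \<le> K + K" if "\<bar>r\<bar> \<le> 1" "\<bar>s\<bar> \<le> 1" for r s :: real
      proof -
        have "cmod (of_real r * y1 t + of_real s * y2 t) \<le> \<bar>r\<bar> * cmod (y1 t) + \<bar>s\<bar> * cmod (y2 t)"
          by (rule order_trans[OF norm_triangle_ineq]) (simp add: norm_mult)
        also have "\<dots> \<le> 1 * K + 1 * K"
          using that yK[OF tX] by (intro add_mono mult_mono) auto
        finally show ?thesis by simp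
      qed
      show "cmod (d1 t) \<le> 2 * cmod z * K"
        using mult_left_mono[OF *[OF H(2,3)], of "cmod z"] by (simp add: d1_def norm_mult)
      show "cmod (d2 t) \<le> 2 * cmod z * K"
        using mult_left_mono[OF *[OF H(1,2)], of "cmod z"] by (simp add: d2_def norm_mult)
    qed
  qed
  define Q where "Q = (1 + cmod \<zeta>) * (\<epsilon> * X)"
  have Q: "0 \<le> Q" using \<epsilon> X by (simp add: Q_def)
  \<comment> \<open>The row (p, q) is (1, \<zeta>) times the primitive of H - H0. This row appears
    because y2' - \<zeta> y1' = -z (1, \<zeta>) H y.\<close>
  define p where "p t = of_real (PA t) + \<zeta> * of_real (PB t)" for t
  define q where "q t = of_real (PB t) + \<zeta> * of_real (PC t)" for t
  have pq: "cmod (p t) \<le> Q" "cmod (q t) \<le> Q" if t: "t \<in> {0..X}" for t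
  proof -
    have *: "cmod (of_real r + \<zeta> * of_real s) \<le> Q" if "\<bar>r\<bar> \<le> \<epsilon> * X" "\<bar>s\<bar> \<le> \<epsilon> * X" for r s :: real
    proof -
      have "cmod (of_real r + \<zeta> * of_real s) \<le> \<bar>r\<bar> + cmod \<zeta> * \<bar>s\<bar>"
        by (rule order_trans[OF norm_triangle_ineq]) (simp add: norm_mult)
      also have "\<dots> \<le> \<epsilon> * X + cmod \<zeta> * (\<epsilon> * X)"
        using that by (intro add_mono mult_left_mono) auto
      finally show ?thesis by (simp add: Q_def algebra_simps)
    qed
    show "cmod (p t) \<le> Q" "cmod (q t) \<le> Q" unfolding p_def q_def using * P[OF t] by auto
  qed
  have pyq: "cmod (p t * u + q t * v) \<le> 2 * (Q * M)" if "t \<in> {0..X}" "cmod u \<le> M" "cmod v \<le> M" for t u v M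
  proof -
    have "cmod (p t * u + q t * v) \<le> cmod (p t) * cmod u + cmod (q t) * cmod v"
      by (rule order_trans[OF norm_triangle_ineq]) (simp add: norm_mult)
    also have "\<dots> \<le> Q * M + Q * M"
      using that pq[OF that(1)] Q by (intro add_mono mult_mono) auto
    finally show ?thesis by (simp only: mult_2)
  qed
  define w where "w = \<i> * z * of_real h"
  define E where "E t = exp (t *\<^sub>R w)" for t
  have normw: "cmod w = cmod z * h" using h(1) by (simp add: w_def norm_mult)
  \<comment> \<open>The real part of \<open>w\<close> is -h Im z <= 0, so the integrating factor
    stays in the unit disc.\<close>
  have E1: "cmod (E t) \<le> 1" if "0 \<le> t" for t
    using that z h(1) by (simp add: E_def w_def)
  have zE: "cmod (z * E t) \<le> cmod z" if "0 \<le> t" for t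
    using mult_left_mono[OF E1[OF that], of "cmod z"] by (simp add: norm_mult)
  define D where "D t = y2 t - \<zeta> * y1 t" for t
  \<comment> \<open>For H = H0 the product E D would be constant. The second summand is the boundary
    term of the integration by parts: it cancels p' and q', so that the derivative of \<Phi>
    contains only the small p and q.\<close>
  define \<Phi> where "\<Phi> t = E t * D t + z * E t * (p t * y1 t + q t * y2 t)" for t
  \<comment> \<open>Together with \<open>e2\<close> this says (1, \<zeta>) H0 = ih (-\<zeta>, 1), so
    D has rate -izh in the constant system.\<close>
  have e1: "of_real b0 + \<zeta> * of_real c0 = \<i> * of_real h" using c0 by (simp add: \<zeta>)
  have e2: "of_real a0 + \<zeta> * of_real b0 = - (\<i> * of_real h * \<zeta>)"
  proof -
    have "of_real c0 * (of_real a0 + \<zeta> * of_real b0 + \<i> * of_real h * \<zeta>)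
        = of_real c0 * of_real a0 + (of_real c0 * \<zeta>) * (of_real b0 + \<i> * of_real h)" by (simp add: algebra_simps)
    also have "of_real c0 * \<zeta> = \<i> * of_real h - of_real b0" using c0 by (simp add: \<zeta>)
    also have "of_real c0 * of_real a0 + (\<i> * of_real h - of_real b0) * (of_real b0 + \<i> * of_real h)
        = complex_of_real (a0 * c0 - b0\<^sup>2 - h\<^sup>2)" by (simp add: algebra_simps power2_eq_square)
    also have "\<dots> = 0" using h(2) by simp
    finally show ?thesis using c0 by (simp add: eq_neg_iff_add_eq_0)
  qed
  have \<Phi>bd: "cmod (\<Phi> s - \<Phi> 0) \<le> (cmod z)\<^sup>2 * Q * K * (2 * h + 4) * (s - 0)" if s: "s \<in> {0..X}" for s
  proof (rule norm_increment_le_abs_continuous)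
    show "0 \<le> s" using s by simp
    show "0 \<le> (cmod z)\<^sup>2 * Q * K * (2 * h + 4)" using Q K h(1) by simp
    show "abs_continuous_on {0..s} \<Phi>"
      unfolding \<Phi>_def E_def D_def p_def q_def scaleR_conv_of_real
      by (intro ac_intros abs_continuous_on_exp solution_ac[OF sol] acP order_refl)
    show "AE t\<in>{0..s} in lebesgue. \<exists>d. (\<Phi> has_vector_derivative d) (at t within {0..s}) \<and> norm d \<le> (cmod z)\<^sup>2 * Q * K * (2 * h + 4)"
      using ae[OF atLeastAtMost_iff[THEN iffD1, OF s, THEN conjunct1] atLeastAtMost_iff[THEN iffD1, OF s, THEN conjunct2]]
    proof eventually_elim
      case (elim t)
      show ?case
      proof
        assume t: "t \<in> {0..s}"
        then have tX: "t \<in> {0..X}" using s by auto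
        have V: "(y1 has_vector_derivative d1 t) (at t within {0..s})" "(y2 has_vector_derivative d2 t) (at t within {0..s})"
          "(PA has_vector_derivative a t - a0) (at t within {0..s})" "(PB has_vector_derivative b t - b0) (at t within {0..s})"
          "(PC has_vector_derivative c t - c0) (at t within {0..s})"
          and db: "cmod (d1 t) \<le> 2 * cmod z * K" "cmod (d2 t) \<le> 2 * cmod z * K"
          using elim t by blast+
        define p' where "p' = of_real (a t - a0) + \<zeta> * of_real (b t - b0)"
        define q' where "q' = of_real (b t - b0) + \<zeta> * of_real (c t - c0)"
        have Vp: "(p has_vector_derivative p') (at t within {0..s})" unfolding p_def p'_def
          by (rule has_vector_derivative_eq_rhs, (rule vd_intros V)+) simp
        have Vq: "(q has_vector_derivative q') (at t within {0..s})" unfolding q_def q'_def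
          by (rule has_vector_derivative_eq_rhs, (rule vd_intros V)+) simp
        have VE: "(E has_vector_derivative E t * w) (at t within {0..s})"
          unfolding E_def by (rule exp_scaleR_has_vector_derivative_right)
        have zero: "w * D t + (d2 t - \<zeta> * d1 t) + z * (p' * y1 t + q' * y2 t) = 0"
        proof -
          have "w * D t + (d2 t - \<zeta> * d1 t) + z * (p' * y1 t + q' * y2 t)
             = z * ((\<i> * of_real h - (of_real b0 + \<zeta> * of_real c0)) * y2 t
                   - ((of_real a0 + \<zeta> * of_real b0) + \<i> * of_real h * \<zeta>) * y1 t)"
            by (simp add: w_def D_def d1_def d2_def p'_def q'_def algebra_simps)
          then show ?thesis unfolding e1 e2 by simp
        qed
        have "(\<Phi> has_vector_derivative E t * (w * D t + (d2 t - \<zeta> * d1 t) + z * (p' * y1 t + q' * y2 t))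
              + z * E t * (w * (p t * y1 t + q t * y2 t) + (p t * d1 t + q t * d2 t))) (at t within {0..s})"
          unfolding \<Phi>_def D_def
          by (rule has_vector_derivative_eq_rhs, (rule vd_intros V(1,2) Vp Vq VE)+) (simp add: D_def algebra_simps)
        then have VF: "(\<Phi> has_vector_derivative z * E t * (w * (p t * y1 t + q t * y2 t) + (p t * d1 t + q t * d2 t))) (at t within {0..s})"
          unfolding zero by simp
        have "cmod (w * (p t * y1 t + q t * y2 t) + (p t * d1 t + q t * d2 t))
            \<le> cmod w * cmod (p t * y1 t + q t * y2 t) + cmod (p t * d1 t + q t * d2 t)"
          by (rule order_trans[OF norm_triangle_ineq]) (simp add: norm_mult)
        also have "\<dots> \<le> cmod w * (2 * (Q * K)) + 2 * (Q * (2 * cmod z * K))"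
          by (intro add_mono mult_left_mono pyq tX yK db) auto
        also have "\<dots> = cmod z * Q * K * (2 * h + 4)" by (simp add: normw algebra_simps)
        finally have "cmod (z * E t) * cmod (w * (p t * y1 t + q t * y2 t) + (p t * d1 t + q t * d2 t))
            \<le> cmod z * (cmod z * Q * K * (2 * h + 4))"
          using zE[of t] t Q K(1) h(1) by (intro mult_mono) simp_all
        then have "norm (z * E t * (w * (p t * y1 t + q t * y2 t) + (p t * d1 t + q t * d2 t))) \<le> (cmod z)\<^sup>2 * Q * K * (2 * h + 4)"
          by (simp add: norm_mult power2_eq_square mult.assoc)
        with VF show "\<exists>d. (\<Phi> has_vector_derivative d) (at t within {0..s}) \<and> norm d \<le> (cmod z)\<^sup>2 * Q * K * (2 * h + 4)" by blast
      qed
    qed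
  qed
  \<comment> \<open>The part with S^2 bounds the change of \<Phi> over [0, X], the part 2S the
    boundary term at t.\<close>
  define err where "err = \<epsilon> * K * ((1 + cmod \<zeta>) * (S\<^sup>2 * (2 * h + 4) + 2 * S))"
  have err0: "0 \<le> err" using \<epsilon> K(1) h(1) X by (simp add: err_def S)
  have \<Phi>0: "\<Phi> 0 = m - \<zeta>" by (simp add: \<Phi>_def E_def D_def p_def q_def P0 init)
  have Dlow: "(cmod (m - \<zeta>))\<^sup>2 / 2 - err\<^sup>2 \<le> (cmod (D t))\<^sup>2" if t: "t \<in> {0..X}" for t
  proof -
    have "cmod (\<Phi> t - \<Phi> 0) \<le> (cmod z)\<^sup>2 * Q * K * (2 * h + 4) * X"
      using \<Phi>bd[OF t] t Q K h(1) by (elim order_trans) (intro mult_left_mono, auto)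
    also have "\<dots> = \<epsilon> * K * ((1 + cmod \<zeta>) * (S\<^sup>2 * (2 * h + 4)))"
      by (simp add: Q_def S power2_eq_square algebra_simps)
    finally have 1: "cmod (\<Phi> t - \<Phi> 0) \<le> \<epsilon> * K * ((1 + cmod \<zeta>) * (S\<^sup>2 * (2 * h + 4)))" .
    have "cmod (z * E t) * cmod (p t * y1 t + q t * y2 t) \<le> cmod z * (2 * (Q * K))"
      using zE[of t] t Q K(1) by (intro mult_mono pyq yK) simp_all
    also have "\<dots> = \<epsilon> * K * ((1 + cmod \<zeta>) * (2 * S))" by (simp add: Q_def S algebra_simps)
    finally have 2: "cmod (z * E t * (p t * y1 t + q t * y2 t)) \<le> \<epsilon> * K * ((1 + cmod \<zeta>) * (2 * S))"
      by (simp add: norm_mult)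
    have "m - \<zeta> = E t * D t + z * E t * (p t * y1 t + q t * y2 t) - (\<Phi> t - \<Phi> 0)"
      by (simp add: \<Phi>_def[of t] \<Phi>0)
    then have "cmod (m - \<zeta>) \<le> cmod (E t * D t) + cmod (z * E t * (p t * y1 t + q t * y2 t)) + cmod (\<Phi> t - \<Phi> 0)"
      using norm_triangle_ineq4[of "E t * D t + z * E t * (p t * y1 t + q t * y2 t)" "\<Phi> t - \<Phi> 0"]
        norm_triangle_ineq[of "E t * D t" "z * E t * (p t * y1 t + q t * y2 t)"] by simp
    also have "\<dots> \<le> cmod (D t) + err"
      using 1 2 E1[of t] t mult_right_mono[of "cmod (E t)" 1 "cmod (D t)"]
      by (simp add: norm_mult err_def algebra_simps)
    finally have "(cmod (m - \<zeta>))\<^sup>2 \<le> (cmod (D t) + err)\<^sup>2" by (intro power_mono) auto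
    also have "\<dots> \<le> 2 * (cmod (D t))\<^sup>2 + 2 * err\<^sup>2"
      using zero_le_power2[of "cmod (D t) - err"] by (simp add: power2_eq_square algebra_simps)
    finally show ?thesis by simp
  qed
  define g where "g t = Im (cnj (y1 t) * y2 t)" for t
  \<comment> \<open>This is y*Py with P the primitive of H - H0. Adding Im z \<Psi> to the flux
    replaces H by H0 in the derivative, up to the terms \<open>rem\<close> in which P is not
    differentiated.\<close>
  define \<Psi> where "\<Psi> t = PA t * (cmod (y1 t))\<^sup>2 + 2 * PB t * Re (cnj (y1 t) * y2 t) + PC t * (cmod (y2 t))\<^sup>2" for t
  define G where "G t = g t + Im z * \<Psi> t" for t
  have "G X - G 0 \<le> (- Im z * (c0 * ((cmod (m - \<zeta>))\<^sup>2 / 2 - err\<^sup>2)) + Im z * (16 * \<epsilon> * S * K\<^sup>2)) * (X - 0)"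
  proof (rule increment_le_abs_continuous)
    show "0 \<le> X" using X by simp
    show "abs_continuous_on {0..X} G" unfolding G_def g_def \<Psi>_def
      by (intro ac_intros abs_continuous_on_norm_sq solution_ac[OF sol] acP order_refl)
    show "AE t\<in>{0..X} in lebesgue. \<exists>d. (G has_vector_derivative d) (at t within {0..X}) \<and>
        d \<le> - Im z * (c0 * ((cmod (m - \<zeta>))\<^sup>2 / 2 - err\<^sup>2)) + Im z * (16 * \<epsilon> * S * K\<^sup>2)"
      using ae[OF less_imp_le[OF X] order_refl]
    proof eventually_elim
      case (elim t)
      show ?case
      proof
        assume t: "t \<in> {0..X}"
        have V: "(y1 has_vector_derivative d1 t) (at t within {0..X})" "(y2 has_vector_derivative d2 t) (at t within {0..X})"
          "(PA has_vector_derivative a t - a0) (at t within {0..X})" "(PB has_vector_derivative b t - b0) (at t within {0..X})"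
          "(PC has_vector_derivative c t - c0) (at t within {0..X})"
          and db: "cmod (d1 t) \<le> 2 * cmod z * K" "cmod (d2 t) \<le> 2 * cmod z * K"
          using elim t by blast+
        have Vg: "(g has_vector_derivative - Im z * energy_density (a t) (b t) (c t) (y1 t) (y2 t)) (at t within {0..X})"
          unfolding g_def using flux_derivative[of y1 z t y2 "{0..X}"] V(1,2) unfolding d1_def d2_def by blast
        define rem where "rem = PA t * (2 * Re (cnj (y1 t) * d1 t)) + 2 * PB t * Re (cnj (d1 t) * y2 t + cnj (y1 t) * d2 t)
            + PC t * (2 * Re (cnj (y2 t) * d2 t))"
        define dA where "dA = a0 * (cmod (y1 t))\<^sup>2 + 2 * b0 * Re (cnj (y1 t) * y2 t) + c0 * (cmod (y2 t))\<^sup>2"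
        have VG: "(G has_vector_derivative - Im z * dA + Im z * rem) (at t within {0..X})"
          unfolding G_def \<Psi>_def
          by (rule has_vector_derivative_eq_rhs, (rule vd_intros has_vector_derivative_norm_sq V Vg)+)
             (simp add: dA_def rem_def energy_density_def algebra_simps)
        have "c0 * ((cmod (m - \<zeta>))\<^sup>2 / 2 - err\<^sup>2) \<le> c0 * (cmod (D t))\<^sup>2"
          using Dlow[OF t] c0 by (intro mult_left_mono) auto
        also have "\<dots> \<le> dA"
          using quadratic_form_root[OF c0 h(2) \<zeta>, of "y1 t" "y2 t"] nonneg[of t] t h(1)
          unfolding dA_def D_def by simp
        finally have dA: "c0 * ((cmod (m - \<zeta>))\<^sup>2 / 2 - err\<^sup>2) \<le> dA" .
        have *: "\<bar>Re (cnj u * v)\<bar> \<le> K * (2 * cmod z * K)" if "cmod u \<le> K" "cmod v \<le> 2 * cmod z * K" for u v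
        proof -
          have "\<bar>Re (cnj u * v)\<bar> \<le> cmod u * cmod v" using abs_Re_le_cmod[of "cnj u * v"] by (simp add: norm_mult)
          also have "\<dots> \<le> K * (2 * cmod z * K)" using that K(1) by (intro mult_mono) auto
          finally show ?thesis .
        qed
        define k where "k = K * (2 * cmod z * K)"
        have b1: "\<bar>Re (cnj (y1 t) * d1 t)\<bar> \<le> k" "\<bar>Re (cnj (y1 t) * d2 t)\<bar> \<le> k" "\<bar>Re (cnj (y2 t) * d2 t)\<bar> \<le> k"
          unfolding k_def using * yK[OF t] db by blast+
        have b2: "\<bar>Re (cnj (d1 t) * y2 t)\<bar> \<le> k"
          using *[OF yK(2)[OF t] db(1)] unfolding k_def by (simp add: mult.commute)
        have k: "0 \<le> k" using K(1) by (simp add: k_def)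
        have pr: "\<bar>x * (2 * r)\<bar> \<le> \<epsilon> * X * (2 * k)" if "\<bar>x\<bar> \<le> \<epsilon> * X" "\<bar>r\<bar> \<le> k" for x r
          using that k \<epsilon> X unfolding abs_mult by (intro mult_mono) simp_all
        have "rem = PA t * (2 * Re (cnj (y1 t) * d1 t)) + PB t * (2 * Re (cnj (d1 t) * y2 t))
            + PB t * (2 * Re (cnj (y1 t) * d2 t)) + PC t * (2 * Re (cnj (y2 t) * d2 t))"
          unfolding rem_def plus_complex.sel by (simp only: distrib_left mult_ac add_ac)
        then have "rem \<le> 4 * (\<epsilon> * X * (2 * k))"
          using pr[OF P(1)[OF t] b1(1)] pr[OF P(2)[OF t] b2] pr[OF P(2)[OF t] b1(2)] pr[OF P(3)[OF t] b1(3)]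
          by linarith
        also have "\<dots> = 16 * \<epsilon> * S * K\<^sup>2" by (simp add: k_def S power2_eq_square)
        finally have "rem \<le> 16 * \<epsilon> * S * K\<^sup>2" .
        then have "Im z * rem \<le> Im z * (16 * \<epsilon> * S * K\<^sup>2)" using z by (intro mult_left_mono) simp_all
        then have "- Im z * dA + Im z * rem \<le> - Im z * (c0 * ((cmod (m - \<zeta>))\<^sup>2 / 2 - err\<^sup>2)) + Im z * (16 * \<epsilon> * S * K\<^sup>2)"
          using mult_left_mono[OF dA less_imp_le[OF z]] unfolding mult_minus_left by linarith
        with VG show "\<exists>d. (G has_vector_derivative d) (at t within {0..X}) \<and>
          d \<le> - Im z * (c0 * ((cmod (m - \<zeta>))\<^sup>2 / 2 - err\<^sup>2)) + Im z * (16 * \<epsilon> * S * K\<^sup>2)" by blast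
      qed
    qed
  qed
  moreover have "G 0 = Im m" by (simp add: G_def \<Psi>_def g_def P0 init)
  \<comment> \<open>At X the flux is discarded by its sign, which leaves only the boundary term
    \<Psi>.\<close>
  moreover have "- (Im z * (4 * (\<epsilon> * X) * K\<^sup>2)) \<le> G X"
  proof -
    have t: "X \<in> {0..X}" using X by simp
    have "\<bar>Re (cnj (y1 X) * y2 X)\<bar> \<le> cmod (y1 X) * cmod (y2 X)"
      using abs_Re_le_cmod[of "cnj (y1 X) * y2 X"] by (simp add: norm_mult)
    also have "\<dots> \<le> K * K" using yK[OF t] K(1) by (intro mult_mono) auto
    finally have B: "\<bar>Re (cnj (y1 X) * y2 X)\<bar> \<le> K\<^sup>2" by (simp add: power2_eq_square)
    have A: "(cmod (y1 X))\<^sup>2 \<le> K\<^sup>2" "(cmod (y2 X))\<^sup>2 \<le> K\<^sup>2" using yK[OF t] by (auto intro: power_mono)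
    have pr: "\<bar>x * r\<bar> \<le> \<epsilon> * X * K\<^sup>2" if "\<bar>x\<bar> \<le> \<epsilon> * X" "\<bar>r\<bar> \<le> K\<^sup>2" for x r
      using that \<epsilon> X unfolding abs_mult by (intro mult_mono) simp_all
    have "- (4 * (\<epsilon> * X) * K\<^sup>2) \<le> \<Psi> X"
      using pr[OF P(1)[OF t], of "(cmod (y1 X))\<^sup>2"] pr[OF P(2)[OF t] B] pr[OF P(3)[OF t], of "(cmod (y2 X))\<^sup>2"] A
      unfolding \<Psi>_def abs_power2 mult.assoc by linarith
    from mult_left_mono[OF this, of "Im z"] have "- (Im z * (4 * (\<epsilon> * X) * K\<^sup>2)) \<le> Im z * \<Psi> X" using z by simp
    moreover have "0 \<le> g X" using nonneg[of X] X by (simp add: g_def)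
    ultimately show ?thesis by (simp add: G_def)
  qed
  ultimately have main: "Im z * X * (c0 * ((cmod (m - \<zeta>))\<^sup>2 / 2)) \<le> Im m + Im z * X * (\<epsilon> * K\<^sup>2 * (16 * S + 4) + c0 * err\<^sup>2)"
    by (simp add: algebra_simps)
  define T where "T = Im z * X"
  have T: "T > 0" using z X by (simp add: T_def)
  have "c0 * ((cmod (m - \<zeta>))\<^sup>2 / 2) \<le> (Im m + T * (\<epsilon> * K\<^sup>2 * (16 * S + 4) + c0 * err\<^sup>2)) / T"
    using main T unfolding T_def[symmetric] by (simp add: pos_le_divide_eq mult.commute)
  also have "\<dots> = Im m / T + (\<epsilon> * K\<^sup>2 * (16 * S + 4) + c0 * err\<^sup>2)" using T by (simp add: add_divide_distrib)
  also have "err\<^sup>2 = \<epsilon>\<^sup>2 * K\<^sup>2 * ((1 + cmod \<zeta>) * (S\<^sup>2 * (2 * h + 4) + 2 * S))\<^sup>2"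
    by (simp add: err_def power_mult_distrib)
  also have "\<epsilon> * K\<^sup>2 * (16 * S + 4) + c0 * (\<epsilon>\<^sup>2 * K\<^sup>2 * ((1 + cmod \<zeta>) * (S\<^sup>2 * (2 * h + 4) + 2 * S))\<^sup>2)
     = \<epsilon> * K\<^sup>2 * (16 * S + 4 + c0 * \<epsilon> * ((1 + cmod \<zeta>) * (S\<^sup>2 * (2 * h + 4) + 2 * S))\<^sup>2)"
    unfolding power2_eq_square[of \<epsilon>] by (simp only: distrib_left mult_ac)
  finally show ?thesis unfolding T_def K(2) by simp
qed

end

text \<open>On the compact interval of angles the sine attains a positive minimum, which serves as
  \<eta>.\<close>

lemma sector_Im_ge:
  assumes "0 < \<delta>1" "\<delta>1 \<le> \<delta>2" "\<delta>2 < pi"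
  obtains \<eta> where "\<eta> > 0" "\<And>z. z \<in> closed_sector \<delta>1 \<delta>2 \<Longrightarrow> \<eta> * cmod z \<le> Im z"
proof -
  obtain t where t: "t \<in> {\<delta>1..\<delta>2}" "\<And>s. s \<in> {\<delta>1..\<delta>2} \<Longrightarrow> sin t \<le> sin s"
  proof -
    have "continuous_on {\<delta>1..\<delta>2} sin" by (intro continuous_intros)
    moreover have "{\<delta>1..\<delta>2} \<noteq> {}" using assms(2) by simp
    ultimately show ?thesis using continuous_attains_inf[OF compact_Icc] that by metis
  qed
  have "sin t > 0" using t(1) assms by (intro sin_gt_zero) auto
  moreover have "sin t * cmod z \<le> Im z" if "z \<in> closed_sector \<delta>1 \<delta>2" for z
  proof -
    have "Im z = cmod z * sin (Arg z)" using rcis_cmod_Arg[of z] Im_rcis by metis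
    moreover have "cmod z * sin t \<le> cmod z * sin (Arg z)"
      using that t(2)[of "Arg z"] by (intro mult_left_mono) (auto simp: closed_sector_def)
    ultimately show ?thesis by (simp add: mult.commute)
  qed
  ultimately show ?thesis by (rule that)
qed

text \<open>\<theta> and \<phi> stand for the first and second column of the fundamental matrix. The
  m-function enters through the nonnegative flux of \<theta> + m \<phi> in the upper half plane, the
  form in which square integrability is used.\<close>

locale weyl_system = trace_normed_system +
  fixes \<theta>1 \<theta>2 \<phi>1 \<phi>2 :: "complex \<Rightarrow> real \<Rightarrow> complex" and m :: "complex \<Rightarrow> complex"
  assumes solution_theta: "solution z (\<theta>1 z) (\<theta>2 z)"
    and solution_phi: "solution z (\<phi>1 z) (\<phi>2 z)"
    and init: "\<theta>1 z 0 = 1" "\<theta>2 z 0 = 0" "\<phi>1 z 0 = 0" "\<phi>2 z 0 = 1"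
    and weyl: "0 < Im z \<Longrightarrow> 0 \<le> x \<Longrightarrow>
      0 \<le> Im (cnj (\<theta>1 z x + m z * \<phi>1 z x) * (\<theta>2 z x + m z * \<phi>2 z x))"
begin

text \<open>With X = S/|z| the estimate has a fixed S, and X tends to 0 as |z| grows. A large S
  makes the flux term Im m / (Im z X) small; a small \<epsilon> then beats the exponential in S.
  Nothing is known beforehand about the size of m, so both terms carry the factor 1 + |m|^2, which
  is finally absorbed into |m - \<zeta>|^2.\<close>

theorem tendsto_in_sectors_if_means_converge:
  fixes a0 b0 c0 h :: real
  assumes means: "((\<lambda>x. integral {0..x} a / x) \<longlongrightarrow> a0) (at_right 0)"
      "((\<lambda>x. integral {0..x} b / x) \<longlongrightarrow> b0) (at_right 0)"
      "((\<lambda>x. integral {0..x} c / x) \<longlongrightarrow> c0) (at_right 0)"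
    and c0: "c0 > 0" and h: "h \<ge> 0" "h\<^sup>2 = a0 * c0 - b0\<^sup>2"
    and \<zeta>: "\<zeta> = (\<i> * of_real h - of_real b0) / of_real c0"
  shows "tendsto_in_sectors m \<zeta>"
  unfolding tendsto_in_sectors_def
proof (intro allI impI)
  fix \<delta>1 \<delta>2 :: real assume "0 < \<delta>1 \<and> \<delta>1 \<le> \<delta>2 \<and> \<delta>2 < pi"
  then obtain \<eta> where \<eta>: "\<eta> > 0" "\<And>z. z \<in> closed_sector \<delta>1 \<delta>2 \<Longrightarrow> \<eta> * cmod z \<le> Im z"
    using sector_Im_ge by blast
  show "(m \<longlongrightarrow> \<zeta>) (inf at_infinity (principal (closed_sector \<delta>1 \<delta>2)))"
    unfolding tendsto_iff
  proof (intro allI impI)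
    fix e :: real assume e: "e > 0"
    define Z where "Z = 1 + 2 * (cmod \<zeta>)\<^sup>2"
    have Z: "Z > 0" by (simp add: Z_def add_pos_nonneg)
    \<comment> \<open>The cap 1/4 lets 2\<kappa>|m - \<zeta>|^2 be absorbed on the left at the cost
      of a factor 2; the other entry makes the remaining 2\<kappa>Z smaller than e^2.\<close>
    define \<kappa> where "\<kappa> = min (1/4) (e\<^sup>2 / (4 * Z))"
    have \<kappa>: "\<kappa> > 0" "\<kappa> \<le> 1/4" "2 * \<kappa> * Z < e\<^sup>2"
    proof -
      show "\<kappa> > 0" "\<kappa> \<le> 1/4" using e Z by (auto simp: \<kappa>_def)
      have "\<kappa> \<le> e\<^sup>2 / (4 * Z)" by (simp add: \<kappa>_def)
      then have "2 * \<kappa> * Z \<le> e\<^sup>2 / 2" using Z by (simp add: field_simps)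
      then show "2 * \<kappa> * Z < e\<^sup>2" using zero_less_power[OF e, of 2] by linarith
    qed
    \<comment> \<open>Solves k/(\<eta>S) = k\<kappa>c0/4, which is half of the admissible error
      c0\<kappa>k/2.\<close>
    define S where "S = 4 / (c0 * \<eta> * \<kappa>)"
    have S: "S > 0" using c0 \<eta>(1) \<kappa>(1) by (simp add: S_def)
    define L where "L = exp (2 * S) * (16 * S + 4 + c0 * ((1 + cmod \<zeta>) * (S\<^sup>2 * (2 * h + 4) + 2 * S))\<^sup>2)"
    have L: "L > 0" using S c0 by (auto simp: L_def intro!: mult_pos_pos add_pos_nonneg)
    \<comment> \<open>Yields the other half of the error. Since \<epsilon> <= 1, the inner factor c0
      \<epsilon> can be replaced by c0, which is why \<open>L\<close> could be fixed before
      \<epsilon>.\<close>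
    define \<epsilon> where "\<epsilon> = min 1 (\<kappa> * c0 / (4 * L))"
    have \<epsilon>: "\<epsilon> > 0" "\<epsilon> \<le> 1" "\<epsilon> * L \<le> \<kappa> * c0 / 4"
    proof -
      show "\<epsilon> > 0" "\<epsilon> \<le> 1" using \<kappa> c0 L by (auto simp: \<epsilon>_def)
      have "\<epsilon> \<le> \<kappa> * c0 / (4 * L)" by (simp add: \<epsilon>_def)
      then show "\<epsilon> * L \<le> \<kappa> * c0 / 4" using L by (simp add: field_simps)
    qed
    have "\<forall>\<^sub>F x in at_right 0. \<bar>integral {0..x} a / x - a0\<bar> < \<epsilon> \<and> \<bar>integral {0..x} b / x - b0\<bar> < \<epsilon> \<and> \<bar>integral {0..x} c / x - c0\<bar> < \<epsilon>"
      using means[unfolded tendsto_iff dist_real_def, rule_format, OF \<epsilon>(1)] by (intro eventually_conj)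
    then obtain d where d: "d > 0" "\<And>x. 0 < x \<Longrightarrow> x < d \<Longrightarrow>
        \<bar>integral {0..x} a / x - a0\<bar> < \<epsilon> \<and> \<bar>integral {0..x} b / x - b0\<bar> < \<epsilon> \<and> \<bar>integral {0..x} c / x - c0\<bar> < \<epsilon>"
      unfolding eventually_at_right_field by auto
    \<comment> \<open>The threshold is chosen for X = S/|z| < d; the summand 1 makes this
      strict.\<close>
    have dist: "dist (m z) \<zeta> < e" if z: "S / d + 1 \<le> cmod z" "z \<in> closed_sector \<delta>1 \<delta>2" for z
    proof -
      have "0 < S / d" using S d(1) by simp
      then have z0: "cmod z > 0" using z(1) by linarith
      have Imz: "\<eta> * cmod z \<le> Im z" by (rule \<eta>(2)[OF z(2)])
      then have Imz0: "Im z > 0" using z0 \<eta>(1) by (meson mult_pos_pos order_less_le_trans)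
      define X where "X = S / cmod z"
      have X: "X > 0" "S = cmod z * X" using z0 S by (auto simp: X_def)
      have "S / d < cmod z" using z(1) by linarith
      then have Xd: "X < d" using d(1) z0 by (simp add: X_def field_simps)
      have dev: "\<bar>integral {0..t} f - l * t\<bar> \<le> \<epsilon> * X"
        if "\<And>x. 0 < x \<Longrightarrow> x < d \<Longrightarrow> \<bar>integral {0..x} f / x - l\<bar> < \<epsilon>" "0 \<le> t" "t \<le> X" for f l t
      proof (cases "t = 0")
        case True
        then show ?thesis using \<epsilon>(1) X(1) by simp
      next
        case False
        then have t: "0 < t" using that(2) by simp
        have "integral {0..t} f - l * t = (integral {0..t} f / t - l) * t" using t by (simp add: left_diff_distrib)
        then have "\<bar>integral {0..t} f - l * t\<bar> = \<bar>integral {0..t} f / t - l\<bar> * t"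
          using t by (simp only: abs_mult abs_of_pos)
        also have "\<dots> \<le> \<epsilon> * X" using that(1)[of t] that(3) t Xd \<epsilon>(1) by (intro mult_mono) auto
        finally show ?thesis .
      qed
      have est: "c0 / 2 * (cmod (m z - \<zeta>))\<^sup>2 \<le> Im (m z) / (Im z * X)
         + \<epsilon> * (exp (2 * S) * (1 + (cmod (m z))\<^sup>2)) * (16 * S + 4 + c0 * \<epsilon> * ((1 + cmod \<zeta>) * (S\<^sup>2 * (2 * h + 4) + 2 * S))\<^sup>2)"
      proof (rule weyl_estimate[OF solution_linear[OF solution_theta solution_phi] _ _ Imz0 _ c0 h \<zeta> X(1) less_imp_le[OF \<epsilon>(1)] X(2)])
        show "\<theta>1 z 0 + m z * \<phi>1 z 0 = 1" "\<theta>2 z 0 + m z * \<phi>2 z 0 = m z" using init by auto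
        show "0 \<le> Im (cnj (\<theta>1 z x + m z * \<phi>1 z x) * (\<theta>2 z x + m z * \<phi>2 z x))" if "0 \<le> x" for x
          by (rule weyl[OF Imz0 that])
        show "\<bar>integral {0..t} a - a0 * t\<bar> \<le> \<epsilon> * X" if "0 \<le> t" "t \<le> X" for t
          by (rule dev[OF _ that]) (use d(2) in blast)
        show "\<bar>integral {0..t} b - b0 * t\<bar> \<le> \<epsilon> * X" if "0 \<le> t" "t \<le> X" for t
          by (rule dev[OF _ that]) (use d(2) in blast)
        show "\<bar>integral {0..t} c - c0 * t\<bar> \<le> \<epsilon> * X" if "0 \<le> t" "t \<le> X" for t
          by (rule dev[OF _ that]) (use d(2) in blast)
      qed
      define k where "k = 1 + (cmod (m z))\<^sup>2"
      have k: "k \<ge> 1" by (simp add: k_def)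
      have "Im (m z) \<le> cmod (m z)" using abs_Im_le_cmod[of "m z"] by linarith
      also have "\<dots> \<le> k"
        using zero_le_power2[of "cmod (m z) - 1"] norm_ge_zero[of "m z"] unfolding k_def power2_diff one_power2 mult_1_right by linarith
      finally have mk: "Im (m z) \<le> k" .
      have "\<eta> * S \<le> Im z * X" using Imz X(1) by (simp add: X(2) mult_right_mono flip: mult.assoc)
      then have "Im (m z) / (Im z * X) \<le> k / (\<eta> * S)"
        using mk k \<eta>(1) S by (intro frac_le) auto
      also have "\<dots> = k * (\<kappa> * c0 / 4)" using c0 \<eta>(1) \<kappa>(1) by (simp add: S_def field_simps)
      finally have t1: "Im (m z) / (Im z * X) \<le> k * (\<kappa> * c0 / 4)" .
      define C where "C = ((1 + cmod \<zeta>) * (S\<^sup>2 * (2 * h + 4) + 2 * S))\<^sup>2"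
      have "c0 * \<epsilon> * C \<le> c0 * C" using \<epsilon>(1,2) c0 by (simp add: C_def mult_right_mono)
      then have "\<epsilon> * (exp (2 * S) * k) * (16 * S + 4 + c0 * \<epsilon> * C) \<le> \<epsilon> * (exp (2 * S) * k) * (16 * S + 4 + c0 * C)"
        using \<epsilon>(1) k by (intro mult_left_mono) auto
      also have "\<dots> = k * (\<epsilon> * L)" by (simp add: L_def C_def)
      also have "\<dots> \<le> k * (\<kappa> * c0 / 4)" using \<epsilon>(3) k by (intro mult_left_mono) auto
      finally have fin: "\<epsilon> * (exp (2 * S) * k) * (16 * S + 4 + c0 * \<epsilon> * C) \<le> k * (\<kappa> * c0 / 4)" .
      have "c0 / 2 * (cmod (m z - \<zeta>))\<^sup>2 \<le> c0 / 2 * (\<kappa> * k)"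
      proof -
        have "c0 / 2 * (\<kappa> * k) = k * (\<kappa> * c0 / 4) + k * (\<kappa> * c0 / 4)" by (simp add: field_simps)
        then show ?thesis using fin est t1 unfolding C_def[symmetric] k_def[symmetric] by linarith
      qed
      then have 1: "(cmod (m z - \<zeta>))\<^sup>2 \<le> \<kappa> * k" using c0 by simp
      have "cmod (m z) \<le> cmod (m z - \<zeta>) + cmod \<zeta>" using norm_triangle_ineq[of "m z - \<zeta>" \<zeta>] by simp
      then have "(cmod (m z))\<^sup>2 \<le> (cmod (m z - \<zeta>) + cmod \<zeta>)\<^sup>2" by (intro power_mono) auto
      also have "\<dots> \<le> 2 * (cmod (m z - \<zeta>))\<^sup>2 + 2 * (cmod \<zeta>)\<^sup>2"
        using zero_le_power2[of "cmod (m z - \<zeta>) - cmod \<zeta>"] by (simp add: power2_eq_square algebra_simps)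
      finally have "k \<le> Z + 2 * (cmod (m z - \<zeta>))\<^sup>2" by (simp add: k_def Z_def)
      then have "\<kappa> * k \<le> \<kappa> * (Z + 2 * (cmod (m z - \<zeta>))\<^sup>2)" using \<kappa>(1) by (intro mult_left_mono) auto
      also have "\<dots> \<le> \<kappa> * Z + (cmod (m z - \<zeta>))\<^sup>2 / 2"
        using mult_right_mono[OF \<kappa>(2), of "2 * (cmod (m z - \<zeta>))\<^sup>2"] by (simp add: algebra_simps)
      finally have "(cmod (m z - \<zeta>))\<^sup>2 < e\<^sup>2" using 1 \<kappa>(3) by simp
      then show ?thesis using e by (simp add: dist_norm power2_less_imp_less)
    qed
    show "\<forall>\<^sub>F z in inf at_infinity (principal (closed_sector \<delta>1 \<delta>2)). dist (m z) \<zeta> < e"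
      unfolding eventually_inf_principal eventually_at_infinity using dist by blast
  qed
qed

end

section \<open>Dependence on the spectral parameter\<close>

text \<open>A Lipschitz function is Cauchy along any sequence tending to the centre. Here
  \<open>Q\<close> will be a difference quotient, and the limit a derivative.\<close>

lemma punctured_Lipschitz_has_limit:
  fixes Q :: "complex \<Rightarrow> complex"
  assumes Q: "\<And>z z'. \<lbrakk>z \<in> cball w 1 - {w}; z' \<in> cball w 1 - {w}\<rbrakk> \<Longrightarrow> cmod (Q z - Q z') \<le> C * cmod (z - z')"
  obtains L where "(Q \<longlongrightarrow> L) (at w)"
proof -
  define z where "z n = w + of_real (inverse (real (Suc n)))" for n
  have z: "z n \<in> cball w 1 - {w}" for n
  proof -
    have "inverse (real (Suc n)) \<le> 1" "inverse (real (Suc n)) > 0" by (auto simp: inverse_le_1_iff)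
    then show ?thesis unfolding z_def by (simp add: dist_norm del: of_real_inverse of_nat_Suc)
  qed
  have zlim: "z \<longlonglongrightarrow> w"
  proof -
    have "(\<lambda>n. w + of_real (inverse (real (Suc n)))) \<longlonglongrightarrow> w + of_real 0"
      by (intro tendsto_intros LIMSEQ_inverse_real_of_nat)
    then show ?thesis by (simp add: z_def[abs_def])
  qed
  have C: "C \<le> \<bar>C\<bar> + 1" "0 < \<bar>C\<bar> + 1" by auto
  have "Cauchy (\<lambda>n. Q (z n))"
  proof (rule metric_CauchyI)
    fix e :: real assume "e > 0"
    then have e: "e / (\<bar>C\<bar> + 1) > 0" by simp
    obtain M where M: "\<And>i j. i \<ge> M \<Longrightarrow> j \<ge> M \<Longrightarrow> dist (z i) (z j) < e / (\<bar>C\<bar> + 1)"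
      using metric_CauchyD[OF LIMSEQ_imp_Cauchy[OF zlim] e] by blast
    show "\<exists>M. \<forall>i\<ge>M. \<forall>j\<ge>M. dist (Q (z i)) (Q (z j)) < e"
    proof (intro exI allI impI)
      fix i j assume "M \<le> i" "M \<le> j"
      have "dist (Q (z i)) (Q (z j)) \<le> C * dist (z i) (z j)" using Q[OF z z] by (simp add: dist_norm)
      also have "\<dots> \<le> (\<bar>C\<bar> + 1) * dist (z i) (z j)" using C(1) by (intro mult_right_mono) auto
      also have "\<dots> < (\<bar>C\<bar> + 1) * (e / (\<bar>C\<bar> + 1))"
        using M[OF \<open>M \<le> i\<close> \<open>M \<le> j\<close>] C(2) by (intro mult_strict_left_mono) auto
      finally show "dist (Q (z i)) (Q (z j)) < e" using C(2) by simp
    qed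
  qed
  then obtain L where L: "(\<lambda>n. Q (z n)) \<longlonglongrightarrow> L" using Cauchy_convergent_iff convergent_def by blast
  have bd: "cmod (Q u - L) \<le> C * cmod (u - w)" if u: "u \<in> cball w 1 - {w}" for u
  proof (rule tendsto_le[OF sequentially_bot])
    show "(\<lambda>n. C * cmod (u - z n)) \<longlonglongrightarrow> C * cmod (u - w)" by (intro tendsto_intros zlim)
    show "(\<lambda>n. cmod (Q u - Q (z n))) \<longlonglongrightarrow> cmod (Q u - L)" by (intro tendsto_intros L)
    show "\<forall>\<^sub>F n in sequentially. cmod (Q u - Q (z n)) \<le> C * cmod (u - z n)" using Q[OF u z] by simp
  qed
  have "((\<lambda>u. Q u - L) \<longlongrightarrow> 0) (at w)"
  proof (rule Lim_null_comparison)
    have "\<forall>\<^sub>F u in at w. u \<in> ball w 1 - {w}"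
      unfolding eventually_at by (intro exI[of _ 1]) (auto simp: dist_commute)
    then show "\<forall>\<^sub>F u in at w. cmod (Q u - L) \<le> C * cmod (u - w)"
      by eventually_elim (use bd in auto)
    have "((\<lambda>u. C * cmod (u - w)) \<longlongrightarrow> C * cmod (w - w)) (at w)" by (intro tendsto_intros)
    then show "((\<lambda>u. C * cmod (u - w)) \<longlongrightarrow> 0) (at w)" by simp
  qed
  then have "(Q \<longlongrightarrow> L) (at w)" by (simp add: LIM_zero_iff)
  then show ?thesis by (rule that)
qed

context trace_normed_system
begin

lemma solution_zero: "solution z (\<lambda>x. 0) (\<lambda>x. 0)"
  unfolding solution_def by (auto intro: abs_continuous_on_const)

definition wronskian :: "(real \<Rightarrow> complex) \<Rightarrow> (real \<Rightarrow> complex) \<Rightarrow> (real \<Rightarrow> complex) \<Rightarrow> (real \<Rightarrow> complex) \<Rightarrow> real \<Rightarrow> complex" where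
  "wronskian u1 u2 y1 y2 x = u2 x * y1 x - u1 x * y2 x"

text \<open>
  In matrix form \<open>(U\<^sub>w\<^sup>T J U\<^sub>z)' = (z - w) U\<^sub>w\<^sup>T H U\<^sub>z\<close>. The weights \<open>\<alpha>, \<beta>\<close> allow comparing the
  increments for two parameters \<open>z, z'\<close> after division by \<open>z - w\<close> and \<open>z' - w\<close>.
\<close>

lemma wronskian_increment:
  assumes u: "solution w u1 u2" and y: "solution z y1 y2" and v: "solution z' v1 v2" and x: "0 \<le> x"
    and \<alpha>\<beta>: "\<alpha> * (z - w) = k" "\<beta> * (z' - w) = k" and M: "0 \<le> M" and D: "0 \<le> D"
    and uM: "\<And>t. t \<in> {0..x} \<Longrightarrow> cmod (u1 t) \<le> M" "\<And>t. t \<in> {0..x} \<Longrightarrow> cmod (u2 t) \<le> M"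
    and yD: "\<And>t. t \<in> {0..x} \<Longrightarrow> cmod (y1 t - v1 t) \<le> D" "\<And>t. t \<in> {0..x} \<Longrightarrow> cmod (y2 t - v2 t) \<le> D"
  shows "cmod ((\<alpha> * wronskian u1 u2 y1 y2 x - \<beta> * wronskian u1 u2 v1 v2 x)
             - (\<alpha> * wronskian u1 u2 y1 y2 0 - \<beta> * wronskian u1 u2 v1 v2 0)) \<le> cmod k * (4 * M * D) * x"
proof -
  define f where "f t = \<alpha> * wronskian u1 u2 y1 y2 t - \<beta> * wronskian u1 u2 v1 v2 t" for t
  have "cmod (f x - f 0) \<le> (cmod k * (4 * M * D)) * (x - 0)"
  proof (rule norm_increment_le_abs_continuous[OF x])
    show "0 \<le> cmod k * (4 * M * D)" using M D by simp
    show "abs_continuous_on {0..x} f" unfolding f_def wronskian_def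
      by (intro ac_intros solution_ac[OF u] solution_ac[OF y] solution_ac[OF v] order_refl)
    show "AE t\<in>{0..x} in lebesgue. \<exists>d. (f has_vector_derivative d) (at t within {0..x}) \<and> norm d \<le> cmod k * (4 * M * D)"
      using solution_AE[OF u order_refl, of x] solution_AE[OF y order_refl, of x] solution_AE[OF v order_refl, of x]
    proof eventually_elim
      case (elim t)
      show ?case
      proof
        assume t: "t \<in> {0..x}"
        have V: "(u1 has_vector_derivative w * (of_real (b t) * u1 t + of_real (c t) * u2 t)) (at t within {0..x})"
          "(u2 has_vector_derivative - w * (of_real (a t) * u1 t + of_real (b t) * u2 t)) (at t within {0..x})"
          "(y1 has_vector_derivative z * (of_real (b t) * y1 t + of_real (c t) * y2 t)) (at t within {0..x})"
          "(y2 has_vector_derivative - z * (of_real (a t) * y1 t + of_real (b t) * y2 t)) (at t within {0..x})"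
          "(v1 has_vector_derivative z' * (of_real (b t) * v1 t + of_real (c t) * v2 t)) (at t within {0..x})"
          "(v2 has_vector_derivative - z' * (of_real (a t) * v1 t + of_real (b t) * v2 t)) (at t within {0..x})"
          using elim t by blast+
        have H: "\<bar>a t\<bar> \<le> 1" "\<bar>b t\<bar> \<le> 1" "\<bar>c t\<bar> \<le> 1"
          using elim t psd_entries_le_1[of "a t" "c t" "b t"] by blast+
        define e1 where "e1 = y1 t - v1 t"
        define e2 where "e2 = y2 t - v2 t"
        define q where "q = of_real (a t) * (u1 t * e1) + of_real (b t) * (u2 t * e1) + of_real (b t) * (u1 t * e2) + of_real (c t) * (u2 t * e2)"
        have *: "cmod (of_real r * (s * e)) \<le> M * D" if "\<bar>r\<bar> \<le> 1" "cmod s \<le> M" "cmod e \<le> D" for r :: real and s e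
        proof -
          have "\<bar>r\<bar> * (cmod s * cmod e) \<le> 1 * (M * D)" using that M D by (intro mult_mono) auto
          then show ?thesis by (simp add: norm_mult)
        qed
        have eD: "cmod e1 \<le> D" "cmod e2 \<le> D" using yD[OF t] by (auto simp: e1_def e2_def)
        have "cmod q \<le> M * D + M * D + M * D + M * D"
          unfolding q_def by (intro norm_triangle_le add_mono * H uM[OF t] eD)
        then have "cmod q \<le> 4 * (M * D)" by linarith
        then have "cmod q \<le> 4 * M * D" by (simp only: mult.assoc)
        from mult_left_mono[OF this norm_ge_zero[of k]] have qb: "cmod (k * q) \<le> cmod k * (4 * M * D)" by (simp add: norm_mult)
        have "(f has_vector_derivative
             (\<alpha> * (z - w)) * (of_real (a t) * (u1 t * y1 t) + of_real (b t) * (u2 t * y1 t) + of_real (b t) * (u1 t * y2 t) + of_real (c t) * (u2 t * y2 t))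
           - (\<beta> * (z' - w)) * (of_real (a t) * (u1 t * v1 t) + of_real (b t) * (u2 t * v1 t) + of_real (b t) * (u1 t * v2 t) + of_real (c t) * (u2 t * v2 t)))
           (at t within {0..x})"
          unfolding f_def wronskian_def
          by (rule has_vector_derivative_eq_rhs, (rule vd_intros V)+) (simp add: algebra_simps)
        then have "(f has_vector_derivative k * q) (at t within {0..x})"
          unfolding \<alpha>\<beta> q_def e1_def e2_def by (simp add: algebra_simps)
        with qb show "\<exists>d. (f has_vector_derivative d) (at t within {0..x}) \<and> norm d \<le> cmod k * (4 * M * D)" by blast
      qed
    qed
  qed
  then show ?thesis by (simp add: f_def)
qed

text \<open>Comparison with the zero solution at the same parameter, with both weights equal to
  1.\<close>

corollary wronskian_increment_single:
  assumes "solution w u1 u2" "solution z y1 y2" "0 \<le> x" "0 \<le> M" "0 \<le> D"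
    and "\<And>t. t \<in> {0..x} \<Longrightarrow> cmod (u1 t) \<le> M" "\<And>t. t \<in> {0..x} \<Longrightarrow> cmod (u2 t) \<le> M"
    and "\<And>t. t \<in> {0..x} \<Longrightarrow> cmod (y1 t) \<le> D" "\<And>t. t \<in> {0..x} \<Longrightarrow> cmod (y2 t) \<le> D"
  shows "cmod (wronskian u1 u2 y1 y2 x - wronskian u1 u2 y1 y2 0) \<le> cmod (z - w) * (4 * M * D) * x"
  using wronskian_increment[OF assms(1,2) solution_zero[of z] assms(3), of 1 "z - w" 1 M D] assms(4-)
  by (simp add: wronskian_def)

lemma solution_bound:
  assumes sol: "solution z y1 y2" and t: "t \<in> {0..x}" and z: "cmod z \<le> R"
  shows "cmod (y1 t) \<le> exp (R * x) * (cmod (y1 0) + cmod (y2 0))"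
    and "cmod (y2 t) \<le> exp (R * x) * (cmod (y1 0) + cmod (y2 0))"
proof -
  have "cmod z * t \<le> R * x" using t z order_trans[OF norm_ge_zero z] by (intro mult_mono) auto
  then have "exp (2 * cmod z * t) \<le> (exp (R * x))\<^sup>2" by (simp add: exp_double[symmetric])
  moreover have "(cmod (y1 0))\<^sup>2 + (cmod (y2 0))\<^sup>2 \<le> (cmod (y1 0) + cmod (y2 0))\<^sup>2"
    by (simp add: power2_sum)
  ultimately have "exp (2 * cmod z * t) * ((cmod (y1 0))\<^sup>2 + (cmod (y2 0))\<^sup>2) \<le> (exp (R * x))\<^sup>2 * (cmod (y1 0) + cmod (y2 0))\<^sup>2"
    by (intro mult_mono) auto
  then have *: "(cmod (y1 t))\<^sup>2 + (cmod (y2 t))\<^sup>2 \<le> (exp (R * x) * (cmod (y1 0) + cmod (y2 0)))\<^sup>2"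
    using solution_norm_growth(1)[OF sol, of t] t by (simp add: power_mult_distrib)
  have "(cmod (y1 t))\<^sup>2 \<le> (exp (R * x) * (cmod (y1 0) + cmod (y2 0)))\<^sup>2" "(cmod (y2 t))\<^sup>2 \<le> (exp (R * x) * (cmod (y1 0) + cmod (y2 0)))\<^sup>2"
    using * zero_le_power2[of "cmod (y1 t)"] zero_le_power2[of "cmod (y2 t)"] by linarith+
  then show "cmod (y1 t) \<le> exp (R * x) * (cmod (y1 0) + cmod (y2 0))" "cmod (y2 t) \<le> exp (R * x) * (cmod (y1 0) + cmod (y2 0))"
    by (auto elim!: power2_le_imp_le)
qed

end

section \<open>Means of the Hamiltonian and first-order expansion of solutions\<close>

context trace_normed_system
begin

text \<open>Each fact integrates a pointwise one; the first is the quadratic form of H at the real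
  vector (1, s).\<close>

lemma primitive_facts:
  assumes x: "0 \<le> x"
  shows primitive_psd: "0 \<le> integral {0..x} a + 2 * s * integral {0..x} b + s\<^sup>2 * integral {0..x} c"
    and primitive_trace: "integral {0..x} a + integral {0..x} c = x"
    and primitive_bounds: "\<bar>integral {0..x} a\<bar> \<le> x" "\<bar>integral {0..x} b\<bar> \<le> x" "\<bar>integral {0..x} c\<bar> \<le> x"
proof -
  define A where "A t = integral {0..t} a" for t
  define B where "B t = integral {0..t} b" for t
  define C where "C t = integral {0..t} c" for t
  have ac: "abs_continuous_on {0..x} A" "abs_continuous_on {0..x} B" "abs_continuous_on {0..x} C"
    unfolding A_def B_def C_def by (rule primitive_ac)+
  have z: "A 0 = 0" "B 0 = 0" "C 0 = 0" by (auto simp: A_def B_def C_def)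
  have ae: "AE t\<in>{0..x} in lebesgue. (A has_vector_derivative a t) (at t within {0..x}) \<and>
      (B has_vector_derivative b t) (at t within {0..x}) \<and> (C has_vector_derivative c t) (at t within {0..x}) \<and>
      0 \<le> a t \<and> 0 \<le> c t \<and> (b t)\<^sup>2 \<le> a t * c t \<and> a t + c t = 1"
    using primitive_AE[OF x] entries_AE unfolding A_def B_def C_def by eventually_elim auto
  have "(\<lambda>t. - (A t + (2 * s) * B t + s\<^sup>2 * C t)) x - (\<lambda>t. - (A t + (2 * s) * B t + s\<^sup>2 * C t)) 0 \<le> 0 * (x - 0)"
  proof (rule increment_le_abs_continuous[OF x])
    show "abs_continuous_on {0..x} (\<lambda>t. - (A t + (2 * s) * B t + s\<^sup>2 * C t))" by (intro ac_intros ac)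
    show "AE t\<in>{0..x} in lebesgue. \<exists>d. ((\<lambda>t. - (A t + (2 * s) * B t + s\<^sup>2 * C t)) has_vector_derivative d) (at t within {0..x}) \<and> d \<le> 0"
      using ae
    proof eventually_elim
      case (elim t)
      show ?case
      proof (intro impI exI conjI)
        assume t: "t \<in> {0..x}"
        have V: "(A has_vector_derivative a t) (at t within {0..x})" "(B has_vector_derivative b t) (at t within {0..x})"
          "(C has_vector_derivative c t) (at t within {0..x})" using elim t by blast+
        show "((\<lambda>t. - (A t + (2 * s) * B t + s\<^sup>2 * C t)) has_vector_derivative - (a t + 2 * s * b t + s\<^sup>2 * c t)) (at t within {0..x})"
          by (rule has_vector_derivative_eq_rhs, (rule vd_intros V)+) simp
        have "0 \<le> a t * 1 + 2 * b t * s + c t * s\<^sup>2"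
          by (rule psd_form_nonneg) (use elim t in auto)
        then show "- (a t + 2 * s * b t + s\<^sup>2 * c t) \<le> 0" by (simp add: mult_ac)
      qed
    qed
  qed
  then show "0 \<le> integral {0..x} a + 2 * s * integral {0..x} b + s\<^sup>2 * integral {0..x} c"
    using z by (simp add: A_def B_def C_def)
  have "norm ((\<lambda>t. A t + C t - t) x - (\<lambda>t. A t + C t - t) 0) \<le> 0 * (x - 0)"
  proof (rule norm_increment_le_abs_continuous[OF x order_refl])
    show "abs_continuous_on {0..x} (\<lambda>t. A t + C t - t)" by (intro ac_intros ac)
    show "AE t\<in>{0..x} in lebesgue. \<exists>d. ((\<lambda>t. A t + C t - t) has_vector_derivative d) (at t within {0..x}) \<and> norm d \<le> 0"
      using ae
    proof eventually_elim
      case (elim t)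
      show ?case
      proof (intro impI exI conjI)
        assume t: "t \<in> {0..x}"
        have V: "(A has_vector_derivative a t) (at t within {0..x})" "(C has_vector_derivative c t) (at t within {0..x})"
          using elim t by blast+
        show "((\<lambda>t. A t + C t - t) has_vector_derivative a t + c t - 1) (at t within {0..x})"
          by (rule has_vector_derivative_eq_rhs, (rule vd_intros V)+) simp
        show "norm (a t + c t - 1) \<le> 0" using elim t by simp
      qed
    qed
  qed
  then show "integral {0..x} a + integral {0..x} c = x" using z by (simp add: A_def C_def)
  have bd: "norm (F x - F 0) \<le> 1 * (x - 0)"
    if "abs_continuous_on {0..x} F" "AE t\<in>{0..x} in lebesgue. (F has_vector_derivative f t) (at t within {0..x}) \<and> \<bar>f t\<bar> \<le> 1"
    for F f :: "real \<Rightarrow> real"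
  proof (rule norm_increment_le_abs_continuous[OF x zero_le_one that(1)])
    show "AE t\<in>{0..x} in lebesgue. \<exists>d. (F has_vector_derivative d) (at t within {0..x}) \<and> norm d \<le> 1"
      using that(2) by eventually_elim auto
  qed
  have "norm (A x - A 0) \<le> 1 * (x - 0)" "norm (B x - B 0) \<le> 1 * (x - 0)" "norm (C x - C 0) \<le> 1 * (x - 0)"
    by (rule bd, rule ac, use ae in eventually_elim, use psd_entries_le_1 in blast)+
  then show "\<bar>integral {0..x} a\<bar> \<le> x" "\<bar>integral {0..x} b\<bar> \<le> x" "\<bar>integral {0..x} c\<bar> \<le> x"
    using z by (auto simp: A_def B_def C_def)
qed

text \<open>Two Picard steps: |y(t) - y(0)| <= 2|z|xM in each component, and replacing y by y(0) in
  the equation then costs at most |z|x times twice that. The error is of second order in |z|x and so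
  isolates the linear coefficient after rescaling.\<close>

lemma solution_expansion:
  assumes sol: "solution z y1 y2" and x: "0 \<le> x"
  defines "M \<equiv> exp (cmod z * x) * (cmod (y1 0) + cmod (y2 0))"
  shows "cmod (y1 x - y1 0 - z * (of_real (integral {0..x} b) * y1 0 + of_real (integral {0..x} c) * y2 0)) \<le> 4 * (cmod z * x)\<^sup>2 * M"
    and "cmod (y2 x - y2 0 + z * (of_real (integral {0..x} a) * y1 0 + of_real (integral {0..x} b) * y2 0)) \<le> 4 * (cmod z * x)\<^sup>2 * M"
proof -
  have M: "0 \<le> M" by (simp add: M_def)
  have yM: "cmod (y1 t) \<le> M" "cmod (y2 t) \<le> M" if "t \<in> {0..x}" for t
    using solution_bound[OF sol that order_refl] by (auto simp: M_def)
  have lin: "cmod (of_real r * u + of_real s * v) \<le> 2 * N" if "\<bar>r\<bar> \<le> 1" "\<bar>s\<bar> \<le> 1" "cmod u \<le> N" "cmod v \<le> N" for r s :: real and u v N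
  proof -
    have "cmod (of_real r * u + of_real s * v) \<le> \<bar>r\<bar> * cmod u + \<bar>s\<bar> * cmod v"
      by (rule order_trans[OF norm_triangle_ineq]) (simp add: norm_mult)
    also have "\<dots> \<le> 1 * N + 1 * N" using that order_trans[OF norm_ge_zero that(3)] by (intro add_mono mult_mono) auto
    finally show ?thesis by simp
  qed
  have ae: "AE t\<in>{0..s} in lebesgue.
      solves_at z y1 y2 t {0..s} \<and>
      \<bar>a t\<bar> \<le> 1 \<and> \<bar>b t\<bar> \<le> 1 \<and> \<bar>c t\<bar> \<le> 1" for s
    using solution_AE[OF sol order_refl, of s] by eventually_elim (use psd_entries_le_1 in blast)
  have step: "cmod (y1 t - y1 0) \<le> 2 * cmod z * M * x \<and> cmod (y2 t - y2 0) \<le> 2 * cmod z * M * x" if t: "t \<in> {0..x}" for t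
  proof -
    have t0: "0 \<le> t" using t by simp
    have grow: "cmod (y t - y 0) \<le> (2 * cmod z * M) * (t - 0)"
      if "abs_continuous_on {0..t} y" "AE s\<in>{0..t} in lebesgue. \<exists>d. (y has_vector_derivative d) (at s within {0..t}) \<and> cmod d \<le> 2 * cmod z * M"
      for y :: "real \<Rightarrow> complex"
      by (rule norm_increment_le_abs_continuous[OF t0 _ that]) (use M in simp)
    have zl: "cmod (w * (of_real p * y1 s + of_real q * y2 s)) \<le> 2 * cmod z * M"
      if "s \<in> {0..t}" "\<bar>p\<bar> \<le> 1" "\<bar>q\<bar> \<le> 1" "cmod w = cmod z" for p q s w
    proof -
      have "s \<in> {0..x}" using that t by auto
      then have "cmod (of_real p * y1 s + of_real q * y2 s) \<le> 2 * M" using that yM by (intro lin) auto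
      from mult_left_mono[OF this norm_ge_zero[of z]] show ?thesis by (simp add: norm_mult that)
    qed
    have "cmod (y1 t - y1 0) \<le> (2 * cmod z * M) * (t - 0)"
      by (rule grow[OF solution_ac(1)[OF sol order_refl]], use ae[of t] in eventually_elim) (metis zl)
    moreover have "cmod (y2 t - y2 0) \<le> (2 * cmod z * M) * (t - 0)"
      by (rule grow[OF solution_ac(2)[OF sol order_refl]], use ae[of t] in eventually_elim) (metis zl norm_minus_cancel)
    moreover have "(2 * cmod z * M) * (t - 0) \<le> 2 * cmod z * M * x" using t M by (intro mult_left_mono) auto
    ultimately show ?thesis by linarith
  qed
  define N where "N = 2 * cmod z * M * x"
  have N: "0 \<le> N" using M x by (simp add: N_def)
  have fin: "cmod z * (2 * N) * (x - 0) = 4 * (cmod z * x)\<^sup>2 * M" by (simp add: N_def power2_eq_square)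
  have kN: "cmod (z * (of_real r * (y1 t - y1 0) + of_real s * (y2 t - y2 0))) \<le> cmod z * (2 * N)"
    if "\<bar>r\<bar> \<le> 1" "\<bar>s\<bar> \<le> 1" "t \<in> {0..x}" for r s t
    unfolding norm_mult using step[OF that(3)] that by (intro mult_left_mono lin) (auto simp: N_def)
  define F1 where "F1 t = y1 t - y1 0 - z * (of_real (integral {0..t} b) * y1 0 + of_real (integral {0..t} c) * y2 0)" for t
  define F2 where "F2 t = y2 t - y2 0 + z * (of_real (integral {0..t} a) * y1 0 + of_real (integral {0..t} b) * y2 0)" for t
  have "cmod (F1 x - F1 0) \<le> cmod z * (2 * N) * (x - 0)"
  proof (rule norm_increment_le_abs_continuous[OF x])
    show "0 \<le> cmod z * (2 * N)" using N by simp
    show "abs_continuous_on {0..x} F1" unfolding F1_def by (intro ac_intros primitive_ac solution_ac[OF sol] order_refl)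
    show "AE t\<in>{0..x} in lebesgue. \<exists>d. (F1 has_vector_derivative d) (at t within {0..x}) \<and> cmod d \<le> cmod z * (2 * N)"
      using ae[of x] primitive_AE[OF x]
    proof eventually_elim
      case (elim t)
      show ?case
      proof (intro impI exI conjI)
        assume t: "t \<in> {0..x}"
        have V: "(y1 has_vector_derivative z * (of_real (b t) * y1 t + of_real (c t) * y2 t)) (at t within {0..x})"
          "((\<lambda>t. integral {0..t} b) has_vector_derivative b t) (at t within {0..x})"
          "((\<lambda>t. integral {0..t} c) has_vector_derivative c t) (at t within {0..x})" using elim t by blast+
        show "(F1 has_vector_derivative z * (of_real (b t) * (y1 t - y1 0) + of_real (c t) * (y2 t - y2 0))) (at t within {0..x})"
          unfolding F1_def by (rule has_vector_derivative_eq_rhs, (rule vd_intros V)+) (simp add: algebra_simps)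
        show "cmod (z * (of_real (b t) * (y1 t - y1 0) + of_real (c t) * (y2 t - y2 0))) \<le> cmod z * (2 * N)"
          using elim t by (intro kN) auto
      qed
    qed
  qed
  then show "cmod (y1 x - y1 0 - z * (of_real (integral {0..x} b) * y1 0 + of_real (integral {0..x} c) * y2 0)) \<le> 4 * (cmod z * x)\<^sup>2 * M"
    unfolding fin by (simp add: F1_def)
  have "cmod (F2 x - F2 0) \<le> cmod z * (2 * N) * (x - 0)"
  proof (rule norm_increment_le_abs_continuous[OF x])
    show "0 \<le> cmod z * (2 * N)" using N by simp
    show "abs_continuous_on {0..x} F2" unfolding F2_def by (intro ac_intros primitive_ac solution_ac[OF sol] order_refl)
    show "AE t\<in>{0..x} in lebesgue. \<exists>d. (F2 has_vector_derivative d) (at t within {0..x}) \<and> cmod d \<le> cmod z * (2 * N)"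
      using ae[of x] primitive_AE[OF x]
    proof eventually_elim
      case (elim t)
      show ?case
      proof (intro impI exI conjI)
        assume t: "t \<in> {0..x}"
        have V: "(y2 has_vector_derivative - z * (of_real (a t) * y1 t + of_real (b t) * y2 t)) (at t within {0..x})"
          "((\<lambda>t. integral {0..t} a) has_vector_derivative a t) (at t within {0..x})"
          "((\<lambda>t. integral {0..t} b) has_vector_derivative b t) (at t within {0..x})" using elim t by blast+
        show "(F2 has_vector_derivative - (z * (of_real (a t) * (y1 t - y1 0) + of_real (b t) * (y2 t - y2 0)))) (at t within {0..x})"
          unfolding F2_def by (rule has_vector_derivative_eq_rhs, (rule vd_intros V)+) (simp add: algebra_simps)
        show "cmod (- (z * (of_real (a t) * (y1 t - y1 0) + of_real (b t) * (y2 t - y2 0)))) \<le> cmod z * (2 * N)"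
          unfolding norm_minus_cancel using elim t by (intro kN) auto
      qed
    qed
  qed
  then show "cmod (y2 x - y2 0 + z * (of_real (integral {0..x} a) * y1 0 + of_real (integral {0..x} b) * y2 0)) \<le> 4 * (cmod z * x)\<^sup>2 * M"
    unfolding fin by (simp add: F2_def)
qed

end

section \<open>Holomorphic dependence of solutions on the parameter\<close>

context weyl_system
begin

text \<open>For equal parameters the factor z - w in the increment vanishes, so the Wronskian keeps
  its initial value.\<close>

lemma fundamental_det:
  assumes "0 \<le> x"
  shows "\<theta>1 z x * \<phi>2 z x - \<theta>2 z x * \<phi>1 z x = 1"
proof -
  define M where "M = exp (cmod z * x)"
  have "cmod (wronskian (\<theta>1 z) (\<theta>2 z) (\<phi>1 z) (\<phi>2 z) x - wronskian (\<theta>1 z) (\<theta>2 z) (\<phi>1 z) (\<phi>2 z) 0)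
     \<le> cmod (z - z) * (4 * M * M) * x"
    using solution_bound[OF solution_theta _ order_refl, of _ x z] solution_bound[OF solution_phi _ order_refl, of _ x z]
    by (intro wronskian_increment_single[OF solution_theta solution_phi assms]) (auto simp: M_def init)
  then show ?thesis by (simp add: wronskian_def init algebra_simps)
qed

text \<open>Cramer's rule in the columns at parameter w, whose determinant is 1. It carries
  information on Wronskians back to the components.\<close>

lemma reconstruct:
  assumes "0 \<le> x"
  shows "y1 x = \<theta>1 w x * wronskian (\<phi>1 w) (\<phi>2 w) y1 y2 x - \<phi>1 w x * wronskian (\<theta>1 w) (\<theta>2 w) y1 y2 x"
    and "y2 x = \<theta>2 w x * wronskian (\<phi>1 w) (\<phi>2 w) y1 y2 x - \<phi>2 w x * wronskian (\<theta>1 w) (\<theta>2 w) y1 y2 x"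
proof -
  have "(\<theta>1 w x * \<phi>2 w x - \<theta>2 w x * \<phi>1 w x) * y = y" for y using fundamental_det[OF assms] by simp
  from this[of "y1 x"] this[of "y2 x"]
  show "y1 x = \<theta>1 w x * wronskian (\<phi>1 w) (\<phi>2 w) y1 y2 x - \<phi>1 w x * wronskian (\<theta>1 w) (\<theta>2 w) y1 y2 x"
    "y2 x = \<theta>2 w x * wronskian (\<phi>1 w) (\<phi>2 w) y1 y2 x - \<phi>2 w x * wronskian (\<theta>1 w) (\<theta>2 w) y1 y2 x"
    by (simp_all add: wronskian_def algebra_simps)
qed

text \<open>For a solution u at w the Wronskian with Y_z has derivative (z - w) times u^T H Y_z in
  x. Dividing by z - w leaves a quantity that is Lipschitz in z because Y_z is, so the difference
  quotients of the Wronskians have limits at w, and \<open>reconstruct\<close> passes these on to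
  \<open>Y1\<close> and \<open>Y2\<close>.\<close>

lemma solution_family_holomorphic:
  assumes Y: "\<And>z. solution z (Y1 z) (Y2 z)" and Y0: "\<And>z. Y1 z 0 = k1" "\<And>z. Y2 z 0 = k2" and x: "0 \<le> x"
  shows "(\<lambda>z. Y1 z x) holomorphic_on UNIV" "(\<lambda>z. Y2 z x) holomorphic_on UNIV"
proof -
  have "(\<exists>D. ((\<lambda>z. Y1 z x) has_field_derivative D) (at w)) \<and> (\<exists>D. ((\<lambda>z. Y2 z x) has_field_derivative D) (at w))" for w
  proof -
    define R where "R = cmod w + 1"
    define M where "M = exp (R * x)"
    define MY where "MY = exp (R * x) * (cmod k1 + cmod k2)"
    have M: "0 \<le> M" "0 \<le> MY" by (auto simp: M_def MY_def)
    have bT: "cmod (\<theta>1 z t) \<le> M" "cmod (\<theta>2 z t) \<le> M" "cmod (\<phi>1 z t) \<le> M" "cmod (\<phi>2 z t) \<le> M"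
      if "t \<in> {0..x}" "cmod z \<le> R" for z t
      using solution_bound[OF solution_theta that] solution_bound[OF solution_phi that] by (auto simp: M_def init)
    have bY: "cmod (Y1 z t) \<le> MY" "cmod (Y2 z t) \<le> MY" if "t \<in> {0..x}" "cmod z \<le> R" for z t
      using solution_bound[OF Y that] by (auto simp: MY_def Y0)
    have const: "wronskian u1 u2 (Y1 z) (Y2 z) t = wronskian u1 u2 (Y1 z) (Y2 z) 0"
      if "solution z u1 u2" "\<And>t. t \<in> {0..x} \<Longrightarrow> cmod (u1 t) \<le> M" "\<And>t. t \<in> {0..x} \<Longrightarrow> cmod (u2 t) \<le> M" "t \<in> {0..x}" "cmod z \<le> R"
      for z u1 u2 t
    proof -
      have "cmod (wronskian u1 u2 (Y1 z) (Y2 z) t - wronskian u1 u2 (Y1 z) (Y2 z) 0) \<le> cmod (z - z) * (4 * M * MY) * t"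
        by (rule wronskian_increment_single[OF that(1) Y]) (use that bY M in auto)
      then show ?thesis by simp
    qed
    have same: "wronskian u1 u2 (Y1 z) (Y2 z) 0 = wronskian u1 u2 (Y1 z') (Y2 z') 0" for u1 u2 z z'
      by (simp add: wronskian_def Y0)
    \<comment> \<open>A factor \<open>M\<close> and a Wronskian increment for each of the two terms
      in \<open>reconstruct\<close>. The Lipschitz bound below takes z' as the base parameter of the
      Wronskians.\<close>
    define C where "C = 2 * M * (4 * M * MY * x)"
    have Lip: "cmod (Y1 z t - Y1 z' t) \<le> C * cmod (z - z')" "cmod (Y2 z t - Y2 z' t) \<le> C * cmod (z - z')"
      if z: "cmod z \<le> R" "cmod z' \<le> R" and t: "t \<in> {0..x}" for z z' t
    proof -
      have dW: "cmod (wronskian u1 u2 (Y1 z) (Y2 z) t - wronskian u1 u2 (Y1 z') (Y2 z') t) \<le> 4 * M * MY * x * cmod (z - z')"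
        if u: "solution z' u1 u2" "\<And>t. t \<in> {0..x} \<Longrightarrow> cmod (u1 t) \<le> M" "\<And>t. t \<in> {0..x} \<Longrightarrow> cmod (u2 t) \<le> M" for u1 u2
      proof -
        have "cmod (wronskian u1 u2 (Y1 z) (Y2 z) t - wronskian u1 u2 (Y1 z) (Y2 z) 0) \<le> cmod (z - z') * (4 * M * MY) * t"
          by (rule wronskian_increment_single[OF u(1) Y]) (use t u bY z M in auto)
        also have "\<dots> \<le> cmod (z - z') * (4 * M * MY) * x" using t M by (intro mult_left_mono) auto
        finally have "cmod (wronskian u1 u2 (Y1 z) (Y2 z) t - wronskian u1 u2 (Y1 z) (Y2 z) 0) \<le> 4 * M * MY * x * cmod (z - z')"
          by (simp add: mult_ac)
        then show ?thesis using const[OF u t z(2)] same[of u1 u2 z z'] by simp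
      qed
      have \<theta>: "cmod (wronskian (\<theta>1 z') (\<theta>2 z') (Y1 z) (Y2 z) t - wronskian (\<theta>1 z') (\<theta>2 z') (Y1 z') (Y2 z') t) \<le> 4 * M * MY * x * cmod (z - z')"
        by (rule dW[OF solution_theta]) (use bT z in auto)
      have \<phi>: "cmod (wronskian (\<phi>1 z') (\<phi>2 z') (Y1 z) (Y2 z) t - wronskian (\<phi>1 z') (\<phi>2 z') (Y1 z') (Y2 z') t) \<le> 4 * M * MY * x * cmod (z - z')"
        by (rule dW[OF solution_phi]) (use bT z in auto)
      have t0: "0 \<le> t" using t by simp
      have fin: "cmod (p * d - q * e) \<le> C * cmod (z - z')"
        if "cmod p \<le> M" "cmod q \<le> M" "cmod d \<le> 4 * M * MY * x * cmod (z - z')" "cmod e \<le> 4 * M * MY * x * cmod (z - z')" for p q d e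
      proof -
        have "cmod (p * d - q * e) \<le> cmod p * cmod d + cmod q * cmod e"
          by (rule order_trans[OF norm_triangle_ineq4]) (simp add: norm_mult)
        also have "\<dots> \<le> M * (4 * M * MY * x * cmod (z - z')) + M * (4 * M * MY * x * cmod (z - z'))"
          using that M(1) by (intro add_mono mult_mono) auto
        finally show ?thesis by (simp add: C_def algebra_simps)
      qed
      have "Y1 z t - Y1 z' t = \<theta>1 z' t * (wronskian (\<phi>1 z') (\<phi>2 z') (Y1 z) (Y2 z) t - wronskian (\<phi>1 z') (\<phi>2 z') (Y1 z') (Y2 z') t)
          - \<phi>1 z' t * (wronskian (\<theta>1 z') (\<theta>2 z') (Y1 z) (Y2 z) t - wronskian (\<theta>1 z') (\<theta>2 z') (Y1 z') (Y2 z') t)"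
        using reconstruct(1)[OF t0, of "Y1 z" z' "Y2 z"] reconstruct(1)[OF t0, of "Y1 z'" z' "Y2 z'"] by (simp add: right_diff_distrib)
      then show "cmod (Y1 z t - Y1 z' t) \<le> C * cmod (z - z')"
        using fin[OF bT(1)[OF t z(2)] bT(3)[OF t z(2)] \<phi> \<theta>] by simp
      have "Y2 z t - Y2 z' t = \<theta>2 z' t * (wronskian (\<phi>1 z') (\<phi>2 z') (Y1 z) (Y2 z) t - wronskian (\<phi>1 z') (\<phi>2 z') (Y1 z') (Y2 z') t)
          - \<phi>2 z' t * (wronskian (\<theta>1 z') (\<theta>2 z') (Y1 z) (Y2 z) t - wronskian (\<theta>1 z') (\<theta>2 z') (Y1 z') (Y2 z') t)"
        using reconstruct(2)[OF t0, of "Y2 z" z' "Y1 z"] reconstruct(2)[OF t0, of "Y2 z'" z' "Y1 z'"] by (simp add: right_diff_distrib)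
      then show "cmod (Y2 z t - Y2 z' t) \<le> C * cmod (z - z')"
        using fin[OF bT(2)[OF t z(2)] bT(4)[OF t z(2)] \<phi> \<theta>] by simp
    qed
    have C: "0 \<le> C" using M x by (simp add: C_def)
    have xx: "x \<in> {0..x}" using x by simp
    have wR: "cmod w \<le> R" by (simp add: R_def)
    define Q where "Q u1 u2 z = (wronskian u1 u2 (Y1 z) (Y2 z) x - wronskian u1 u2 (Y1 w) (Y2 w) x) / (z - w)" for u1 u2 z
    have lim: "\<exists>L. ((\<lambda>z. Q u1 u2 z) \<longlongrightarrow> L) (at w)"
      if u: "solution w u1 u2" "\<And>t. t \<in> {0..x} \<Longrightarrow> cmod (u1 t) \<le> M" "\<And>t. t \<in> {0..x} \<Longrightarrow> cmod (u2 t) \<le> M" for u1 u2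
    proof -
      have "cmod (Q u1 u2 z - Q u1 u2 z') \<le> (4 * M * C * x) * cmod (z - z')"
        if "z \<in> cball w 1 - {w}" "z' \<in> cball w 1 - {w}" for z z'
      proof -
        have zR: "cmod z \<le> R" "cmod z' \<le> R" and ne: "z \<noteq> w" "z' \<noteq> w"
          using that norm_triangle_ineq[of "z - w" w] norm_triangle_ineq[of "z' - w" w]
          by (auto simp: R_def dist_norm norm_minus_commute)
        \<comment> \<open>The weights 1/(z - w) and 1/(z' - w) normalize the increments to k = 1, so
          they differ only through Y_z - Y_z'.\<close>
        have "cmod ((inverse (z - w) * wronskian u1 u2 (Y1 z) (Y2 z) x - inverse (z' - w) * wronskian u1 u2 (Y1 z') (Y2 z') x)
           - (inverse (z - w) * wronskian u1 u2 (Y1 z) (Y2 z) 0 - inverse (z' - w) * wronskian u1 u2 (Y1 z') (Y2 z') 0))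
           \<le> cmod 1 * (4 * M * (C * cmod (z - z'))) * x"
          by (rule wronskian_increment[OF u(1) Y Y x]) (use u Lip zR ne M C in auto)
        moreover have "wronskian u1 u2 (Y1 z) (Y2 z) 0 = wronskian u1 u2 (Y1 w) (Y2 w) x"
            "wronskian u1 u2 (Y1 z') (Y2 z') 0 = wronskian u1 u2 (Y1 w) (Y2 w) x"
          using const[OF u xx wR] same by metis+
        ultimately show ?thesis by (simp add: Q_def divide_inverse algebra_simps)
      qed
      then obtain L where "((\<lambda>z. Q u1 u2 z) \<longlongrightarrow> L) (at w)" by (rule punctured_Lipschitz_has_limit)
      then show ?thesis by blast
    qed
    obtain L1 where L1: "((\<lambda>z. Q (\<theta>1 w) (\<theta>2 w) z) \<longlongrightarrow> L1) (at w)"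
      using lim[OF solution_theta bT(1)[OF _ wR] bT(2)[OF _ wR]] by blast
    obtain L2 where L2: "((\<lambda>z. Q (\<phi>1 w) (\<phi>2 w) z) \<longlongrightarrow> L2) (at w)"
      using lim[OF solution_phi bT(3)[OF _ wR] bT(4)[OF _ wR]] by blast
    have e1: "(Y1 z x - Y1 w x) / (z - w) = \<theta>1 w x * Q (\<phi>1 w) (\<phi>2 w) z - \<phi>1 w x * Q (\<theta>1 w) (\<theta>2 w) z" for z
      unfolding Q_def using reconstruct(1)[OF x, of "Y1 z" w "Y2 z"] reconstruct(1)[OF x, of "Y1 w" w "Y2 w"]
      by (simp add: right_diff_distrib flip: diff_divide_distrib)
    have e2: "(Y2 z x - Y2 w x) / (z - w) = \<theta>2 w x * Q (\<phi>1 w) (\<phi>2 w) z - \<phi>2 w x * Q (\<theta>1 w) (\<theta>2 w) z" for z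
      unfolding Q_def using reconstruct(2)[OF x, of "Y2 z" w "Y1 z"] reconstruct(2)[OF x, of "Y2 w" w "Y1 w"]
      by (simp add: right_diff_distrib flip: diff_divide_distrib)
    show ?thesis unfolding has_field_derivative_iff e1 e2
      using tendsto_diff[OF tendsto_mult[OF tendsto_const L2] tendsto_mult[OF tendsto_const L1]] by blast
  qed
  then show "(\<lambda>z. Y1 z x) holomorphic_on UNIV" "(\<lambda>z. Y2 z x) holomorphic_on UNIV"
    unfolding holomorphic_on_def field_differentiable_def by auto
qed

end

section \<open>Convergence of the m-function implies convergence of the means\<close>

text \<open>The points s/x(n) stay on one ray, which is the closed sector with both angles equal to
  Arg s.\<close>

lemma tendsto_along_ray:
  assumes m: "tendsto_in_sectors m \<zeta>" and s: "0 < Im s" and x: "\<And>n. 0 < x n" "x \<longlonglongrightarrow> 0"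
  shows "(\<lambda>n. m (s / of_real (x n))) \<longlonglongrightarrow> \<zeta>"
proof -
  have Arg: "0 < Arg s" "Arg s < pi" using s Arg_lt_pi by auto
  have lim: "(m \<longlongrightarrow> \<zeta>) (inf at_infinity (principal (closed_sector (Arg s) (Arg s))))"
    using m Arg unfolding tendsto_in_sectors_def by blast
  have s0: "s \<noteq> 0" using s by auto
  have mem: "s / of_real (x n) \<in> closed_sector (Arg s) (Arg s)" for n
  proof -
    have "Arg (of_real (inverse (x n)) * s) = Arg s" using x(1)[of n] by (intro Arg_times_of_real) simp
    then have "Arg (s / of_real (x n)) = Arg s" by (simp add: divide_inverse mult.commute)
    then show ?thesis using s0 x(1)[of n] by (simp add: closed_sector_def)
  qed
  have "filterlim x (at_right 0) sequentially"
  proof -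
    have "\<forall>n. x n \<in> {0<..} \<and> x n \<noteq> 0" using x(1) by (metis greaterThan_iff less_irrefl)
    then show ?thesis using x(2) by (simp add: filterlim_at always_eventually)
  qed
  then have "filterlim (\<lambda>n. inverse (x n)) at_top sequentially"
    by (rule filterlim_compose[OF filterlim_inverse_at_top_right])
  then have "filterlim (\<lambda>n. cmod s * inverse (x n)) at_top sequentially"
    using s0 by (intro filterlim_tendsto_pos_mult_at_top[OF tendsto_const]) auto
  moreover have "(\<lambda>n. cmod s * inverse (x n)) = (\<lambda>n. norm (s / of_real (x n)))"
  proof
    fix n show "cmod s * inverse (x n) = norm (s / of_real (x n))"
      unfolding norm_divide using x(1)[of n] by (simp add: divide_inverse)
  qed
  ultimately have "filterlim (\<lambda>n. s / of_real (x n)) at_infinity sequentially"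
    by (simp add: filterlim_at_infinity_conv_norm_at_top)
  then have "filterlim (\<lambda>n. s / of_real (x n)) (inf at_infinity (principal (closed_sector (Arg s) (Arg s)))) sequentially"
    using mem by (simp add: filterlim_inf filterlim_principal)
  then show ?thesis by (rule filterlim_compose[OF lim])
qed

text \<open>The bound is uniform in n on compact sets, as Montel requires; its exponential form is
  the one that \<open>solution_bound\<close> takes after rescaling.\<close>

lemma normal_entire_sequence:
  fixes F :: "nat \<Rightarrow> complex \<Rightarrow> complex"
  assumes hol: "\<And>n. F n holomorphic_on UNIV" and bd: "\<And>n s. cmod (F n s) \<le> C * exp (cmod s)"
  obtains f r where "f holomorphic_on UNIV" "strict_mono (r :: nat \<Rightarrow> nat)" "\<And>s. (\<lambda>n. F (r n) s) \<longlonglongrightarrow> f s"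
proof -
  have C: "0 \<le> C" using order_trans[OF norm_ge_zero bd[of 0 0]] by simp
  show ?thesis
  proof (rule Montel[of UNIV "range F" F])
    show "\<exists>B. \<forall>h\<in>range F. \<forall>z\<in>K. norm (h z) \<le> B" if K: "compact K" for K
    proof -
      obtain R where R: "\<And>z. z \<in> K \<Longrightarrow> cmod z \<le> R" using compact_imp_bounded[OF K] unfolding bounded_iff by blast
      have "cmod (F n z) \<le> C * exp R" if "z \<in> K" for n z
        using bd[of n z] mult_left_mono[of "exp (cmod z)" "exp R" C] R[OF that] C by simp
      then show ?thesis by blast
    qed
  qed (use hol that in auto)
qed

text \<open>The Cayley transform in a form without quotients: it makes sense at zeros of u or u - iv
  and passes to limits.\<close>

lemma flux_iff_norm_le: "0 \<le> Im (cnj u * v) \<longleftrightarrow> cmod (u + \<i> * v) \<le> cmod (u - \<i> * v)"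
proof -
  have "(cmod (u - \<i> * v))\<^sup>2 - (cmod (u + \<i> * v))\<^sup>2 = 4 * Im (cnj u * v)"
    unfolding cmod_power2 by (simp add: power2_eq_square algebra_simps)
  moreover have "cmod (u + \<i> * v) \<le> cmod (u - \<i> * v) \<longleftrightarrow> (cmod (u + \<i> * v))\<^sup>2 \<le> (cmod (u - \<i> * v))\<^sup>2"
    by (simp add: abs_le_square_iff[symmetric])
  ultimately show ?thesis by linarith
qed

text \<open>For nonreal \<zeta> the imaginary part of the equation gives b + c Re \<zeta> = 0. For
  real \<zeta> that part is empty, but then \<zeta> is a zero of a nonnegative quadratic in s, hence
  a critical point, which gives the same relation. The real part and the trace do the rest.\<close>

lemma quadratic_root_determines_form:
  fixes a b c :: real and \<zeta> :: complex
  assumes root: "of_real a + 2 * of_real b * \<zeta> + of_real c * \<zeta>\<^sup>2 = 0" and tr: "a + c = 1"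
    and psd: "\<And>s. 0 \<le> a + 2 * s * b + s\<^sup>2 * c"
  shows "a = (cmod \<zeta>)\<^sup>2 / ((cmod \<zeta>)\<^sup>2 + 1)" "b = - Re \<zeta> / ((cmod \<zeta>)\<^sup>2 + 1)" "c = 1 / ((cmod \<zeta>)\<^sup>2 + 1)"
proof -
  define p where "p = Re \<zeta>"
  define r where "r = Im \<zeta>"
  have re: "a + 2 * b * p + c * (p\<^sup>2 - r\<^sup>2) = 0" and im: "r * (b + c * p) = 0"
    using arg_cong[OF root, of Re] arg_cong[OF root, of Im] by (simp_all add: p_def r_def power2_eq_square algebra_simps)
  have bc: "b + c * p = 0"
  proof (cases "r = 0")
    case True
    \<comment> \<open>Half the slope at p. A step of length k against it changes the form by (c -
      2)k^2, which is negative unless k = 0, since c <= 1.\<close>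
    define k where "k = b + c * p"
    have "a \<ge> 0" using psd[of 0] by simp
    then have c1: "c \<le> 1" using tr by simp
    have "a + 2 * (p - k) * b + (p - k)\<^sup>2 * c = (a + 2 * b * p + c * p\<^sup>2) + (c - 2) * k\<^sup>2"
      by (simp add: k_def power2_eq_square algebra_simps)
    then have "0 \<le> (c - 2) * k\<^sup>2" using psd[of "p - k"] re True by simp
    then have "k\<^sup>2 \<le> 0" using c1 by (simp add: zero_le_mult_iff)
    then show ?thesis by (simp add: k_def)
  qed (use im in simp)
  have n: "(cmod \<zeta>)\<^sup>2 = p\<^sup>2 + r\<^sup>2" by (simp add: cmod_power2 p_def r_def)
  have b: "b = - (c * p)" using bc by simp
  have a: "a = c * (cmod \<zeta>)\<^sup>2" using re unfolding n b by (simp add: power2_eq_square algebra_simps)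
  have pos: "(cmod \<zeta>)\<^sup>2 + 1 > 0" by (simp add: add_nonneg_pos)
  have "c * ((cmod \<zeta>)\<^sup>2 + 1) = 1" using tr a by (simp add: algebra_simps)
  then show c: "c = 1 / ((cmod \<zeta>)\<^sup>2 + 1)" using pos by (simp add: eq_divide_eq)
  show "a = (cmod \<zeta>)\<^sup>2 / ((cmod \<zeta>)\<^sup>2 + 1)" using a c by simp
  show "b = - Re \<zeta> / ((cmod \<zeta>)\<^sup>2 + 1)" using b c by (simp add: p_def)
qed

context weyl_system
begin

text \<open>
  In the limit of the rescaled systems, the solution \<open>(y1, y2)\<close> starting at \<open>(1, \<zeta>)\<close> has nonnegative flux
  for every parameter: in the upper half plane because \<open>\<zeta>\<close> is the limit of the Weyl coefficients, in the
  closed lower half plane by monotonicity. Hence \<open>(y1 + \<i> y2) / (y1 - \<i> y2)\<close> is entire and bounded by 1, so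
  constant by Liouville, and the first-order term of \<open>y2 - \<zeta> y1\<close> vanishes.
\<close>

lemma limit_form_root:
  assumes \<zeta>: "0 \<le> Im \<zeta>" "tendsto_in_sectors m \<zeta>" and x: "\<And>n. 0 < x n" "x \<longlonglongrightarrow> 0"
    and lim: "(\<lambda>n. integral {0..x n} a / x n) \<longlonglongrightarrow> a1"
      "(\<lambda>n. integral {0..x n} b / x n) \<longlonglongrightarrow> b1" "(\<lambda>n. integral {0..x n} c / x n) \<longlonglongrightarrow> c1"
  shows "of_real a1 + 2 * of_real b1 * \<zeta> + of_real c1 * \<zeta>\<^sup>2 = 0"
proof -
  define Y1 where "Y1 z t = \<theta>1 z t + \<zeta> * \<phi>1 z t" for z t
  define Y2 where "Y2 z t = \<theta>2 z t + \<zeta> * \<phi>2 z t" for z t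
  have Y: "solution z (Y1 z) (Y2 z)" for z
    using solution_linear[OF solution_theta solution_phi, of z \<zeta>] unfolding Y1_def[abs_def] Y2_def[abs_def] .
  have Y0: "Y1 z 0 = 1" "Y2 z 0 = \<zeta>" for z by (simp_all add: Y1_def Y2_def init)
  define C where "C = 1 + cmod \<zeta>"
  have C: "C > 0" by (simp add: C_def add_pos_nonneg)
  \<comment> \<open>Parameter s/x(n) read at position x(n): here |z|x = |s|, so all bounds are
    uniform in n.\<close>
  define y1 where "y1 n s = Y1 (s / of_real (x n)) (x n)" for n s
  define y2 where "y2 n s = Y2 (s / of_real (x n)) (x n)" for n s
  have xs: "cmod (s / of_real (x n)) * x n = cmod s" for s n using x(1)[of n] by (simp add: norm_divide)
  have xmem: "x n \<in> {0..x n}" and x0: "0 \<le> x n" for n using x(1)[of n] by auto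
  have ybd: "cmod (y1 n s) \<le> C * exp (cmod s)" "cmod (y2 n s) \<le> C * exp (cmod s)" for n s
    using solution_bound[OF Y xmem[of n] order_refl, of "s / of_real (x n)"] unfolding xs Y0
    by (simp_all add: y1_def y2_def C_def mult.commute)
  have scale: "(\<lambda>s. s / of_real (x n)) holomorphic_on UNIV" for n
    using x(1)[of n] by (intro holomorphic_intros) auto
  have hol: "y1 n holomorphic_on UNIV" "y2 n holomorphic_on UNIV" for n
    using holomorphic_on_compose_gen[OF scale[of n] solution_family_holomorphic(1)[OF Y Y0 x0[of n]]]
      holomorphic_on_compose_gen[OF scale[of n] solution_family_holomorphic(2)[OF Y Y0 x0[of n]]]
    by (simp_all add: o_def y1_def[abs_def] y2_def[abs_def])
  \<comment> \<open>\<open>F\<close> and \<open>G\<close> are denominator and numerator of the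
    Cayley transform. A subsequence is extracted for \<open>F\<close> and then thinned out once more
    for \<open>G\<close>.\<close>
  define F where "F n s = y1 n s - \<i> * y2 n s" for n s
  define G where "G n s = y1 n s + \<i> * y2 n s" for n s
  have FG_bd: "cmod (F n s) \<le> (2 * C) * exp (cmod s)" "cmod (G n s) \<le> (2 * C) * exp (cmod s)" for n s
    using ybd[of n s] norm_triangle_ineq4[of "y1 n s" "\<i> * y2 n s"] norm_triangle_ineq[of "y1 n s" "\<i> * y2 n s"]
    unfolding F_def G_def norm_mult norm_ii mult_1 by linarith+
  have FG_hol: "F n holomorphic_on UNIV" "G n holomorphic_on UNIV" for n
    unfolding F_def[abs_def] G_def[abs_def] by (intro holomorphic_intros hol)+
  obtain f r1 where f: "f holomorphic_on UNIV" "strict_mono (r1 :: nat \<Rightarrow> nat)" "\<And>s. (\<lambda>n. F (r1 n) s) \<longlonglongrightarrow> f s"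
    by (rule normal_entire_sequence[OF FG_hol(1) FG_bd(1)]) (rule that)
  obtain g r2 where g: "g holomorphic_on UNIV" "strict_mono (r2 :: nat \<Rightarrow> nat)" "\<And>s. (\<lambda>n. G (r1 (r2 n)) s) \<longlonglongrightarrow> g s"
    by (rule normal_entire_sequence[of "\<lambda>n. G (r1 n)", OF FG_hol(2) FG_bd(2)]) (rule that)
  define r where "r n = r1 (r2 n)" for n
  have r: "strict_mono r" using f(2) g(2) by (simp add: r_def strict_mono_def)
  have Flim: "(\<lambda>n. F (r n) s) \<longlonglongrightarrow> f s" for s
    using LIMSEQ_subseq_LIMSEQ[OF f(3)[of s] g(2)] by (simp add: o_def r_def)
  have Glim: "(\<lambda>n. G (r n) s) \<longlonglongrightarrow> g s" for s using g(3) by (simp add: r_def)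
  have sub: "(\<lambda>n. h (r n)) \<longlonglongrightarrow> l" if "h \<longlonglongrightarrow> l" for h :: "nat \<Rightarrow> 'b::topological_space" and l
    using LIMSEQ_subseq_LIMSEQ[OF that r] by (simp add: o_def)
  have gf: "cmod (g s) \<le> cmod (f s)" for s
  proof (cases "0 < Im s")
    case True
    \<comment> \<open>Passing from \<zeta> to m changes \<open>F\<close> and \<open>G\<close> by
      \<mu> times a factor bounded in n. The limits stay the same, so the sign of the Weyl flux
      carries over to them.\<close>
    define \<mu> where "\<mu> n = m (s / of_real (x (r n))) - \<zeta>" for n
    define p1 where "p1 n = \<phi>1 (s / of_real (x (r n))) (x (r n))" for n
    define p2 where "p2 n = \<phi>2 (s / of_real (x (r n))) (x (r n))" for n
    have "(\<lambda>n. m (s / of_real (x (r n)))) \<longlonglongrightarrow> \<zeta>" using sub[OF tendsto_along_ray[OF \<zeta>(2) True x]] .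
    then have \<mu>: "(\<lambda>n. cmod (\<mu> n) * (2 * exp (cmod s))) \<longlonglongrightarrow> 0"
      unfolding \<mu>_def by (intro tendsto_mult_left_zero tendsto_norm_zero) (simp add: LIM_zero_iff)
    have pb: "cmod (p1 n) \<le> exp (cmod s)" "cmod (p2 n) \<le> exp (cmod s)" for n
      using solution_bound[OF solution_phi xmem[of "r n"] order_refl, of "s / of_real (x (r n))"] unfolding xs init
      by (simp_all add: p1_def p2_def)
    have pp: "cmod (p1 n + \<i> * p2 n) \<le> 2 * exp (cmod s)" "cmod (p1 n - \<i> * p2 n) \<le> 2 * exp (cmod s)" for n
      using pb[of n] norm_triangle_ineq4[of "p1 n" "\<i> * p2 n"] norm_triangle_ineq[of "p1 n" "\<i> * p2 n"]
      unfolding norm_mult norm_ii mult_1 by linarith+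
    have "(\<lambda>n. \<mu> n * (p1 n + \<i> * p2 n)) \<longlonglongrightarrow> 0" "(\<lambda>n. \<mu> n * (p1 n - \<i> * p2 n)) \<longlonglongrightarrow> 0"
      by (rule Lim_null_comparison[OF _ \<mu>]; simp add: norm_mult mult_left_mono pp)+
    from tendsto_add[OF Glim[of s] this(1)] tendsto_add[OF Flim[of s] this(2)]
    have 1: "(\<lambda>n. G (r n) s + \<mu> n * (p1 n + \<i> * p2 n)) \<longlonglongrightarrow> g s"
      and 2: "(\<lambda>n. F (r n) s + \<mu> n * (p1 n - \<i> * p2 n)) \<longlonglongrightarrow> f s" by simp_all
    show ?thesis
    proof (rule tendsto_le[OF sequentially_bot tendsto_norm[OF 2] tendsto_norm[OF 1]], intro always_eventually allI)
      fix n
      define z where "z = s / of_real (x (r n))"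
      have z: "0 < Im z" using True x(1)[of "r n"] by (simp add: z_def)
      have "0 \<le> Im (cnj (\<theta>1 z (x (r n)) + m z * \<phi>1 z (x (r n))) * (\<theta>2 z (x (r n)) + m z * \<phi>2 z (x (r n))))"
        by (rule weyl[OF z x0])
      then have "cmod ((\<theta>1 z (x (r n)) + m z * \<phi>1 z (x (r n))) + \<i> * (\<theta>2 z (x (r n)) + m z * \<phi>2 z (x (r n))))
         \<le> cmod ((\<theta>1 z (x (r n)) + m z * \<phi>1 z (x (r n))) - \<i> * (\<theta>2 z (x (r n)) + m z * \<phi>2 z (x (r n))))"
        unfolding flux_iff_norm_le .
      then show "cmod (G (r n) s + \<mu> n * (p1 n + \<i> * p2 n)) \<le> cmod (F (r n) s + \<mu> n * (p1 n - \<i> * p2 n))"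
        unfolding G_def F_def y1_def y2_def Y1_def Y2_def \<mu>_def p1_def p2_def z_def[symmetric]
        by (simp add: algebra_simps)
    qed
  next
    case False
    show ?thesis
    proof (rule tendsto_le[OF sequentially_bot tendsto_norm[OF Flim] tendsto_norm[OF Glim]], intro always_eventually allI)
      fix n
      define z where "z = s / of_real (x (r n))"
      have "Im z \<le> 0" using False x(1)[of "r n"] by (simp add: z_def divide_nonpos_pos)
      from flux_mono[OF Y order_refl x0[of "r n"] this]
      have "Im \<zeta> \<le> Im (cnj (Y1 z (x (r n))) * Y2 z (x (r n)))" unfolding Y0 complex_cnj_one mult_1 .
      with \<zeta>(1) have "0 \<le> Im (cnj (Y1 z (x (r n))) * Y2 z (x (r n)))" by (rule order_trans)
      then show "cmod (G (r n) s) \<le> cmod (F (r n) s)"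
        unfolding flux_iff_norm_le G_def F_def y1_def y2_def z_def .
    qed
  qed
  \<comment> \<open>By \<open>gf\<close> a zero of f would also be a zero of g, against the lower
    growth bound: |F|^2 + |G|^2 is twice |y1|^2 + |y2|^2, which stays away from 0.\<close>
  have f0: "f s \<noteq> 0" for s
  proof
    assume fs: "f s = 0"
    then have gs: "g s = 0" using gf[of s] by simp
    define k where "k = 2 * exp (- (2 * cmod s))"
    have k0: "0 \<le> k" by (simp add: k_def)
    have ke: "k * exp (2 * cmod s) = 2" by (simp add: k_def exp_minus)
    have "k \<le> (cmod (f s))\<^sup>2 + (cmod (g s))\<^sup>2"
    proof (rule tendsto_lowerbound[OF tendsto_add[OF tendsto_power[OF tendsto_norm[OF Flim]] tendsto_power[OF tendsto_norm[OF Glim]]]])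
      show "\<forall>\<^sub>F n in sequentially. k \<le> (cmod (F (r n) s))\<^sup>2 + (cmod (G (r n) s))\<^sup>2"
      proof (intro always_eventually allI)
        fix n
        have "(cmod (1::complex))\<^sup>2 + (cmod \<zeta>)\<^sup>2 \<le> exp (2 * cmod s) * ((cmod (y1 (r n) s))\<^sup>2 + (cmod (y2 (r n) s))\<^sup>2)"
          using solution_norm_growth(2)[OF Y x0, of "s / of_real (x (r n))" "r n"]
          unfolding Y0 mult.assoc xs y1_def[symmetric] y2_def[symmetric] .
        then have "1 \<le> exp (2 * cmod s) * ((cmod (y1 (r n) s))\<^sup>2 + (cmod (y2 (r n) s))\<^sup>2)"
          using zero_le_power2[of "cmod \<zeta>"] unfolding norm_one one_power2 by linarith
        from mult_left_mono[OF this k0]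
        have "k \<le> (k * exp (2 * cmod s)) * ((cmod (y1 (r n) s))\<^sup>2 + (cmod (y2 (r n) s))\<^sup>2)"
          by (simp only: mult_1_right mult.assoc)
        then have "k \<le> 2 * ((cmod (y1 (r n) s))\<^sup>2 + (cmod (y2 (r n) s))\<^sup>2)" unfolding ke .
        also have "\<dots> = (cmod (F (r n) s))\<^sup>2 + (cmod (G (r n) s))\<^sup>2"
          unfolding F_def G_def cmod_power2 by (simp add: power2_eq_square algebra_simps)
        finally show "k \<le> (cmod (F (r n) s))\<^sup>2 + (cmod (G (r n) s))\<^sup>2" .
      qed
    qed simp
    then show False by (simp add: fs gs k_def)
  qed
  have "(\<lambda>s. g s / f s) holomorphic_on UNIV" using f(1) g(1) f0 by (intro holomorphic_intros) auto
  moreover have "bounded (range (\<lambda>s. g s / f s))"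
  proof -
    have "cmod (g s / f s) \<le> 1" for s using gf[of s] f0[of s] by (simp add: norm_divide divide_le_eq_1)
    then show ?thesis unfolding bounded_iff by blast
  qed
  ultimately have "(\<lambda>s. g s / f s) constant_on UNIV" by (rule Liouville_theorem)
  then obtain \<kappa> where quot: "\<And>s. g s / f s = \<kappa>" unfolding constant_on_def by (metis UNIV_I)
  have \<kappa>: "g s = \<kappa> * f s" for s
  proof -
    have "g s = (g s / f s) * f s" using f0[of s] by simp
    then show ?thesis unfolding quot .
  qed
  have at0: "y1 n 0 = 1" "y2 n 0 = \<zeta>" for n
    using solution_expansion[OF Y x0, of 0 n] by (simp_all add: y1_def y2_def Y0)
  have FG0: "(\<lambda>n. F (r n) 0) \<longlonglongrightarrow> 1 - \<i> * \<zeta>" "(\<lambda>n. G (r n) 0) \<longlonglongrightarrow> 1 + \<i> * \<zeta>"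
    by (simp_all add: F_def G_def at0)
  have fg0: "f 0 = 1 - \<i> * \<zeta>" "g 0 = 1 + \<i> * \<zeta>"
    by (rule LIMSEQ_unique[OF Flim[of 0] FG0(1)], rule LIMSEQ_unique[OF Glim[of 0] FG0(2)])
  have "1 + \<i> * \<zeta> = \<kappa> * (1 - \<i> * \<zeta>)" using \<kappa>[of 0] unfolding fg0 .
  then have rel: "(1 - \<i> * \<zeta>) * g s = (1 + \<i> * \<zeta>) * f s" for s
    using \<kappa>[of s] by (simp only: mult_ac)
  have Dlim: "(\<lambda>n. y2 (r n) s - \<zeta> * y1 (r n) s) \<longlonglongrightarrow> 0" for s
  proof -
    \<comment> \<open>The combination of \<open>F\<close> and \<open>G\<close> that recovers y2 -
      \<zeta> y1; \<open>rel\<close> makes it vanish in the limit.\<close>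
    have l: "(\<lambda>n. (\<i> / 2) * ((1 + \<i> * \<zeta>) * F (r n) s - (1 - \<i> * \<zeta>) * G (r n) s)) \<longlonglongrightarrow> (\<i> / 2) * ((1 + \<i> * \<zeta>) * f s - (1 - \<i> * \<zeta>) * g s)"
      by (intro tendsto_intros Flim Glim)
    have eq: "(\<i> / 2) * ((1 + \<i> * \<zeta>) * F n s - (1 - \<i> * \<zeta>) * G n s) = y2 n s - \<zeta> * y1 n s" for n
      by (simp add: F_def G_def algebra_simps)
    show ?thesis using l unfolding eq rel diff_self mult_zero_right .
  qed
  define E where "E = of_real a1 + 2 * of_real b1 * \<zeta> + of_real c1 * \<zeta>\<^sup>2"
  define A where "A n = complex_of_real (integral {0..x n} a / x n)" for n
  define B where "B n = complex_of_real (integral {0..x n} b / x n)" for n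
  define D where "D n = complex_of_real (integral {0..x n} c / x n)" for n
  have Elim: "(\<lambda>n. A (r n) + 2 * B (r n) * \<zeta> + D (r n) * \<zeta>\<^sup>2) \<longlonglongrightarrow> E"
    unfolding E_def A_def B_def D_def by (intro tendsto_intros sub lim)
  \<comment> \<open>The expansion reads y2 - \<zeta> y1 = -sE + O(|s|^2) in the limit of large n. As
    the left side tends to 0 for each fixed s, the term sE is itself of second order, and letting s
    tend to 0 afterwards forces E = 0.\<close>
  have bound: "cmod (s * E) \<le> 4 * (cmod s)\<^sup>2 * (exp (cmod s) * C) * C" for s
  proof -
    have "(\<lambda>n. (y2 (r n) s - \<zeta> * y1 (r n) s) + s * (A (r n) + 2 * B (r n) * \<zeta> + D (r n) * \<zeta>\<^sup>2)) \<longlonglongrightarrow> 0 + s * E"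
      by (intro tendsto_intros Dlim Elim)
    then have l: "(\<lambda>n. (y2 (r n) s - \<zeta> * y1 (r n) s) + s * (A (r n) + 2 * B (r n) * \<zeta> + D (r n) * \<zeta>\<^sup>2)) \<longlonglongrightarrow> s * E" by simp
    show ?thesis
    proof (rule tendsto_upperbound[OF tendsto_norm[OF l]])
      show "\<forall>\<^sub>F n in sequentially. cmod (y2 (r n) s - \<zeta> * y1 (r n) s + s * (A (r n) + 2 * B (r n) * \<zeta> + D (r n) * \<zeta>\<^sup>2)) \<le> 4 * (cmod s)\<^sup>2 * (exp (cmod s) * C) * C"
      proof (intro always_eventually allI)
        fix n
        define k where "k = r n"
        define K where "K = 4 * (cmod s)\<^sup>2 * (exp (cmod s) * C)"
        define e1 where "e1 = y1 k s - 1 - s * (B k + D k * \<zeta>)"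
        define e2 where "e2 = y2 k s - \<zeta> + s * (A k + B k * \<zeta>)"
        have "e1 = y1 k s - 1 - (s / of_real (x k)) * (of_real (integral {0..x k} b) * 1 + of_real (integral {0..x k} c) * \<zeta>)"
          using x(1)[of k] by (simp add: e1_def B_def D_def algebra_simps add_divide_distrib)
        then have 1: "cmod e1 \<le> K"
          using solution_expansion(1)[OF Y x0, of "s / of_real (x k)" k] unfolding xs Y0 y1_def[symmetric] y2_def[symmetric]
          by (simp add: K_def C_def)
        have "e2 = y2 k s - \<zeta> + (s / of_real (x k)) * (of_real (integral {0..x k} a) * 1 + of_real (integral {0..x k} b) * \<zeta>)"
          using x(1)[of k] by (simp add: e2_def A_def B_def algebra_simps add_divide_distrib)
        then have 2: "cmod e2 \<le> K"
          using solution_expansion(2)[OF Y x0, of "s / of_real (x k)" k] unfolding xs Y0 y1_def[symmetric] y2_def[symmetric]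
          by (simp add: K_def C_def)
        have "y2 k s - \<zeta> * y1 k s + s * (A k + 2 * B k * \<zeta> + D k * \<zeta>\<^sup>2) = e2 - \<zeta> * e1"
          by (simp add: e1_def e2_def power2_eq_square algebra_simps)
        also have "cmod (e2 - \<zeta> * e1) \<le> cmod e2 + cmod \<zeta> * cmod e1"
          by (rule order_trans[OF norm_triangle_ineq4]) (simp add: norm_mult)
        also have "\<dots> \<le> K + cmod \<zeta> * K" using 1 2 by (intro add_mono mult_left_mono) auto
        also have "\<dots> = K * C" by (simp add: C_def algebra_simps)
        finally show "cmod (y2 (r n) s - \<zeta> * y1 (r n) s + s * (A (r n) + 2 * B (r n) * \<zeta> + D (r n) * \<zeta>\<^sup>2)) \<le> 4 * (cmod s)\<^sup>2 * (exp (cmod s) * C) * C"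
          unfolding k_def K_def .
      qed
    qed simp
  qed
  have "E = 0"
  proof (rule ccontr)
    assume "E \<noteq> 0"
    then have E: "cmod E > 0" by simp
    define K where "K = 4 * (exp 1 * C) * C"
    have K: "K > 0" using C by (simp add: K_def)
    \<comment> \<open>Small enough for Kt <= |E|/2; the cap 1 replaces exp t by exp 1.\<close>
    define t where "t = min 1 (cmod E / (2 * K))"
    have t: "0 < t" "t \<le> 1" "t \<le> cmod E / (2 * K)" using E K by (auto simp: t_def)
    have "t * cmod E \<le> 4 * t\<^sup>2 * (exp t * C) * C" using bound[of "of_real t"] t(1) by (simp add: norm_mult)
    also have "\<dots> \<le> 4 * t\<^sup>2 * (exp 1 * C) * C" using t(2) C by (intro mult_left_mono mult_right_mono) auto
    also have "\<dots> = t * (K * t)" by (simp add: K_def power2_eq_square)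
    finally have "cmod E \<le> K * t" using t(1) by simp
    also have "\<dots> \<le> K * (cmod E / (2 * K))" using t(3) K by (intro mult_left_mono) auto
    also have "\<dots> = cmod E / 2" using K by simp
    finally show False using E by simp
  qed
  then show ?thesis by (simp add: E_def)
qed

text \<open>Compactness and uniqueness: the means stay in a cube, and for a limit along any
  subsequence \<open>limit_form_root\<close>, trace and positivity leave a single value. A sequence
  of means staying away from this value cannot exist.\<close>

theorem means_converge_if_tendsto_in_sectors:
  assumes \<zeta>: "0 \<le> Im \<zeta>" "tendsto_in_sectors m \<zeta>"
  shows "((\<lambda>x. integral {0..x} a / x) \<longlongrightarrow> (cmod \<zeta>)\<^sup>2 / ((cmod \<zeta>)\<^sup>2 + 1)) (at_right 0)"
    and "((\<lambda>x. integral {0..x} b / x) \<longlongrightarrow> - Re \<zeta> / ((cmod \<zeta>)\<^sup>2 + 1)) (at_right 0)"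
    and "((\<lambda>x. integral {0..x} c / x) \<longlongrightarrow> 1 / ((cmod \<zeta>)\<^sup>2 + 1)) (at_right 0)"
proof -
  define V where "V x = (integral {0..x} a / x, integral {0..x} b / x, integral {0..x} c / x)" for x
  define V0 where "V0 = ((cmod \<zeta>)\<^sup>2 / ((cmod \<zeta>)\<^sup>2 + 1), - Re \<zeta> / ((cmod \<zeta>)\<^sup>2 + 1), 1 / ((cmod \<zeta>)\<^sup>2 + 1))"
  have "(V \<longlongrightarrow> V0) (at_right 0)"
  proof (rule ccontr)
    assume "\<not> (V \<longlongrightarrow> V0) (at_right 0)"
    then obtain e where e: "e > 0" "\<not> (\<forall>\<^sub>F x in at_right 0. dist (V x) V0 < e)"
      unfolding tendsto_iff by blast
    have "\<exists>x>0. x < inverse (real (Suc n)) \<and> e \<le> dist (V x) V0" for n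
    proof (rule ccontr)
      assume "\<not> (\<exists>x>0. x < inverse (real (Suc n)) \<and> e \<le> dist (V x) V0)"
      then have "\<forall>\<^sub>F x in at_right 0. dist (V x) V0 < e"
        unfolding eventually_at_right_field by (intro exI[of _ "inverse (real (Suc n))"]) (auto simp: not_le)
      with e(2) show False by contradiction
    qed
    then obtain x where x: "\<And>n. 0 < x n" "\<And>n. x n < inverse (real (Suc n))" "\<And>n. e \<le> dist (V (x n)) V0"
      by metis
    have xlim: "x \<longlonglongrightarrow> 0"
      by (rule tendsto_sandwich[OF _ _ tendsto_const LIMSEQ_inverse_real_of_nat])
         (intro always_eventually allI less_imp_le x(1,2))+
    have "V (x n) \<in> {-1..1} \<times> {-1..1} \<times> {-1..1}" for n
    proof -
      have *: "I / x n \<in> {-1..1}" if "\<bar>I\<bar> \<le> x n" for I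
        using that x(1)[of n] by (simp add: pos_le_divide_eq pos_divide_le_eq abs_le_iff)
      show ?thesis unfolding V_def
        using primitive_bounds[OF less_imp_le[OF x(1)], of n] by (intro SigmaI *) simp_all
    qed
    moreover have "compact ({-1..1::real} \<times> {-1..1::real} \<times> {-1..1::real})" by (intro compact_Times compact_Icc)
    ultimately obtain l r where l: "strict_mono (r :: nat \<Rightarrow> nat)" "((\<lambda>n. V (x n)) \<circ> r) \<longlonglongrightarrow> l"
      by (meson seq_compactE compact_imp_seq_compact)
    from l(2) have l2: "(\<lambda>n. V (x (r n))) \<longlonglongrightarrow> l" by (simp add: o_def)
    obtain a1 b1 c1 where l_eq: "l = (a1, b1, c1)" by (cases l) auto
    have xr: "(\<lambda>n. x (r n)) \<longlonglongrightarrow> 0" using LIMSEQ_subseq_LIMSEQ[OF xlim l(1)] by (simp add: o_def)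
    have lim: "(\<lambda>n. integral {0..x (r n)} a / x (r n)) \<longlonglongrightarrow> a1"
      "(\<lambda>n. integral {0..x (r n)} b / x (r n)) \<longlonglongrightarrow> b1" "(\<lambda>n. integral {0..x (r n)} c / x (r n)) \<longlonglongrightarrow> c1"
      using tendsto_fst[OF l2] tendsto_fst[OF tendsto_snd[OF l2]] tendsto_snd[OF tendsto_snd[OF l2]]
      by (simp_all add: V_def l_eq)
    have root: "of_real a1 + 2 * of_real b1 * \<zeta> + of_real c1 * \<zeta>\<^sup>2 = 0"
      by (rule limit_form_root[OF \<zeta> x(1) xr lim])
    have tr: "a1 + c1 = 1"
    proof (rule LIMSEQ_unique[OF tendsto_add[OF lim(1,3)]])
      have "integral {0..x (r n)} a / x (r n) + integral {0..x (r n)} c / x (r n) = 1" for n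
        using primitive_trace[OF less_imp_le[OF x(1)], of "r n"] x(1)[of "r n"] by (simp add: add_divide_distrib[symmetric])
      then show "(\<lambda>n. integral {0..x (r n)} a / x (r n) + integral {0..x (r n)} c / x (r n)) \<longlonglongrightarrow> 1" by simp
    qed
    have psd: "0 \<le> a1 + 2 * s * b1 + s\<^sup>2 * c1" for s
    proof (rule tendsto_lowerbound)
      show "(\<lambda>n. integral {0..x (r n)} a / x (r n) + 2 * s * (integral {0..x (r n)} b / x (r n)) + s\<^sup>2 * (integral {0..x (r n)} c / x (r n)))
          \<longlonglongrightarrow> a1 + 2 * s * b1 + s\<^sup>2 * c1" by (intro tendsto_intros lim)
      have "0 \<le> (integral {0..x (r n)} a + 2 * s * integral {0..x (r n)} b + s\<^sup>2 * integral {0..x (r n)} c) / x (r n)" for n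
        using primitive_psd[OF less_imp_le[OF x(1)], of "r n" s] x(1)[of "r n"] by simp
      then show "\<forall>\<^sub>F n in sequentially. 0 \<le> integral {0..x (r n)} a / x (r n) + 2 * s * (integral {0..x (r n)} b / x (r n)) + s\<^sup>2 * (integral {0..x (r n)} c / x (r n))"
        by (intro always_eventually allI) (simp add: add_divide_distrib)
    qed simp
    have "l = V0" unfolding l_eq V0_def using quadratic_root_determines_form[OF root tr psd] by simp
    then have "(\<lambda>n. dist (V (x (r n))) V0) \<longlonglongrightarrow> 0" using tendsto_dist[OF l2 tendsto_const[of V0]] by simp
    then have "e \<le> 0" 
      by (rule tendsto_lowerbound) (intro always_eventually allI x(3), simp)
    then show False using e(1) by simp
  qed
  note lims = tendsto_fst[OF this] tendsto_fst[OF tendsto_snd[OF this]] tendsto_snd[OF tendsto_snd[OF this]]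
  show "((\<lambda>x. integral {0..x} a / x) \<longlongrightarrow> (cmod \<zeta>)\<^sup>2 / ((cmod \<zeta>)\<^sup>2 + 1)) (at_right 0)"
    "((\<lambda>x. integral {0..x} b / x) \<longlongrightarrow> - Re \<zeta> / ((cmod \<zeta>)\<^sup>2 + 1)) (at_right 0)"
    "((\<lambda>x. integral {0..x} c / x) \<longlongrightarrow> 1 / ((cmod \<zeta>)\<^sup>2 + 1)) (at_right 0)"
    by (fact lims[unfolded V_def V0_def fst_conv snd_conv])+
qed

end

section \<open>From the matrix formulation to components\<close>

text \<open>For rows (a, b) and (b, c) the form takes the values a det A and c det A at (-b, a) and
  (c, -b). Adding them with a + c = 1 gives det A >= 0 without a case distinction on a = 0.\<close>

lemma pos_semidef_2_entries:
  fixes A :: "real^2^2"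
  assumes A: "pos_semidef A" and tr: "A $ 1 $ 1 + A $ 2 $ 2 = 1"
  shows "0 \<le> A $ 1 $ 1" "0 \<le> A $ 2 $ 2" "(A $ 1 $ 2)\<^sup>2 \<le> A $ 1 $ 1 * A $ 2 $ 2"
proof -
  have sym: "A $ 2 $ 1 = A $ 1 $ 2"
  proof -
    have "transpose A $ 2 $ 1 = A $ 1 $ 2" by (simp add: transpose_def)
    moreover have "transpose A = A" using A unfolding pos_semidef_def by (rule conjunct1)
    ultimately show ?thesis by (simp only:)
  qed
  have q: "0 \<le> s\<^sup>2 * A $ 1 $ 1 + 2 * s * t * A $ 1 $ 2 + t\<^sup>2 * A $ 2 $ 2" for s t :: real
  proof -
    have "0 \<le> (vector [s, t] :: real^2) \<bullet> (A *v vector [s, t])" using A unfolding pos_semidef_def by blast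
    also have "\<dots> = s\<^sup>2 * A $ 1 $ 1 + 2 * s * t * A $ 1 $ 2 + t\<^sup>2 * A $ 2 $ 2"
      by (simp add: inner_vec_def matrix_vector_mult_def sum_2 vector_2 sym power2_eq_square algebra_simps)
    finally show ?thesis .
  qed
  show "0 \<le> A $ 1 $ 1" "0 \<le> A $ 2 $ 2" using q[of 1 0] q[of 0 1] by simp_all
  define d where "d = A $ 1 $ 1 * A $ 2 $ 2 - (A $ 1 $ 2)\<^sup>2"
  have "0 \<le> A $ 1 $ 1 * d" "0 \<le> A $ 2 $ 2 * d"
    using q[of "- (A $ 1 $ 2)" "A $ 1 $ 1"] q[of "A $ 2 $ 2" "- (A $ 1 $ 2)"]
    by (simp_all add: d_def power2_eq_square algebra_simps)
  then have "0 \<le> (A $ 1 $ 1 + A $ 2 $ 2) * d" by (simp add: algebra_simps)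
  then show "(A $ 1 $ 2)\<^sup>2 \<le> A $ 1 $ 1 * A $ 2 $ 2" unfolding tr d_def by simp
qed

lemma J_mult: "(J *v v) $ 1 = - v $ 2" "(J *v v) $ 2 = v $ 1"
  by (simp_all add: J_def matrix_vector_mult_def sum_2 vector_2)

lemma hamiltonian_sym:
  assumes "hamiltonian H" "0 \<le> x"
  shows "H x $ 2 $ 1 = H x $ 1 $ 2"
proof -
  have "transpose (H x) $ 2 $ 1 = H x $ 1 $ 2" by (simp add: transpose_def)
  moreover have "transpose (H x) = H x" using assms unfolding hamiltonian_def by blast
  ultimately show ?thesis by (simp only:)
qed

lemma hamiltonian_trace_normed_system:
  assumes H: "hamiltonian H" and tr: "trace_normed H"
  shows "trace_normed_system (\<lambda>x. H x $ 1 $ 1) (\<lambda>x. H x $ 1 $ 2) (\<lambda>x. H x $ 2 $ 2)"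
proof
  show "(\<lambda>x. H x $ 1 $ 1) absolutely_integrable_on {0..R}" "(\<lambda>x. H x $ 1 $ 2) absolutely_integrable_on {0..R}"
    "(\<lambda>x. H x $ 2 $ 2) absolutely_integrable_on {0..R}" if "0 \<le> R" for R
    using H that unfolding hamiltonian_def by blast+
  have "AE x\<in>{0..} in lebesgue. pos_semidef (H x) \<and> H x \<noteq> 0" using H unfolding hamiltonian_def by blast
  then show "AE x\<in>{0..} in lebesgue. 0 \<le> H x $ 1 $ 1 \<and> 0 \<le> H x $ 2 $ 2 \<and>
      (H x $ 1 $ 2)\<^sup>2 \<le> H x $ 1 $ 1 * H x $ 2 $ 2 \<and> H x $ 1 $ 1 + H x $ 2 $ 2 = 1"
    using tr unfolding trace_normed_def
  proof eventually_elim
    case (elim x)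
    show ?case
    proof
      assume x: "x \<in> {0..}"
      have "pos_semidef (H x)" and t: "H x $ 1 $ 1 + H x $ 2 $ 2 = 1" using elim x by simp_all
      from pos_semidef_2_entries[OF this] t
      show "0 \<le> H x $ 1 $ 1 \<and> 0 \<le> H x $ 2 $ 2 \<and>
        (H x $ 1 $ 2)\<^sup>2 \<le> H x $ 1 $ 1 * H x $ 2 $ 2 \<and> H x $ 1 $ 1 + H x $ 2 $ 2 = 1" by (intro conjI)
    qed
  qed
qed

lemma canonical_solution_components:
  assumes H: "hamiltonian H" and tr: "trace_normed H" and Y: "canonical_solution H z Y"
  shows "trace_normed_system.solution (\<lambda>x. H x $ 1 $ 1) (\<lambda>x. H x $ 1 $ 2) (\<lambda>x. H x $ 2 $ 2)
           z (\<lambda>x. Y x $ 1) (\<lambda>x. Y x $ 2)"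
proof -
  interpret trace_normed_system "\<lambda>x. H x $ 1 $ 1" "\<lambda>x. H x $ 1 $ 2" "\<lambda>x. H x $ 2 $ 2"
    by (rule hamiltonian_trace_normed_system[OF H tr])
  have ac: "\<And>R. 0 \<le> R \<Longrightarrow> abs_continuous_on {0..R} Y"
    and ae: "AE x\<in>{0..} in lebesgue. \<exists>Y'. (Y has_vector_derivative Y') (at x within {0..}) \<and>
        J *v Y' = z *s (cmatrix (H x) *v Y x)"
    using Y unfolding canonical_solution_def by blast+
  show ?thesis
    unfolding solution_def
  proof (intro conjI allI impI)
    fix R :: real assume "0 \<le> R"
    then show "abs_continuous_on {0..R} (\<lambda>x. Y x $ 1)" "abs_continuous_on {0..R} (\<lambda>x. Y x $ 2)"
      by (intro abs_continuous_on_bounded_linear[OF bounded_linear_vec_nth] ac; assumption)+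
  next
    show "AE x\<in>{0..} in lebesgue.
        ((\<lambda>x. Y x $ 1) has_vector_derivative z * (of_real (H x $ 1 $ 2) * Y x $ 1 + of_real (H x $ 2 $ 2) * Y x $ 2)) (at x within {0..}) \<and>
        ((\<lambda>x. Y x $ 2) has_vector_derivative - z * (of_real (H x $ 1 $ 1) * Y x $ 1 + of_real (H x $ 1 $ 2) * Y x $ 2)) (at x within {0..})"
      using ae
    proof eventually_elim
      case (elim x)
      show ?case
      proof
        assume x: "x \<in> {0..}"
        obtain Y' where Y': "(Y has_vector_derivative Y') (at x within {0..})" "J *v Y' = z *s (cmatrix (H x) *v Y x)"
          using elim x by blast
        have sym: "H x $ 2 $ 1 = H x $ 1 $ 2" using hamiltonian_sym[OF H] x by simp
        have "- Y' $ 2 = z * (of_real (H x $ 1 $ 1) * Y x $ 1 + of_real (H x $ 1 $ 2) * Y x $ 2)"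
          unfolding J_mult(1)[of Y', symmetric] Y'(2) by (simp add: matrix_vector_mult_def sum_2 map_matrix_def)
        from arg_cong[OF this, of uminus]
        have 2: "Y' $ 2 = - z * (of_real (H x $ 1 $ 1) * Y x $ 1 + of_real (H x $ 1 $ 2) * Y x $ 2)"
          unfolding minus_minus mult_minus_left .
        have 1: "Y' $ 1 = z * (of_real (H x $ 1 $ 2) * Y x $ 1 + of_real (H x $ 2 $ 2) * Y x $ 2)"
          unfolding J_mult(2)[of Y', symmetric] Y'(2) by (simp add: matrix_vector_mult_def sum_2 map_matrix_def sym)
        show "((\<lambda>x. Y x $ 1) has_vector_derivative z * (of_real (H x $ 1 $ 2) * Y x $ 1 + of_real (H x $ 2 $ 2) * Y x $ 2)) (at x within {0..}) \<and>
          ((\<lambda>x. Y x $ 2) has_vector_derivative - z * (of_real (H x $ 1 $ 1) * Y x $ 1 + of_real (H x $ 1 $ 2) * Y x $ 2)) (at x within {0..})"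
          using bounded_linear.has_vector_derivative[OF bounded_linear_vec_nth Y'(1), of 1]
            bounded_linear.has_vector_derivative[OF bounded_linear_vec_nth Y'(1), of 2]
          unfolding 1 2 by blast
      qed
    qed
  qed
qed

text \<open>The place where square integrability enters: the integrand f*Hf is the energy density of
  \<theta> + m \<phi>, so \<open>weyl_flux_nonneg\<close> applies.\<close>

lemma m_function_weyl_system:
  assumes H: "hamiltonian H" and tr: "trace_normed H" and U: "fundamental_solution H U" and m: "m_function H U m"
  shows "weyl_system (\<lambda>x. H x $ 1 $ 1) (\<lambda>x. H x $ 1 $ 2) (\<lambda>x. H x $ 2 $ 2)
           (\<lambda>z x. U z x $ 1 $ 1) (\<lambda>z x. U z x $ 2 $ 1) (\<lambda>z x. U z x $ 1 $ 2) (\<lambda>z x. U z x $ 2 $ 2) m"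
proof -
  interpret trace_normed_system "\<lambda>x. H x $ 1 $ 1" "\<lambda>x. H x $ 1 $ 2" "\<lambda>x. H x $ 2 $ 2"
    by (rule hamiltonian_trace_normed_system[OF H tr])
  have col: "canonical_solution H z (\<lambda>x. column j (U z x))" and U0: "U z 0 = mat 1" for z j
    using U unfolding fundamental_solution_def by blast+
  have sol: "solution z (\<lambda>x. U z x $ 1 $ j) (\<lambda>x. U z x $ 2 $ j)" for z j
    using canonical_solution_components[OF H tr col[of z j]] by (simp add: column_def)
  show ?thesis
  proof unfold_locales
    show "solution z (\<lambda>x. U z x $ 1 $ 1) (\<lambda>x. U z x $ 2 $ 1)" "solution z (\<lambda>x. U z x $ 1 $ 2) (\<lambda>x. U z x $ 2 $ 2)" for z
      by (rule sol)+
    show "U z 0 $ 1 $ 1 = 1" "U z 0 $ 2 $ 1 = 0" "U z 0 $ 1 $ 2 = 0" "U z 0 $ 2 $ 2 = 1" for z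
      by (simp_all add: U0 mat_def)
    fix z x assume z: "0 < Im z" and x: "(0::real) \<le> x"
    define f1 where "f1 x = U z x $ 1 $ 1 + m z * U z x $ 1 $ 2" for x
    define f2 where "f2 x = U z x $ 2 $ 1 + m z * U z x $ 2 $ 2" for x
    have "z \<notin> \<real>" using z by (auto elim!: Reals_cases)
    then have L2: "(\<integral>\<^sup>+x\<in>{0..}. ennreal (Re (\<Sum>i\<in>UNIV. cnj ((U z x *v vector [1, m z]) $ i) * (cmatrix (H x) *v (U z x *v vector [1, m z])) $ i)) \<partial>lebesgue) < \<infinity>"
      using m unfolding m_function_def in_L2_def by blast
    have "Re (\<Sum>i\<in>UNIV. cnj ((U z x *v vector [1, m z]) $ i) * (cmatrix (H x) *v (U z x *v vector [1, m z])) $ i)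
        = energy_density (H x $ 1 $ 1) (H x $ 1 $ 2) (H x $ 2 $ 2) (f1 x) (f2 x)" if "x \<in> {0..}" for x
    proof -
      have sym: "H x $ 2 $ 1 = H x $ 1 $ 2" using hamiltonian_sym[OF H] that by simp
      have f: "(U z x *v vector [1, m z]) $ 1 = f1 x" "(U z x *v vector [1, m z]) $ 2 = f2 x"
        by (simp_all add: f1_def f2_def matrix_vector_mult_def sum_2 vector_2 mult.commute)
      have HM: "(cmatrix (H x) *v v) $ 1 = of_real (H x $ 1 $ 1) * v $ 1 + of_real (H x $ 1 $ 2) * v $ 2"
        "(cmatrix (H x) *v v) $ 2 = of_real (H x $ 1 $ 2) * v $ 1 + of_real (H x $ 2 $ 2) * v $ 2" for v
        by (simp_all add: matrix_vector_mult_def sum_2 map_matrix_def sym)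
      show ?thesis unfolding sum_2 HM f energy_density_def cmod_power2
        by (simp add: power2_eq_square algebra_simps)
    qed
    then have "(\<integral>\<^sup>+x\<in>{0..}. ennreal (energy_density (H x $ 1 $ 1) (H x $ 1 $ 2) (H x $ 2 $ 2) (f1 x) (f2 x)) \<partial>lebesgue)
       = (\<integral>\<^sup>+x\<in>{0..}. ennreal (Re (\<Sum>i\<in>UNIV. cnj ((U z x *v vector [1, m z]) $ i) * (cmatrix (H x) *v (U z x *v vector [1, m z])) $ i)) \<partial>lebesgue)"
      by (intro nn_integral_cong) (auto simp: indicator_def)
    with L2 have L2': "(\<integral>\<^sup>+x\<in>{0..}. ennreal (energy_density (H x $ 1 $ 1) (H x $ 1 $ 2) (H x $ 2 $ 2) (f1 x) (f2 x)) \<partial>lebesgue) < \<infinity>"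
      by simp
    have "solution z f1 f2"
      unfolding f1_def[abs_def] f2_def[abs_def] by (rule solution_linear[OF sol sol])
    from weyl_flux_nonneg[OF this z L2' x]
    show "0 \<le> Im (cnj (U z x $ 1 $ 1 + m z * U z x $ 1 $ 2) * (U z x $ 2 $ 1 + m z * U z x $ 2 $ 2))"
      unfolding f1_def f2_def .
  qed
qed

text \<open>Passes from the Lebesgue integral of the matrix to gauge integrals of its entries;
  symmetry of H reduces four limits to three.\<close>

lemma mean_tendsto_iff:
  assumes H: "hamiltonian H"
  shows "mean_tendsto H (vector [vector [a\<^sub>0, b\<^sub>0], vector [b\<^sub>0, c\<^sub>0]]) \<longleftrightarrow>
     ((\<lambda>x. integral {0..x} (\<lambda>t. H t $ 1 $ 1) / x) \<longlongrightarrow> a\<^sub>0) (at_right 0) \<and>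
     ((\<lambda>x. integral {0..x} (\<lambda>t. H t $ 1 $ 2) / x) \<longlongrightarrow> b\<^sub>0) (at_right 0) \<and>
     ((\<lambda>x. integral {0..x} (\<lambda>t. H t $ 2 $ 2) / x) \<longlongrightarrow> c\<^sub>0) (at_right 0)"
proof -
  define M where "M x = (1 / x) *\<^sub>R (LINT t:{0..x}|lebesgue. H t)" for x :: real
  define V :: "real^2^2" where "V = vector [vector [a\<^sub>0, b\<^sub>0], vector [b\<^sub>0, c\<^sub>0]]"
  have V: "V $ 1 $ 1 = a\<^sub>0" "V $ 1 $ 2 = b\<^sub>0" "V $ 2 $ 1 = b\<^sub>0" "V $ 2 $ 2 = c\<^sub>0"
    by (simp_all add: V_def vector_2)
  have M: "M x $ i $ j = integral {0..x} (\<lambda>t. H t $ i $ j) / x" if x: "0 < x" for x i j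
  proof -
    have comp: "(\<lambda>t. H t $ i $ j) absolutely_integrable_on {0..x}" for i j
      using H x unfolding hamiltonian_def by (meson less_imp_le)
    have ai: "H absolutely_integrable_on {0..x}"
    proof (rule absolutely_integrable_componentwise)
      fix u :: "real^2^2" assume "u \<in> Basis"
      then obtain i j where "u = axis i (axis j 1)" by (auto simp: Basis_vec_def)
      then show "(\<lambda>t. H t \<bullet> u) absolutely_integrable_on {0..x}" using comp by (simp add: inner_axis)
    qed
    have int: "H integrable_on {0..x}" using ai by (simp add: absolutely_integrable_on_def)
    have int2: "(\<lambda>t. H t $ i) integrable_on {0..x}"
      using integrable_linear[OF int bounded_linear_vec_nth[of i]] by (simp add: o_def)
    have "M x $ i $ j = (1 / x) * (integral {0..x} H $ i $ j)"
      unfolding M_def set_lebesgue_integral_eq_integral(2)[OF ai] by simp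
    also have "integral {0..x} H $ i $ j = integral {0..x} (\<lambda>t. H t $ i $ j)"
      using integral_linear[OF int bounded_linear_vec_nth[of i]] integral_linear[OF int2 bounded_linear_vec_nth[of j]]
      by (simp add: o_def)
    finally show ?thesis by simp
  qed
  have entry: "((\<lambda>x. M x $ i $ j) \<longlongrightarrow> l) (at_right 0) \<longleftrightarrow> ((\<lambda>x. integral {0..x} (\<lambda>t. H t $ i $ j) / x) \<longlongrightarrow> l) (at_right 0)" for i j l
    by (rule tendsto_cong, rule eventually_mono[OF eventually_at_right_less[of 0]]) (rule M)
  have sym: "integral {0..x} (\<lambda>t. H t $ 2 $ 1) = integral {0..x} (\<lambda>t. H t $ 1 $ 2)" for x
    by (intro integral_cong) (simp add: hamiltonian_sym[OF H])
  have "mean_tendsto H V \<longleftrightarrow> (M \<longlongrightarrow> V) (at_right 0)" by (simp add: mean_tendsto_def M_def[abs_def])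
  also have "\<dots> \<longleftrightarrow> (\<forall>i j. ((\<lambda>x. M x $ i $ j) \<longlongrightarrow> V $ i $ j) (at_right 0))"
  proof
    show "\<forall>i j. ((\<lambda>x. M x $ i $ j) \<longlongrightarrow> V $ i $ j) (at_right 0)" if "(M \<longlongrightarrow> V) (at_right 0)"
      by (intro allI tendsto_vec_nth that)
    show "(M \<longlongrightarrow> V) (at_right 0)" if "\<forall>i j. ((\<lambda>x. M x $ i $ j) \<longlongrightarrow> V $ i $ j) (at_right 0)"
      by (intro vec_tendstoI) (use that in blast)
  qed
  also have "\<dots> \<longleftrightarrow> ((\<lambda>x. integral {0..x} (\<lambda>t. H t $ 1 $ 1) / x) \<longlongrightarrow> a\<^sub>0) (at_right 0) \<and>
     ((\<lambda>x. integral {0..x} (\<lambda>t. H t $ 1 $ 2) / x) \<longlongrightarrow> b\<^sub>0) (at_right 0) \<and>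
     ((\<lambda>x. integral {0..x} (\<lambda>t. H t $ 2 $ 2) / x) \<longlongrightarrow> c\<^sub>0) (at_right 0)"
    unfolding entry forall_2 V sym by blast
  finally show ?thesis unfolding V_def .
qed

text \<open>A single ray suffices to compare the limits; the imaginary axis is taken.\<close>

lemma tendsto_in_sectors_unique:
  assumes "tendsto_in_sectors m \<zeta>" "tendsto_in_sectors m \<zeta>'"
  shows "\<zeta> = \<zeta>'"
proof -
  have x: "\<And>n. 0 < inverse (real (Suc n))" "(\<lambda>n. inverse (real (Suc n))) \<longlonglongrightarrow> 0"
    by (simp, rule LIMSEQ_inverse_real_of_nat)
  have i: "0 < Im \<i>" by simp
  show ?thesis
    by (rule LIMSEQ_unique[OF tendsto_along_ray[OF assms(1) i x] tendsto_along_ray[OF assms(2) i x]])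
qed

section \<open>The equivalence and the relations between the constants\<close>

theorem theorem3p1:
  fixes H :: "real \<Rightarrow> real^2^2"
    and U :: "complex \<Rightarrow> real \<Rightarrow> complex^2^2"
    and m :: "complex \<Rightarrow> complex"
  assumes "hamiltonian H"
    and "trace_normed H"
    and "fundamental_solution H U"
    and "m_function H U m"
  shows "((\<exists>a\<^sub>0 b\<^sub>0 c\<^sub>0 :: real. a\<^sub>0 \<ge> 0 \<and> c\<^sub>0 > 0 \<and> a\<^sub>0 * c\<^sub>0 - b\<^sub>0\<^sup>2 \<ge> 0 \<and>
              mean_tendsto H (vector [vector [a\<^sub>0, b\<^sub>0], vector [b\<^sub>0, c\<^sub>0]]))
          \<longleftrightarrow> (\<exists>\<zeta>\<^sub>0. Im \<zeta>\<^sub>0 \<ge> 0 \<and> tendsto_in_sectors m \<zeta>\<^sub>0))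
       \<and> (\<forall>(a\<^sub>0::real) (b\<^sub>0::real) (c\<^sub>0::real) (\<zeta>\<^sub>0::complex).
            a\<^sub>0 \<ge> 0 \<and> c\<^sub>0 > 0 \<and> a\<^sub>0 * c\<^sub>0 - b\<^sub>0\<^sup>2 \<ge> 0 \<and>
            mean_tendsto H (vector [vector [a\<^sub>0, b\<^sub>0], vector [b\<^sub>0, c\<^sub>0]]) \<and>
            Im \<zeta>\<^sub>0 \<ge> 0 \<and> tendsto_in_sectors m \<zeta>\<^sub>0 \<longrightarrow>
            (let h\<^sub>0 = sqrt (a\<^sub>0 * c\<^sub>0 - b\<^sub>0\<^sup>2) in
               \<zeta>\<^sub>0 = (\<i> * complex_of_real h\<^sub>0 - complex_of_real b\<^sub>0) / complex_of_real c\<^sub>0 \<and>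
               a\<^sub>0 = (norm \<zeta>\<^sub>0)\<^sup>2 / ((norm \<zeta>\<^sub>0)\<^sup>2 + 1) \<and>
               b\<^sub>0 = - Re \<zeta>\<^sub>0 / ((norm \<zeta>\<^sub>0)\<^sup>2 + 1) \<and>
               c\<^sub>0 = 1 / ((norm \<zeta>\<^sub>0)\<^sup>2 + 1)))"
proof -
  interpret weyl_system "\<lambda>x. H x $ 1 $ 1" "\<lambda>x. H x $ 1 $ 2" "\<lambda>x. H x $ 2 $ 2"
    "\<lambda>z x. U z x $ 1 $ 1" "\<lambda>z x. U z x $ 2 $ 1" "\<lambda>z x. U z x $ 1 $ 2" "\<lambda>z x. U z x $ 2 $ 2" m
    by (rule m_function_weyl_system[OF assms])
  have forward: "tendsto_in_sectors m ((\<i> * complex_of_real (sqrt (a0 * c0 - b0\<^sup>2)) - complex_of_real b0) / complex_of_real c0)"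
    if "c0 > 0" "a0 * c0 - b0\<^sup>2 \<ge> 0" "mean_tendsto H (vector [vector [a0, b0], vector [b0, c0]])" for a0 b0 c0
    using that(3) unfolding mean_tendsto_iff[OF assms(1)]
    by (intro tendsto_in_sectors_if_means_converge[where ?a0.0 = a0 and ?b0.0 = b0 and ?c0.0 = c0 and h = "sqrt (a0 * c0 - b0\<^sup>2)"])
       (use that(1,2) in simp_all)
  have backward: "mean_tendsto H (vector [vector [(norm \<zeta>)\<^sup>2 / ((norm \<zeta>)\<^sup>2 + 1), - Re \<zeta> / ((norm \<zeta>)\<^sup>2 + 1)],
      vector [- Re \<zeta> / ((norm \<zeta>)\<^sup>2 + 1), 1 / ((norm \<zeta>)\<^sup>2 + 1)]])"
    if "Im \<zeta> \<ge> 0" "tendsto_in_sectors m \<zeta>" for \<zeta>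
    unfolding mean_tendsto_iff[OF assms(1)] using means_converge_if_tendsto_in_sectors[OF that] by blast
  show ?thesis
  proof (intro conjI iffI allI impI)
    assume "\<exists>a\<^sub>0 b\<^sub>0 c\<^sub>0 :: real. a\<^sub>0 \<ge> 0 \<and> c\<^sub>0 > 0 \<and> a\<^sub>0 * c\<^sub>0 - b\<^sub>0\<^sup>2 \<ge> 0 \<and>
              mean_tendsto H (vector [vector [a\<^sub>0, b\<^sub>0], vector [b\<^sub>0, c\<^sub>0]])"
    then obtain a0 b0 c0 where *: "c0 > 0" "a0 * c0 - b0\<^sup>2 \<ge> 0" "mean_tendsto H (vector [vector [a0, b0], vector [b0, c0]])"
      by blast
    have "Im ((\<i> * complex_of_real (sqrt (a0 * c0 - b0\<^sup>2)) - complex_of_real b0) / complex_of_real c0) \<ge> 0"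
      using *(1,2) by simp
    with forward[OF *] show "\<exists>\<zeta>\<^sub>0. Im \<zeta>\<^sub>0 \<ge> 0 \<and> tendsto_in_sectors m \<zeta>\<^sub>0" by blast
  next
    assume "\<exists>\<zeta>\<^sub>0. Im \<zeta>\<^sub>0 \<ge> 0 \<and> tendsto_in_sectors m \<zeta>\<^sub>0"
    then obtain \<zeta> where \<zeta>: "Im \<zeta> \<ge> 0" "tendsto_in_sectors m \<zeta>" by blast
    define n where "n = (norm \<zeta>)\<^sup>2 + 1"
    have n: "n > 0" by (simp add: n_def add_nonneg_pos)
    \<comment> \<open>The determinant of the limit matrix is a square, which gives the inequality
      demanded in the first condition.\<close>
    have "(norm \<zeta>)\<^sup>2 / n * (1 / n) - (- Re \<zeta> / n)\<^sup>2 = (Im \<zeta> / n)\<^sup>2"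
      unfolding cmod_power2 by (simp add: power_divide power2_eq_square add_divide_distrib)
    then have "(norm \<zeta>)\<^sup>2 / n * (1 / n) - (- Re \<zeta> / n)\<^sup>2 \<ge> 0" by simp
    with backward[OF \<zeta>] n show "\<exists>a\<^sub>0 b\<^sub>0 c\<^sub>0 :: real. a\<^sub>0 \<ge> 0 \<and> c\<^sub>0 > 0 \<and> a\<^sub>0 * c\<^sub>0 - b\<^sub>0\<^sup>2 \<ge> 0 \<and>
              mean_tendsto H (vector [vector [a\<^sub>0, b\<^sub>0], vector [b\<^sub>0, c\<^sub>0]])"
      unfolding n_def[symmetric]
      by (intro exI[of _ "(norm \<zeta>)\<^sup>2 / n"] exI[of _ "- Re \<zeta> / n"] exI[of _ "1 / n"]) simp
  next
    fix a0 b0 c0 :: real and \<zeta> :: complex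
    assume *: "a0 \<ge> 0 \<and> c0 > 0 \<and> a0 * c0 - b0\<^sup>2 \<ge> 0 \<and>
            mean_tendsto H (vector [vector [a0, b0], vector [b0, c0]]) \<and>
            Im \<zeta> \<ge> 0 \<and> tendsto_in_sectors m \<zeta>"
    have \<zeta>: "\<zeta> = (\<i> * complex_of_real (sqrt (a0 * c0 - b0\<^sup>2)) - complex_of_real b0) / complex_of_real c0"
      using * by (intro tendsto_in_sectors_unique[OF _ forward]) simp_all
    \<comment> \<open>The means have the given limit and, by \<open>backward\<close>, the one
      computed from \<zeta>; uniqueness of limits allows comparing entries.\<close>
    have l: "vector [vector [a0, b0], vector [b0, c0]] = (vector [vector [(norm \<zeta>)\<^sup>2 / ((norm \<zeta>)\<^sup>2 + 1), - Re \<zeta> / ((norm \<zeta>)\<^sup>2 + 1)],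
      vector [- Re \<zeta> / ((norm \<zeta>)\<^sup>2 + 1), 1 / ((norm \<zeta>)\<^sup>2 + 1)]] :: real^2^2)"
    proof (rule tendsto_unique[OF trivial_limit_at_right_real])
      show "((\<lambda>x. (1 / x) *\<^sub>R (LINT t:{0..x}|lebesgue. H t)) \<longlongrightarrow> vector [vector [a0, b0], vector [b0, c0]]) (at_right 0)"
        using * unfolding mean_tendsto_def by (elim conjE)
      show "((\<lambda>x. (1 / x) *\<^sub>R (LINT t:{0..x}|lebesgue. H t)) \<longlongrightarrow> vector [vector [(norm \<zeta>)\<^sup>2 / ((norm \<zeta>)\<^sup>2 + 1), - Re \<zeta> / ((norm \<zeta>)\<^sup>2 + 1)],
          vector [- Re \<zeta> / ((norm \<zeta>)\<^sup>2 + 1), 1 / ((norm \<zeta>)\<^sup>2 + 1)]]) (at_right 0)"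
        using * by (intro backward[unfolded mean_tendsto_def]) simp_all
    qed
    have "a0 = (norm \<zeta>)\<^sup>2 / ((norm \<zeta>)\<^sup>2 + 1)" "b0 = - Re \<zeta> / ((norm \<zeta>)\<^sup>2 + 1)" "c0 = 1 / ((norm \<zeta>)\<^sup>2 + 1)"
      using arg_cong[OF l, of "\<lambda>A. A $ 1 $ 1"] arg_cong[OF l, of "\<lambda>A. A $ 1 $ 2"] arg_cong[OF l, of "\<lambda>A. A $ 2 $ 2"]
      by (simp_all add: vector_2)
    with \<zeta> show "let h\<^sub>0 = sqrt (a0 * c0 - b0\<^sup>2) in
               \<zeta> = (\<i> * complex_of_real h\<^sub>0 - complex_of_real b0) / complex_of_real c0 \<and>
               a0 = (norm \<zeta>)\<^sup>2 / ((norm \<zeta>)\<^sup>2 + 1) \<and>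
               b0 = - Re \<zeta> / ((norm \<zeta>)\<^sup>2 + 1) \<and>
               c0 = 1 / ((norm \<zeta>)\<^sup>2 + 1)"
      unfolding Let_def by blast
  qed
qed

end
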